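(* Let $\Omega\subset B(0,R)$ be a nonempty bounded open subset of $\mathbb{R}^N$ with boundary $\Gamma$, let $0<m<1$, and let $(\boldsymbol{a},\boldsymbol{b},\boldsymbol{c})\in\mathbb{C}^3$ with $\Im(\boldsymbol{a})\le0$, $\Im(\boldsymbol{b})<0$, $\Im(\boldsymbol{c})\le0$; if $\Re(\boldsymbol{a})\le0$ assume moreover $\Im(\boldsymbol{a})<0$. Let $\boldsymbol{G}\in L^1_{loc}(\Omega)$, let $\boldsymbol{g}\in H^1_{loc}(\Omega)$ be a local weak solution of $$-\Delta\boldsymbol{g}+\boldsymbol{a}|\boldsymbol{g}|^{-(1-m)}\boldsymbol{g}+\boldsymbol{b}\boldsymbol{g}+\boldsymbol{c}|x|^2\boldsymbol{g}=\boldsymbol{G}\quad\text{in }\mathscr{D}'(\Omega),$$ let $x_0\in\Omega$ and $\rho_1>0$; if $\rho_1>\operatorname{dist}(x_0,\Gamma)$ assume moreover $\boldsymbol{g}\in H^1_0(\Omega)$. Let $\rho_0\in(0,\rho_1)$. Then there exist two positive constants $E_\star>0$ and $\varepsilon_\star>0$ such that, if $\|\nabla\boldsymbol{g}\|^2_{L^2(\Omega\cap B(x_0,\rho_1))}<E_\star$ and $$\forall\rho\in(0,\rho_1),\quad \|\boldsymbol{G}\|^2_{L^2(\Omega\cap B(x_0,\rho))}\le\varepsilon_\star\big((\rho-\rho_0)_+\big)^p,\qquad p=\frac{2(1+m)+N(1-m)}{1-m},$$ then $\boldsymbol{g}=0$ a.e. on $\Omega\cap B(x_0,\rho_0)$.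
   Context: All functions are complex-valued; $r_+=\max\{0,r\}$; $|\boldsymbol{z}|^{-(1-m)}\boldsymbol{z}:=0$ when $\boldsymbol{z}=0$. A local weak solution is a function $\boldsymbol{g}\in H^1_{loc}(\Omega)$ such that for all $\boldsymbol{\varphi}\in\mathscr{D}(\Omega)$, $\Re\int_\Omega\nabla\boldsymbol{g}\cdot\overline{\nabla\boldsymbol{\varphi}}\,dx+\Re\int_\Omega\big(\boldsymbol{a}|\boldsymbol{g}|^{-(1-m)}\boldsymbol{g}+\boldsymbol{b}\boldsymbol{g}+\boldsymbol{c}|x|^2\boldsymbol{g}\big)\overline{\boldsymbol{\varphi}}\,dx=\Re\int_\Omega\boldsymbol{G}\,\overline{\boldsymbol{\varphi}}\,dx$. $B(x_0,r)$ is the open ball of center $x_0$ and radius $r$. *)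

theory Defs
  imports "HOL-Analysis.Analysis"
begin

coinductive C_inf :: "('a::real_normed_vector \<Rightarrow> 'b::real_normed_vector) \<Rightarrow> bool" where
  "(\<forall>x. f differentiable (at x)) \<Longrightarrow> (\<forall>v. C_inf (\<lambda>x. frechet_derivative f (at x) v))
   \<Longrightarrow> C_inf f"

definition test_fun :: "'a::euclidean_space set \<Rightarrow> ('a \<Rightarrow> complex) \<Rightarrow> bool" where
  "test_fun \<Omega> \<phi> \<longleftrightarrow> C_inf \<phi> \<and> compact (closure {x. \<phi> x \<noteq> 0})
      \<and> closure {x. \<phi> x \<noteq> 0} \<subseteq> \<Omega>"

definition pd :: "('a::euclidean_space \<Rightarrow> complex) \<Rightarrow> 'a \<Rightarrow> 'a \<Rightarrow> complex" where
  "pd \<phi> i x = frechet_derivative \<phi> (at x) i"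

definition L1_loc :: "'a::euclidean_space set \<Rightarrow> ('a \<Rightarrow> complex) \<Rightarrow> bool" where
  "L1_loc \<Omega> f \<longleftrightarrow> set_borel_measurable lebesgue \<Omega> f \<and>
     (\<forall>K. compact K \<and> K \<subseteq> \<Omega> \<longrightarrow> set_integrable lebesgue K f)"

definition L2_loc :: "'a::euclidean_space set \<Rightarrow> ('a \<Rightarrow> complex) \<Rightarrow> bool" where
  "L2_loc \<Omega> f \<longleftrightarrow> set_borel_measurable lebesgue \<Omega> f \<and>
     (\<forall>K. compact K \<and> K \<subseteq> \<Omega> \<longrightarrow> set_integrable lebesgue K (\<lambda>x. (cmod (f x))\<^sup>2))"

definition L2 :: "'a::euclidean_space set \<Rightarrow> ('a \<Rightarrow> complex) \<Rightarrow> bool" where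
  "L2 \<Omega> f \<longleftrightarrow> set_borel_measurable lebesgue \<Omega> f \<and>
     set_integrable lebesgue \<Omega> (\<lambda>x. (cmod (f x))\<^sup>2)"

definition weak_grad :: "'a::euclidean_space set \<Rightarrow> ('a \<Rightarrow> complex) \<Rightarrow> ('a \<Rightarrow> 'a \<Rightarrow> complex) \<Rightarrow> bool" where
  "weak_grad \<Omega> g Dg \<longleftrightarrow> (\<forall>\<phi>. test_fun \<Omega> \<phi> \<longrightarrow> (\<forall>i\<in>Basis.
      (LINT x:\<Omega>|lebesgue. g x * pd \<phi> i x) = - (LINT x:\<Omega>|lebesgue. Dg i x * \<phi> x)))"

definition H1_loc :: "'a::euclidean_space set \<Rightarrow> ('a \<Rightarrow> complex) \<Rightarrow> ('a \<Rightarrow> 'a \<Rightarrow> complex) \<Rightarrow> bool" where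
  "H1_loc \<Omega> g Dg \<longleftrightarrow> L2_loc \<Omega> g \<and> (\<forall>i\<in>Basis. L2_loc \<Omega> (Dg i)) \<and> weak_grad \<Omega> g Dg"

definition H1_0 :: "'a::euclidean_space set \<Rightarrow> ('a \<Rightarrow> complex) \<Rightarrow> ('a \<Rightarrow> 'a \<Rightarrow> complex) \<Rightarrow> bool" where
  "H1_0 \<Omega> g Dg \<longleftrightarrow> L2 \<Omega> g \<and> (\<forall>i\<in>Basis. L2 \<Omega> (Dg i)) \<and> weak_grad \<Omega> g Dg \<and>
     (\<exists>\<phi>::nat \<Rightarrow> 'a \<Rightarrow> complex. (\<forall>k. test_fun \<Omega> (\<phi> k)) \<and>
        ((\<lambda>k. set_nn_integral lebesgue \<Omega> (\<lambda>x. ennreal ((cmod (\<phi> k x - g x))\<^sup>2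
            + (\<Sum>i\<in>Basis. (cmod (pd (\<phi> k) i x - Dg i x))\<^sup>2)))) \<longlonglongrightarrow> 0))"

definition nl :: "real \<Rightarrow> complex \<Rightarrow> complex" where
  "nl m z = (if z = 0 then 0 else complex_of_real (cmod z powr (-(1 - m))) * z)"

definition weak_sol :: "'a::euclidean_space set \<Rightarrow> real \<Rightarrow> complex \<Rightarrow> complex \<Rightarrow> complex
    \<Rightarrow> ('a \<Rightarrow> complex) \<Rightarrow> ('a \<Rightarrow> complex) \<Rightarrow> ('a \<Rightarrow> 'a \<Rightarrow> complex) \<Rightarrow> bool" where
  "weak_sol \<Omega> m a b c G g Dg \<longleftrightarrow> H1_loc \<Omega> g Dg \<and>
     (\<forall>\<phi>. test_fun \<Omega> \<phi> \<longrightarrow>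
        Re (LINT x:\<Omega>|lebesgue. (\<Sum>i\<in>Basis. Dg i x * cnj (pd \<phi> i x)))
      + Re (LINT x:\<Omega>|lebesgue. (a * nl m (g x) + b * g x
              + c * complex_of_real ((norm x)\<^sup>2) * g x) * cnj (\<phi> x))
      = Re (LINT x:\<Omega>|lebesgue. G x * cnj (\<phi> x)))"

end

(* Local energy method on shrinking balls around the centre. Testing the equation with the square of a
   cutoff times g, and combining the real part with a large multiple of the imaginary part, controls
   |grad g|^2 + |g|^(1+m) + |g|^2 on a ball by G and by |g|^2 / h^2 on a ball larger by h. An interpolation
   inequality, obtained by comparing g with its translates by vectors of length l, bounds |g|^2 by
   l^2 |grad g|^2 plus a superlinear power of the L^(1+m) integral. With h = d / 2^k and l a small multiple
   of h, the exponent p is exactly the one for which the bound "energy on the ball of radius rho0 + h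
   is at most A h^p" passes from h to h/2, once A is small. To start, the energy on a slightly smaller ball
   is controlled by grad g and G alone, because Im b < 0 makes the |g|^2 term coercive. The energy bounds
   A h^p tend to 0, so g vanishes on the ball of radius rho0. *)

theory Submission
  imports Defs
begin

section \<open>Smooth functions\<close>

text \<open>The choice of p is a scaling identity: with energy Y of size h^p and translation length
  l proportional to h, the interpolation factor (Y / l^N)^((1 - m) / (1 + m)) scales like h^2,
  exactly what the gradient of the cutoff costs. Powers of h cancel and only numerical factors must
  beat 2^-p. These come from the data alone, so both thresholds are fixed before g and G.

  The square of a cutoff times g is not itself a test function. It is admissible once it is an H1
  limit of test functions supported in the domain and the ball, and the two alternatives on
  \<open>\<rho>\<^sub>1\<close> supply this differently: mollification if the ball lies inside the
  domain, multiplication of the approximants of g if g is in \<open>H1_0\<close>.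

  \<open>C_inf\<close> is coinductive, so a construction is smooth once it belongs to a class of
  functions closed under directional derivatives; this shapes the treatment of products, bumps and
  convolutions.\<close>

lemma C_inf_derivatives:
  assumes "C_inf f"
  shows "f differentiable (at x)" "C_inf (\<lambda>x. frechet_derivative f (at x) v)"
  using assms by (auto elim: C_inf.cases)

lemma C_inf_has_derivative:
  "C_inf f \<Longrightarrow> (f has_derivative frechet_derivative f (at x)) (at x)"
  using C_inf_derivatives(1) frechet_derivative_works by blast

lemma C_inf_continuous_on: "C_inf f \<Longrightarrow> continuous_on S f"
  by (meson C_inf_derivatives(1) differentiable_imp_continuous_within continuous_at_imp_continuous_on)

text \<open>Coinduction with a class P closed under directional derivatives. The derivative may be
  given by any explicit formula f', which uniqueness identifies with
  \<open>frechet_derivative\<close>, so closure is checked on the formula.\<close>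

lemma C_inf_coinduct_derivative:
  assumes "P f"
    and step: "\<And>f. P f \<Longrightarrow> \<exists>f'. (\<forall>x. (f has_derivative f' x) (at x)) \<and> (\<forall>v. P (\<lambda>x. f' x v))"
  shows "C_inf f"
  using \<open>P f\<close>
proof (coinduction arbitrary: f)
  case C_inf
  then obtain f' where f': "\<And>x. (f has_derivative f' x) (at x)" "\<And>v. P (\<lambda>x. f' x v)"
    using step by blast
  have eq: "frechet_derivative f (at x) = f' x" for x
    using f'(1) frechet_derivative_at by metis
  then show ?case
    using f' by (auto simp: differentiable_def)
qed

lemma C_inf_bounded_linear:
  assumes "bounded_linear L" "C_inf f"
  shows "C_inf (\<lambda>x. L (f x))"
proof (rule C_inf_coinduct_derivative[where P = "\<lambda>g. \<exists>f. C_inf f \<and> g = (\<lambda>x. L (f x))"])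
  fix g assume "\<exists>f. C_inf f \<and> g = (\<lambda>x. L (f x))"
  then obtain f where f: "C_inf f" "g = (\<lambda>x. L (f x))" by blast
  show "\<exists>g'. (\<forall>x. (g has_derivative g' x) (at x)) \<and>
      (\<forall>v. \<exists>f. C_inf f \<and> (\<lambda>x. g' x v) = (\<lambda>x. L (f x)))"
    using f C_inf_derivatives(2)[OF f(1)] bounded_linear.has_derivative[OF assms(1) C_inf_has_derivative[OF f(1)]]
    by (intro exI[of _ "\<lambda>x v. L (frechet_derivative f (at x) v)"]) blast
qed (use assms in blast)

text \<open>The chain rule only rescales the direction: the derivative along v is the derivative of
  f along \<open>k *\<^sub>R v\<close>, composed with the same affine map. The class of such
  compositions is therefore closed.\<close>

lemma C_inf_affine:
  assumes "C_inf f"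
  shows "C_inf (\<lambda>x. f (k *\<^sub>R x + d))"
proof (rule C_inf_coinduct_derivative[where P = "\<lambda>g. \<exists>f. C_inf f \<and> g = (\<lambda>x. f (k *\<^sub>R x + d))"])
  fix g assume "\<exists>f. C_inf f \<and> g = (\<lambda>x. f (k *\<^sub>R x + d))"
  then obtain f where f: "C_inf f" "g = (\<lambda>x. f (k *\<^sub>R x + d))" by blast
  have "(g has_derivative (\<lambda>v. frechet_derivative f (at (k *\<^sub>R x + d)) (k *\<^sub>R v))) (at x)" for x
    unfolding f(2)
    by (rule has_derivative_compose[OF _ C_inf_has_derivative[OF f(1)]])
      (auto intro!: derivative_eq_intros)
  then show "\<exists>g'. (\<forall>x. (g has_derivative g' x) (at x)) \<and>
      (\<forall>v. \<exists>f. C_inf f \<and> (\<lambda>x. g' x v) = (\<lambda>x. f (k *\<^sub>R x + d)))"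
    using C_inf_derivatives(2)[OF f(1)]
    by (intro exI[of _ "\<lambda>x v. frechet_derivative f (at (k *\<^sub>R x + d)) (k *\<^sub>R v)"]) blast
qed (use assms in blast)

text \<open>A single product is not stable under differentiation, as the Leibniz rule yields two
  products. Finite sums of products are stable, and they form the invariant for
  \<open>C_inf_bilinear\<close>.\<close>

inductive prod_span :: "('b::real_normed_vector \<Rightarrow> 'c::real_normed_vector \<Rightarrow> 'd::real_normed_vector) \<Rightarrow> ('a::real_normed_vector \<Rightarrow> 'd) \<Rightarrow> bool"
  for pr where
  "C_inf f \<Longrightarrow> C_inf g \<Longrightarrow> prod_span pr (\<lambda>x. pr (f x) (g x))"
| "prod_span pr f \<Longrightarrow> prod_span pr g \<Longrightarrow> prod_span pr (\<lambda>x. f x + g x)"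

lemma C_inf_bilinear:
  fixes pr :: "'b::real_normed_vector \<Rightarrow> 'c::real_normed_vector \<Rightarrow> 'd::real_normed_vector"
    and f :: "'a::real_normed_vector \<Rightarrow> 'b"
  assumes "bounded_bilinear pr" "C_inf f" "C_inf g"
  shows "C_inf (\<lambda>x. pr (f x) (g x))"
proof (rule C_inf_coinduct_derivative[where P = "prod_span pr"])
  show "prod_span pr (\<lambda>x. pr (f x) (g x))"
    using assms prod_span.intros(1) by blast
  fix h :: "'a \<Rightarrow> 'd" assume "prod_span pr h"
  then show "\<exists>h'. (\<forall>x. (h has_derivative h' x) (at x)) \<and> (\<forall>v. prod_span pr (\<lambda>x. h' x v))"
  proof induction
    case (1 f g)
    have "((\<lambda>x. pr (f x) (g x)) has_derivative
      (\<lambda>v. pr (f x) (frechet_derivative g (at x) v) + pr (frechet_derivative f (at x) v) (g x))) (at x)" for x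
      using bounded_bilinear.FDERIV[OF assms(1) C_inf_has_derivative[OF 1(1)] C_inf_has_derivative[OF 1(2)]] .
    then show ?case
      using 1 by (intro exI[of _ "\<lambda>x v. pr (f x) (frechet_derivative g (at x) v) + pr (frechet_derivative f (at x) v) (g x)"])
        (auto intro!: prod_span.intros C_inf_derivatives(2))
  next
    case (2 f g)
    then obtain f' g' where "\<And>x. (f has_derivative f' x) (at x)" "\<And>v. prod_span pr (\<lambda>x. f' x v)"
        "\<And>x. (g has_derivative g' x) (at x)" "\<And>v. prod_span pr (\<lambda>x. g' x v)"
      by blast
    then show ?case
      by (intro exI[of _ "\<lambda>x v. f' x v + g' x v"]) (auto intro!: prod_span.intros has_derivative_add)
  qed
qed

section \<open>A function flat at zero and the smooth bump built from it\<close>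

definition flat :: "nat \<Rightarrow> real \<Rightarrow> real" where
  "flat n t = (if t > 0 then exp (- 1 / t) / t ^ n else 0)"

text \<open>Only t = 0 needs a limit: there the difference quotient from the right is exp(-1/h) /
  h^(n+1), which tends to 0 because the exponential of 1/h beats every power of 1/h. Off zero the
  function agrees locally with an elementary formula.\<close>

lemma flat_has_derivative:
  "(flat n has_real_derivative (flat (n + 2) t - real n * flat (n + 1) t)) (at t)"
proof (cases t "0::real" rule: linorder_cases)
  case less
  have "\<forall>\<^sub>F x in nhds t. flat n x = 0"
    using eventually_nhds_in_open[of "{..<0}" t] less by (auto elim!: eventually_mono simp: flat_def)
  then show ?thesis
    using less by (subst DERIV_cong_ev[OF refl _ refl, where g = "\<lambda>_. 0"]) (auto simp: flat_def)
next
  case greater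
  have ev: "\<forall>\<^sub>F x in nhds t. flat n x = exp (- 1 / x) / x ^ n"
    using eventually_nhds_in_open[of "{0<..}" t] greater by (auto elim!: eventually_mono simp: flat_def)
  have "((\<lambda>x. exp (- 1 / x) / x ^ n) has_real_derivative (flat (n + 2) t - real n * flat (n + 1) t)) (at t)"
    using greater
    apply (auto intro!: derivative_eq_intros simp: flat_def field_simps power2_eq_square)
    apply (cases n; simp add: field_simps)
    done
  then show ?thesis
    using DERIV_cong_ev[OF refl ev refl] by blast
next
  case equal
  have right: "((\<lambda>h. flat n h / h) \<longlongrightarrow> 0) (at_right 0)"
  proof (rule Lim_transform_eventually)
    have "((\<lambda>h::real. exp (- 1 / h) / h ^ (n + 1)) \<longlongrightarrow> 0) (at_right 0)"
    proof -
      have "((\<lambda>h::real. inverse h ^ (n + 1) / exp (inverse h)) \<longlongrightarrow> 0) (at_right 0)"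
        using filterlim_compose[OF tendsto_power_div_exp_0 filterlim_inverse_at_top_right] .
      then show ?thesis by (simp add: exp_minus field_simps)
    qed
    then show "((\<lambda>h::real. exp (- 1 / h) / h ^ (n + 1)) \<longlongrightarrow> 0) (at_right 0)" .
    show "\<forall>\<^sub>F h in at_right 0. exp (- 1 / h) / h ^ (n + 1) = flat n h / h"
      by (auto simp: eventually_at_filter flat_def)
  qed
  have left: "((\<lambda>h. flat n h / h) \<longlongrightarrow> 0) (at_left 0)"
    by (rule Lim_transform_eventually[OF tendsto_const]) (auto simp: eventually_at_filter flat_def)
  have "((\<lambda>h. flat n h / h) \<longlongrightarrow> 0) (at 0)"
    using left right filterlim_split_at by blast
  then show ?thesis
    using equal by (simp add: DERIV_def flat_def)
qed

text \<open>An algebra of functions closed under directional derivatives, because the derivative of flat n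
  is a combination of flat (n + 1) and flat (n + 2).\<close>

inductive flat_alg :: "('a::euclidean_space \<Rightarrow> real) \<Rightarrow> bool" where
  "flat_alg (\<lambda>x. k)"
| "flat_alg (\<lambda>x. x \<bullet> v)"
| "flat_alg (\<lambda>x. flat n (1 - x \<bullet> x))"
| "flat_alg f \<Longrightarrow> flat_alg g \<Longrightarrow> flat_alg (\<lambda>x. f x + g x)"
| "flat_alg f \<Longrightarrow> flat_alg g \<Longrightarrow> flat_alg (\<lambda>x. f x * g x)"

lemma C_inf_bump: "C_inf (\<lambda>x::'a::euclidean_space. flat n (1 - x \<bullet> x))"
proof (rule C_inf_coinduct_derivative[where P = flat_alg])
  fix h :: "'a \<Rightarrow> real" assume "flat_alg h"
  then show "\<exists>h'. (\<forall>x. (h has_derivative h' x) (at x)) \<and> (\<forall>v. flat_alg (\<lambda>x. h' x v))"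
  proof induction
    case (1 k)
    then show ?case
      by (intro exI[of _ "\<lambda>x v. 0"]) (auto intro: flat_alg.intros)
  next
    case (2 w)
    then show ?case
      by (intro exI[of _ "\<lambda>x v. v \<bullet> w"]) (auto intro: flat_alg.intros intro!: derivative_eq_intros)
  next
    case (3 n)
    have d: "((\<lambda>x::'a. flat n (1 - x \<bullet> x)) has_derivative (\<lambda>v. (flat (n + 2) (1 - x \<bullet> x)
        + (- real n) * flat (n + 1) (1 - x \<bullet> x)) * ((- 2) * (x \<bullet> v)))) (at x)" for x
    proof -
      have "((\<lambda>x::'a. 1 - x \<bullet> x) has_derivative (\<lambda>v. (- 2) * (x \<bullet> v))) (at x)"
        by (auto intro!: derivative_eq_intros simp: inner_commute)
      from has_derivative_compose[OF this flat_has_derivative[unfolded has_field_derivative_def]]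
      show ?thesis by simp
    qed
    have fl: "flat_alg (\<lambda>x::'a. (flat (n + 2) (1 - x \<bullet> x)
        + (- real n) * flat (n + 1) (1 - x \<bullet> x)) * ((- 2) * (x \<bullet> v)))" for v
      by (rule flat_alg.intros(3-5) flat_alg.intros(1,2))+
    show ?case
      by (rule exI, rule conjI; rule allI) (rule d, rule fl)
  next
    case (4 f g)
    then obtain f' g' where "\<And>x. (f has_derivative f' x) (at x)" "\<And>v. flat_alg (\<lambda>x. f' x v)"
        "\<And>x. (g has_derivative g' x) (at x)" "\<And>v. flat_alg (\<lambda>x. g' x v)"
      by blast
    then show ?case
      by (intro exI[of _ "\<lambda>x v. f' x v + g' x v"]) (auto intro!: flat_alg.intros has_derivative_add)
  next
    case (5 f g)
    then obtain f' g' where "\<And>x. (f has_derivative f' x) (at x)" "\<And>v. flat_alg (\<lambda>x. f' x v)"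
        "\<And>x. (g has_derivative g' x) (at x)" "\<And>v. flat_alg (\<lambda>x. g' x v)"
      by blast
    then show ?case
      using 5 by (intro exI[of _ "\<lambda>x v. f x * g' x v + f' x v * g x"])
        (auto intro!: flat_alg.intros has_derivative_mult)
  qed
qed (rule flat_alg.intros)

section \<open>Square norms and smooth kernels\<close>

text \<open>The squared L2 norm, in \<open>ennreal\<close> so that inequalities need no
  integrability; finiteness becomes a separate assumption where a Bochner integral is taken. Keeping
  the square avoids roots, at the price of the factors 2 in \<open>sqn_add\<close>.\<close>

definition sqn :: "('a::euclidean_space \<Rightarrow> 'b::real_normed_vector) \<Rightarrow> ennreal" where
  "sqn f = (\<integral>\<^sup>+x. ennreal ((norm (f x))\<^sup>2) \<partial>lebesgue)"

lemma borel_measurable_continuous_lebesgue: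
  fixes f :: "'a::euclidean_space \<Rightarrow> 'b::topological_space"
  shows "continuous_on UNIV f \<Longrightarrow> f \<in> borel_measurable lebesgue"
  by (simp add: borel_measurable_continuous_onI measurable_completion)

lemma power2_norm_add_le: "(norm (x + y))\<^sup>2 \<le> 2 * (norm x)\<^sup>2 + 2 * (norm y)\<^sup>2"
  for x y :: "'a::real_normed_vector"
proof -
  have "(norm (x + y))\<^sup>2 \<le> (norm x + norm y)\<^sup>2"
    by (simp add: norm_triangle_ineq power_mono)
  also have "\<dots> \<le> 2 * (norm x)\<^sup>2 + 2 * (norm y)\<^sup>2"
    using zero_le_power2[of "norm x - norm y"] by (simp add: power2_sum power2_diff)
  finally show ?thesis .
qed

lemma sqn_add:
  fixes f g :: "'a::euclidean_space \<Rightarrow> 'b::{real_normed_vector, second_countable_topology}"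
  assumes [measurable]: "f \<in> borel_measurable lebesgue" "g \<in> borel_measurable lebesgue"
  shows "sqn (\<lambda>x. f x + g x) \<le> 2 * sqn f + 2 * sqn g"
proof -
  have "sqn (\<lambda>x. f x + g x)
      \<le> (\<integral>\<^sup>+x. 2 * ennreal ((norm (f x))\<^sup>2) + 2 * ennreal ((norm (g x))\<^sup>2) \<partial>lebesgue)"
    unfolding sqn_def
  proof (intro nn_integral_mono)
    fix x
    have "ennreal ((norm (f x + g x))\<^sup>2) \<le> ennreal (2 * (norm (f x))\<^sup>2 + 2 * (norm (g x))\<^sup>2)"
      by (intro ennreal_leI power2_norm_add_le)
    also have "\<dots> = 2 * ennreal ((norm (f x))\<^sup>2) + 2 * ennreal ((norm (g x))\<^sup>2)"
      by (simp add: ennreal_mult')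
    finally show "ennreal ((norm (f x + g x))\<^sup>2)
        \<le> 2 * ennreal ((norm (f x))\<^sup>2) + 2 * ennreal ((norm (g x))\<^sup>2)" .
  qed
  also have "\<dots> = 2 * sqn f + 2 * sqn g"
    unfolding sqn_def by (simp add: nn_integral_add nn_integral_cmult)
  finally show ?thesis .
qed

lemma sqn_add3:
  fixes f g h :: "'a::euclidean_space \<Rightarrow> 'b::{real_normed_vector, second_countable_topology}"
  assumes [measurable]: "f \<in> borel_measurable lebesgue" "g \<in> borel_measurable lebesgue"
    "h \<in> borel_measurable lebesgue"
  shows "sqn (\<lambda>x. f x + g x + h x) \<le> 4 * sqn f + 4 * sqn g + 2 * sqn h"
proof -
  have "sqn (\<lambda>x. f x + g x + h x) \<le> 2 * sqn (\<lambda>x. f x + g x) + 2 * sqn h"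
    by (intro sqn_add) measurable
  also have "\<dots> \<le> 2 * (2 * sqn f + 2 * sqn g) + 2 * sqn h"
    by (intro add_right_mono mult_left_mono sqn_add) auto
  also have "\<dots> = 4 * sqn f + 4 * sqn g + 2 * sqn h"
    by (simp add: distrib_left mult.assoc[symmetric])
  finally show ?thesis .
qed

lemma sqn_scaleR_le:
  assumes "\<And>x. norm (f x) \<le> M * norm (g x)" "M \<ge> 0"
    "g \<in> borel_measurable lebesgue"
  shows "sqn f \<le> ennreal (M\<^sup>2) * sqn g"
proof -
  have "sqn f \<le> (\<integral>\<^sup>+x. ennreal (M\<^sup>2) * ennreal ((norm (g x))\<^sup>2) \<partial>lebesgue)"
    unfolding sqn_def
  proof (intro nn_integral_mono)
    fix x
    have "(norm (f x))\<^sup>2 \<le> M\<^sup>2 * (norm (g x))\<^sup>2"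
      using power_mono[OF assms(1)[of x], of 2] by (simp add: power_mult_distrib)
    then show "ennreal ((norm (f x))\<^sup>2) \<le> ennreal (M\<^sup>2) * ennreal ((norm (g x))\<^sup>2)"
      by (simp add: ennreal_mult'[symmetric] ennreal_leI)
  qed
  also have "\<dots> = ennreal (M\<^sup>2) * sqn g"
    unfolding sqn_def using assms(3) by (subst nn_integral_cmult) auto
  finally show ?thesis .
qed

lemma sqn_minus: "sqn (\<lambda>x. g x - f x) = sqn (\<lambda>x. f x - g x)"
  by (simp add: sqn_def norm_minus_commute)

lemma sqn_finite_integrable:
  assumes "f \<in> borel_measurable lebesgue" "sqn f < \<infinity>"
  shows "integrable lebesgue (\<lambda>x. (norm (f x))\<^sup>2)"
  using assms by (intro integrableI_bounded) (auto simp: sqn_def)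

text \<open>L2 embeds in L1 on a set of finite measure, through t \<le> t^2 + 1; a ball that
  contains the support carries the constant 1.\<close>

lemma integrable_zero_off_bounded:
  fixes f :: "'a::euclidean_space \<Rightarrow> 'b::{banach, second_countable_topology}"
  assumes "f \<in> borel_measurable lebesgue" "sqn f < \<infinity>" "bounded {x. f x \<noteq> 0}"
  shows "integrable lebesgue f"
proof -
  obtain r where r: "{x. f x \<noteq> 0} \<subseteq> ball 0 r"
    using bounded_subset_ballD assms(3) by metis
  have "integrable lebesgue (\<lambda>x. (norm (f x))\<^sup>2 + indicat_real (ball 0 r) x)"
    by (intro Bochner_Integration.integrable_add sqn_finite_integrable assms)
      (auto simp: emeasure_lborel_ball_finite[simplified])
  then show ?thesis
  proof (rule Bochner_Integration.integrable_bound)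
    show "f \<in> borel_measurable lebesgue" by (rule assms)
    show "AE x in lebesgue. norm (f x) \<le> norm ((norm (f x))\<^sup>2 + indicat_real (ball 0 r) x)"
    proof (rule AE_I2)
      fix x
      have "2 * norm (f x) \<le> (norm (f x))\<^sup>2 + 1"
        using zero_le_power2[of "norm (f x) - 1"] by (simp add: power2_diff)
      then have "norm (f x) \<le> (norm (f x))\<^sup>2 + 1"
        using norm_ge_zero[of "f x"] by linarith
      then show "norm (f x) \<le> norm ((norm (f x))\<^sup>2 + indicat_real (ball 0 r) x)"
        using r by (cases "f x = 0") (auto simp: indicator_def)
    qed
  qed
qed

text \<open>Smooth functions of compact support, without reference to an open set and with any
  normed codomain. This one notion covers mollifiers, cutoffs, complex test functions and their
  directional derivatives.\<close>

definition kernel :: "('a::euclidean_space \<Rightarrow> 'b::real_normed_vector) \<Rightarrow> bool" where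
  "kernel \<phi> \<longleftrightarrow> C_inf \<phi> \<and> bounded {x. \<phi> x \<noteq> 0}"

lemma frechet_derivative_off_support:
  assumes "x \<notin> closure {x. \<phi> x \<noteq> 0}"
  shows "frechet_derivative \<phi> (at x) = (\<lambda>_. 0)"
proof -
  have "((\<lambda>_. 0) has_derivative (\<lambda>_. 0)) (at x)" by simp
  then have "(\<phi> has_derivative (\<lambda>_. 0)) (at x)"
    by (rule has_derivative_transform_within_open[of _ _ _ _ "- closure {x. \<phi> x \<noteq> 0}"])
      (use assms closure_subset[of "{x. \<phi> x \<noteq> 0}"] in auto)
  then show ?thesis
    using frechet_derivative_at by metis
qed

lemma kernel_derivative:
  assumes "kernel \<phi>"
  shows "kernel (\<lambda>x. frechet_derivative \<phi> (at x) v)"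
proof -
  have "{x. frechet_derivative \<phi> (at x) v \<noteq> 0} \<subseteq> closure {x. \<phi> x \<noteq> 0}"
    using frechet_derivative_off_support by fastforce
  then show ?thesis
    using assms C_inf_derivatives(2) bounded_subset[OF bounded_closure] unfolding kernel_def by blast
qed

lemma kernel_bound:
  assumes "kernel \<phi>"
  obtains B where "B \<ge> 0" "\<And>x. norm (\<phi> x) \<le> B"
proof -
  have "compact (\<phi> ` closure {x. \<phi> x \<noteq> 0})"
    using assms unfolding kernel_def
    by (intro compact_continuous_image C_inf_continuous_on) (auto simp: compact_closure)
  then obtain B where B: "\<And>y. y \<in> \<phi> ` closure {x. \<phi> x \<noteq> 0} \<Longrightarrow> norm y \<le> B"
    using compact_imp_bounded bounded_iff by metis
  have "norm (\<phi> x) \<le> max B 0" for x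
  proof (cases "\<phi> x = 0")
    case False
    then have "x \<in> closure {x. \<phi> x \<noteq> 0}"
      using closure_subset by fast
    then show ?thesis using B[of "\<phi> x"] by auto
  qed auto
  then show thesis
    using that[of "max B 0"] by auto
qed

lemma norm_linear_le_sum_Basis:
  fixes L :: "'a::euclidean_space \<Rightarrow> 'b::real_normed_vector"
  assumes "linear L"
  shows "norm (L h) \<le> norm h * (\<Sum>i\<in>Basis. norm (L i))"
proof -
  have "L h = (\<Sum>i\<in>Basis. (h \<bullet> i) *\<^sub>R L i)"
    using linear_sum[OF assms] linear_scale[OF assms] euclidean_representation[of h]
    by (metis (no_types, lifting) sum.cong)
  also have "norm \<dots> \<le> (\<Sum>i\<in>Basis. norm h * norm (L i))"
    by (rule sum_norm_le) (simp add: Basis_le_norm mult_right_mono)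
  finally show ?thesis by (simp add: sum_distrib_left)
qed

lemma kernel_lipschitz:
  assumes "kernel \<phi>"
  obtains B where "B \<ge> 0" "\<And>x y. norm (\<phi> x - \<phi> y) \<le> B * norm (x - y)"
proof -
  have "\<exists>B. B \<ge> 0 \<and> (\<forall>x. norm (frechet_derivative \<phi> (at x) i) \<le> B)" for i
    using kernel_bound[OF kernel_derivative[OF assms]] by metis
  then obtain B where B: "\<And>i. B i \<ge> 0" "\<And>i x. norm (frechet_derivative \<phi> (at x) i) \<le> B i"
    by metis
  have "norm (\<phi> x - \<phi> y) \<le> (\<Sum>i\<in>Basis. B i) * norm (x - y)" for x y
  proof (rule differentiable_bound[of UNIV])
    fix x
    have der: "(\<phi> has_derivative frechet_derivative \<phi> (at x)) (at x)"
      using C_inf_has_derivative assms kernel_def by blast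
    then show "(\<phi> has_derivative frechet_derivative \<phi> (at x)) (at x within UNIV)" by simp
    show "onorm (frechet_derivative \<phi> (at x)) \<le> (\<Sum>i\<in>Basis. B i)"
    proof (rule onorm_le)
      fix h
      have "norm (frechet_derivative \<phi> (at x) h) \<le> norm h * (\<Sum>i\<in>Basis. norm (frechet_derivative \<phi> (at x) i))"
        by (rule norm_linear_le_sum_Basis) (use der has_derivative_linear in blast)
      also have "\<dots> \<le> norm h * (\<Sum>i\<in>Basis. B i)"
        by (intro mult_left_mono sum_mono B) auto
      finally show "norm (frechet_derivative \<phi> (at x) h) \<le> (\<Sum>i\<in>Basis. B i) * norm h"
        by (simp add: mult.commute)
    qed
  qed auto
  then show thesis
    using that[of "\<Sum>i\<in>Basis. B i"] B(1) by (auto simp: sum_nonneg)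
qed

text \<open>A second order Taylor remainder that is uniform in the base point, because the
  derivative is globally Lipschitz. Uniformity lets the remainder be pulled out of a convolution
  integral.\<close>

lemma kernel_uniform_derivative:
  assumes "kernel \<phi>"
  obtains B where "B \<ge> 0"
    "\<And>z h. norm (\<phi> (z + h) - \<phi> z - frechet_derivative \<phi> (at z) h) \<le> B * (norm h)\<^sup>2"
proof -
  let ?D = "\<lambda>x. frechet_derivative \<phi> (at x)"
  have "\<exists>B\<ge>0. \<forall>x y. norm (?D x i - ?D y i) \<le> B * norm (x - y)" for i
    using kernel_lipschitz[OF kernel_derivative[OF assms, of i]] by metis
  then obtain B where B: "\<And>i. B i \<ge> 0" "\<And>i x y. norm (?D x i - ?D y i) \<le> B i * norm (x - y)"
    by metis
  have der: "(\<phi> has_derivative ?D x) (at x)" for x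
    using C_inf_has_derivative assms kernel_def by blast
  have "norm (\<phi> (z + h) - \<phi> z - ?D z h) \<le> (\<Sum>i\<in>Basis. B i) * (norm h)\<^sup>2" for z h
  proof -
    have on: "onorm (?D x - ?D z) \<le> (\<Sum>i\<in>Basis. B i) * norm h" if "x \<in> cball z (norm h)" for x
    proof (rule onorm_le)
      fix k
      have "norm ((?D x - ?D z) k) \<le> norm k * (\<Sum>i\<in>Basis. norm ((?D x - ?D z) i))"
        using linear_compose_sub[OF has_derivative_linear[OF der[of x]] has_derivative_linear[OF der[of z]]]
        by (intro norm_linear_le_sum_Basis) (simp add: fun_diff_def)
      also have "\<dots> \<le> norm k * (\<Sum>i\<in>Basis. B i * norm h)"
      proof (intro mult_left_mono sum_mono)
        fix i
        have "norm (?D x i - ?D z i) \<le> B i * norm (x - z)" by (rule B)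
        also have "\<dots> \<le> B i * norm h"
          using that B(1) by (intro mult_left_mono) (auto simp: dist_norm norm_minus_commute)
        finally show "norm ((?D x - ?D z) i) \<le> B i * norm h" by simp
      qed auto
      finally show "norm ((?D x - ?D z) k) \<le> (\<Sum>i\<in>Basis. B i) * norm h * norm k"
        by (simp add: sum_distrib_left sum_distrib_right mult_ac)
    qed
    have "norm (\<phi> (z + h) - \<phi> z - ?D z (z + h - z)) \<le> norm (z + h - z) * ((\<Sum>i\<in>Basis. B i) * norm h)"
    proof (rule differentiable_bound_linearization[where S = "cball z (norm h)"])
      show "z + t *\<^sub>R (z + h - z) \<in> cball z (norm h)" if "t \<in> {0..1}" for t
        using that by (auto simp: dist_norm mult_left_le_one_le)
    qed (use on der in \<open>auto intro: has_derivative_at_withinI\<close>)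
    then show ?thesis by (simp add: power2_eq_square mult_ac)
  qed
  then show thesis
    using that[of "\<Sum>i\<in>Basis. B i"] B(1) by (auto simp: sum_nonneg)
qed

section \<open>Convolution\<close>

definition conv :: "('a::euclidean_space \<Rightarrow> 'b::{banach, second_countable_topology}) \<Rightarrow> ('a \<Rightarrow> real) \<Rightarrow> 'a \<Rightarrow> 'b" where
  "conv f \<phi> x = (LINT y|lebesgue. \<phi> (x - y) *\<^sub>R f y)"

lemma kernel_measurable:
  assumes "kernel \<phi>"
  shows "(\<lambda>y. \<phi> (x - y)) \<in> borel_measurable lebesgue"
proof (rule borel_measurable_continuous_lebesgue)
  have "continuous_on UNIV \<phi>"
    using assms C_inf_continuous_on kernel_def by blast
  then show "continuous_on UNIV (\<lambda>y. \<phi> (x - y))"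
    by (rule continuous_on_compose2) (auto intro!: continuous_intros)
qed

lemma conv_integrable:
  fixes f :: "'a::euclidean_space \<Rightarrow> 'b::{banach, second_countable_topology}"
  assumes f: "integrable lebesgue f" and k: "kernel \<phi>"
  shows "integrable lebesgue (\<lambda>y. \<phi> (x - y) *\<^sub>R f y)"
proof -
  obtain B where B: "B \<ge> 0" "\<And>x. norm (\<phi> x) \<le> B"
    using kernel_bound[OF k] by blast
  have [measurable]: "f \<in> borel_measurable lebesgue" "(\<lambda>y. \<phi> (x - y)) \<in> borel_measurable lebesgue"
    using f kernel_measurable[OF k] by auto
  show ?thesis
  proof (rule Bochner_Integration.integrable_bound[OF integrable_scaleR_right[OF f, of B]])
    show "AE y in lebesgue. norm (\<phi> (x - y) *\<^sub>R f y) \<le> norm (B *\<^sub>R f y)"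
      using B by (intro AE_I2) (auto intro!: mult_right_mono)
  qed measurable
qed

text \<open>Differentiation under the integral without dominated convergence: the remainder of
  \<phi> is at most B |h|^2 everywhere, so integrating it against f leaves B |h|^2 times the L1 norm
  of f.\<close>

lemma conv_has_derivative:
  fixes f :: "'a::euclidean_space \<Rightarrow> 'b::{banach, second_countable_topology}"
  assumes f: "integrable lebesgue f" and k: "kernel \<phi>"
  shows "(conv f \<phi> has_derivative (\<lambda>v. conv f (\<lambda>z. frechet_derivative \<phi> (at z) v) x)) (at x)"
proof -
  let ?D = "\<lambda>z. frechet_derivative \<phi> (at z)"
  let ?L = "\<lambda>v. conv f (\<lambda>z. ?D z v) x"
  have lin: "linear (?D z)" for z
    using C_inf_has_derivative k has_derivative_linear kernel_def by blast
  note int = conv_integrable[OF f k] conv_integrable[OF f kernel_derivative[OF k]]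
  have linL: "linear ?L"
    unfolding conv_def
    by (rule linearI)
      (simp_all add: linear_add[OF lin] linear_scale[OF lin] scaleR_left_distrib int
        flip: scaleR_scaleR)
  obtain B where B: "B \<ge> 0"
    "\<And>z h. norm (\<phi> (z + h) - \<phi> z - ?D z h) \<le> B * (norm h)\<^sup>2"
    using kernel_uniform_derivative[OF k] by blast
  define I where "I = (LINT y|lebesgue. norm (f y))"
  have I: "I \<ge> 0" unfolding I_def by simp
  have est: "norm (conv f \<phi> y - conv f \<phi> x - ?L (y - x)) \<le> B * (norm (y - x))\<^sup>2 * I" for y
  proof -
    have "conv f \<phi> y - conv f \<phi> x - ?L (y - x)
        = (LINT u|lebesgue. (\<phi> (y - u) - \<phi> (x - u) - ?D (x - u) (y - x)) *\<^sub>R f u)"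
      unfolding conv_def
      by (simp add: scaleR_left_diff_distrib int)
    also have "norm \<dots> \<le> (LINT u|lebesgue. B * (norm (y - x))\<^sup>2 * norm (f u))"
    proof (rule Bochner_Integration.integral_norm_bound_integral)
      show "integrable lebesgue (\<lambda>u. (\<phi> (y - u) - \<phi> (x - u) - ?D (x - u) (y - x)) *\<^sub>R f u)"
        by (simp add: scaleR_left_diff_distrib int)
      fix u
      show "norm ((\<phi> (y - u) - \<phi> (x - u) - ?D (x - u) (y - x)) *\<^sub>R f u) \<le> B * (norm (y - x))\<^sup>2 * norm (f u)"
        using B(2)[of "x - u" "y - x"] by (auto intro!: mult_right_mono)
    qed (use f in auto)
    also have "\<dots> = B * (norm (y - x))\<^sup>2 * I"
      unfolding I_def by simp
    finally show ?thesis .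
  qed
  show ?thesis
    unfolding has_derivative_at_alt
  proof (intro conjI allI impI)
    show "bounded_linear ?L" using linL linear_conv_bounded_linear by blast
    fix e :: real assume "e > 0"
    show "\<exists>d>0. \<forall>y. norm (y - x) < d \<longrightarrow> norm (conv f \<phi> y - conv f \<phi> x - ?L (y - x)) \<le> e * norm (y - x)"
    \<comment> \<open>The summand 1 keeps the denominator positive when \<open>B * I\<close>
      vanishes.\<close>
    proof (intro exI[of _ "e / (B * I + 1)"] conjI allI impI)
      show "e / (B * I + 1) > 0" using \<open>e > 0\<close> B(1) I by (simp add: add_nonneg_pos)
      fix y assume y: "norm (y - x) < e / (B * I + 1)"
      then have "norm (y - x) * (B * I + 1) \<le> e"
        using B(1) I pos_less_divide_eq[of "B * I + 1" "norm (y - x)" e] by (simp add: add_nonneg_pos)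
      moreover have "norm (y - x) * (B * I) \<le> norm (y - x) * (B * I + 1)"
        by (intro mult_left_mono) auto
      ultimately have "norm (y - x) * (B * I) \<le> e" by linarith
      then have "norm (y - x) * (norm (y - x) * (B * I)) \<le> norm (y - x) * e"
        by (intro mult_left_mono) auto
      then show "norm (conv f \<phi> y - conv f \<phi> x - ?L (y - x)) \<le> e * norm (y - x)"
        using est[of y] by (simp add: power2_eq_square mult_ac)
    qed
  qed
qed

text \<open>Every derivative falls on the kernel, and a derivative of a kernel is again a kernel. So
  the convolutions of the fixed f form a closed class, whatever the regularity of f.\<close>

lemma C_inf_conv:
  fixes f :: "'a::euclidean_space \<Rightarrow> 'b::{banach, second_countable_topology}"
  assumes f: "integrable lebesgue f" and "kernel \<phi>"
  shows "C_inf (conv f \<phi>)"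
proof (rule C_inf_coinduct_derivative[where P = "\<lambda>g. \<exists>\<phi>. kernel \<phi> \<and> g = conv f \<phi>"])
  fix g assume "\<exists>\<phi>. kernel \<phi> \<and> g = conv f \<phi>"
  then obtain \<phi> where \<phi>: "kernel \<phi>" "g = conv f \<phi>" by blast
  show "\<exists>g'. (\<forall>x. (g has_derivative g' x) (at x)) \<and> (\<forall>v. \<exists>\<phi>. kernel \<phi> \<and> (\<lambda>x. g' x v) = conv f \<phi>)"
    using conv_has_derivative[OF f \<phi>(1)] kernel_derivative[OF \<phi>(1)] \<phi>(2)
    by (intro exI[of _ "\<lambda>x v. conv f (\<lambda>z. frechet_derivative \<phi> (at z) v) x"]) blast
qed (use assms in blast)

lemma conv_frechet_derivative:
  fixes f :: "'a::euclidean_space \<Rightarrow> 'b::{banach, second_countable_topology}"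
  assumes "integrable lebesgue f" "kernel \<phi>"
  shows "frechet_derivative (conv f \<phi>) (at x) v = conv f (\<lambda>z. frechet_derivative \<phi> (at z) v) x"
  using frechet_derivative_at[OF conv_has_derivative[OF assms]] by metis

lemma conv_eq_0:
  assumes "\<And>y. f y \<noteq> 0 \<Longrightarrow> \<phi> (x - y) = 0"
  shows "conv f \<phi> x = 0"
proof -
  have "\<phi> (x - y) *\<^sub>R f y = 0" for y
    using assms by (cases "f y = 0") auto
  then show ?thesis unfolding conv_def by (simp only: Bochner_Integration.integral_zero)
qed

section \<open>Changes of variables, mollifiers and contraction in mean square\<close>

lemma nn_integral_lborel_reflect:
  fixes h :: "'a::euclidean_space \<Rightarrow> ennreal"
  assumes "h \<in> borel_measurable borel"
  shows "(\<integral>\<^sup>+x. h (y - x) \<partial>lborel) = (\<integral>\<^sup>+x. h x \<partial>lborel)"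
  using assms by (subst (2) lborel_affine[of "-1" y]) (simp_all add: nn_integral_density nn_integral_distr)

lemma nn_integral_lborel_scale:
  fixes h :: "'a::euclidean_space \<Rightarrow> ennreal"
  assumes "h \<in> borel_measurable borel" "c > 0"
  shows "(\<integral>\<^sup>+x. h x \<partial>lborel) = ennreal (c ^ DIM('a)) * (\<integral>\<^sup>+x. h (c *\<^sub>R x) \<partial>lborel)"
  using assms by (subst lborel_affine[of c 0]) (simp_all add: nn_integral_density nn_integral_distr nn_integral_cmult)

lemma nn_integral_lborel_shift:
  fixes h :: "'a::euclidean_space \<Rightarrow> ennreal"
  assumes "h \<in> borel_measurable borel"
  shows "(\<integral>\<^sup>+x. h (x + y) \<partial>lborel) = (\<integral>\<^sup>+x. h x \<partial>lborel)"
  using assms by (subst (2) lborel_affine[of 1 y]) (simp_all add: nn_integral_density nn_integral_distr add.commute)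

definition mollifier :: "('a::euclidean_space \<Rightarrow> real) \<Rightarrow> real \<Rightarrow> bool" where
  "mollifier j r \<longleftrightarrow> kernel j \<and> (\<forall>x. j x \<ge> 0) \<and> (\<forall>x. norm x \<ge> r \<longrightarrow> j x = 0) \<and> integral\<^sup>L lebesgue j = 1"

lemma kernel_integrable:
  fixes \<phi> :: "'a::euclidean_space \<Rightarrow> real"
  assumes "kernel \<phi>"
  shows "integrable lebesgue \<phi>"
proof -
  obtain B where B: "B \<ge> 0" "\<And>x. norm (\<phi> x) \<le> B"
    using kernel_bound[OF assms] by blast
  obtain r where r: "{x. \<phi> x \<noteq> 0} \<subseteq> ball 0 r"
    using assms bounded_subset_ballD unfolding kernel_def by metis
  show ?thesis
  proof (rule Bochner_Integration.integrable_bound[of _ "\<lambda>x. B * indicat_real (ball 0 r) x"])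
    show "\<phi> \<in> borel_measurable lebesgue"
      using assms by (intro borel_measurable_continuous_lebesgue) (auto simp: kernel_def C_inf_continuous_on)
    show "AE x in lebesgue. norm (\<phi> x) \<le> norm (B * indicat_real (ball 0 r) x)"
      using B r by (intro AE_I2) (auto simp: indicator_def)
  qed (auto simp: emeasure_lborel_ball_finite[simplified])
qed

lemma mollifier_integrable: "mollifier j r \<Longrightarrow> integrable lebesgue j"
  by (simp add: kernel_integrable mollifier_def)

lemma mollifier_borel: "mollifier j r \<Longrightarrow> j \<in> borel_measurable borel"
  by (simp add: mollifier_def kernel_def C_inf_continuous_on borel_measurable_continuous_onI)

lemma mollifier_nn_integral:
  assumes "mollifier j r"
  shows "(\<integral>\<^sup>+x. ennreal (j x) \<partial>lborel) = 1"
proof -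
  have "(\<integral>\<^sup>+x. ennreal (j x) \<partial>lebesgue) = ennreal (integral\<^sup>L lebesgue j)"
    using assms by (intro nn_integral_eq_integral mollifier_integrable) (auto simp: mollifier_def)
  then show ?thesis
    using assms by (simp add: nn_integral_completion mollifier_def)
qed

lemma mollifier_reflect:
  assumes "mollifier j r"
  shows "integrable lebesgue (\<lambda>y. j (x - y))" "(LINT y|lebesgue. j (x - y)) = 1"
proof -
  have m: "(\<lambda>y. j (x - y)) \<in> borel_measurable lebesgue"
    using assms kernel_measurable mollifier_def by blast
  have "(\<integral>\<^sup>+y. ennreal (j (x - y)) \<partial>lebesgue) = 1"
    using nn_integral_lborel_reflect[of "\<lambda>y. ennreal (j y)" x] mollifier_borel[OF assms]
      mollifier_nn_integral[OF assms] by (simp add: nn_integral_completion)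
  then show "integrable lebesgue (\<lambda>y. j (x - y))" "(LINT y|lebesgue. j (x - y)) = 1"
    using m assms nn_integral_eq_integrable[of "\<lambda>y. j (x - y)" lebesgue 1] by (auto simp: mollifier_def)
qed

text \<open>Jensen's inequality for the probability density j(x - y): with c the mean of |f|,
  integrating (c - |f|)^2 \<ge> 0 shows that c^2 is at most the mean of |f|^2.\<close>

lemma conv_mollifier_power2_le:
  fixes f :: "'a::euclidean_space \<Rightarrow> 'b::{banach, second_countable_topology}"
  assumes f: "integrable lebesgue f" "integrable lebesgue (\<lambda>x. (norm (f x))\<^sup>2)" and j: "mollifier j r"
  shows "(norm (conv f j x))\<^sup>2 \<le> (LINT y|lebesgue. j (x - y) * (norm (f y))\<^sup>2)"
proof -
  have k: "kernel j" and j0: "\<And>x. j x \<ge> 0" using j by (auto simp: mollifier_def)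
  define c where "c = (LINT y|lebesgue. j (x - y) * norm (f y))"
  have i1: "integrable lebesgue (\<lambda>y. j (x - y) * norm (f y))"
    using conv_integrable[OF integrable_norm[OF f(1)] k] by simp
  have i2: "integrable lebesgue (\<lambda>y. j (x - y) * (norm (f y))\<^sup>2)"
    using conv_integrable[OF f(2) k] by simp
  have "norm (conv f j x) \<le> (LINT y|lebesgue. norm (j (x - y) *\<^sub>R f y))"
    unfolding conv_def by (rule integral_norm_bound)
  also have "\<dots> = c"
    unfolding c_def using j0 by simp
  finally have nc: "norm (conv f j x) \<le> c" .
  have "(LINT y|lebesgue. 2 * c * (j (x - y) * norm (f y)))
      \<le> (LINT y|lebesgue. c\<^sup>2 * j (x - y) + j (x - y) * (norm (f y))\<^sup>2)"
  proof (rule integral_mono)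
    fix y
    have "0 \<le> j (x - y) * (c - norm (f y))\<^sup>2" using j0 by simp
    then show "2 * c * (j (x - y) * norm (f y)) \<le> c\<^sup>2 * j (x - y) + j (x - y) * (norm (f y))\<^sup>2"
      by (simp add: power2_diff algebra_simps)
  qed (use i1 i2 mollifier_reflect[OF j] in auto)
  then have "2 * c * c \<le> c\<^sup>2 + (LINT y|lebesgue. j (x - y) * (norm (f y))\<^sup>2)"
    using i1 i2 mollifier_reflect[OF j] by (simp add: c_def)
  then have "c\<^sup>2 \<le> (LINT y|lebesgue. j (x - y) * (norm (f y))\<^sup>2)"
    by (simp add: power2_eq_square)
  then show ?thesis
    using power_mono[OF nc, of 2] by simp
qed

text \<open>The pointwise Jensen bound is integrated over x and the integrals are exchanged; the
  density has mass 1 in x as well as in y.\<close>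

lemma sqn_conv_le:
  fixes f :: "'a::euclidean_space \<Rightarrow> 'b::{banach, second_countable_topology}"
  assumes f: "f \<in> borel_measurable lebesgue" "sqn f < \<infinity>" "bounded {x. f x \<noteq> 0}" and j: "mollifier j r"
  shows "sqn (conv f j) \<le> sqn f"
proof -
  have k: "kernel j" and j0: "\<And>x. j x \<ge> 0" using j by (auto simp: mollifier_def)
  have [measurable]: "j \<in> borel_measurable borel" using mollifier_borel[OF j] .
  note i1 = integrable_zero_off_bounded[OF f]
  note i2 = sqn_finite_integrable[OF f(1,2)]
  have [measurable]: "f \<in> borel_measurable lebesgue" by fact
  \<comment> \<open>Fubini is applied for \<open>lborel\<close>, so the square of |f|, known to be
    Lebesgue measurable only, is replaced by a Borel function that equals it almost
    everywhere.\<close>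
  obtain F where F[measurable]: "F \<in> borel_measurable lborel" and "AE x in lborel. ennreal ((norm (f x))\<^sup>2) = F x"
  proof -
    have "(\<lambda>x. ennreal ((norm (f x))\<^sup>2)) \<in> borel_measurable lebesgue" by measurable
    then show thesis using completion_ex_borel_measurable that by blast
  qed
  then have AE: "AE x in lebesgue. ennreal ((norm (f x))\<^sup>2) = F x"
    by (simp add: AE_completion)
  have pt: "ennreal ((norm (conv f j x))\<^sup>2) \<le> (\<integral>\<^sup>+y. ennreal (j (x - y)) * F y \<partial>lborel)" for x
  proof -
    have "ennreal ((norm (conv f j x))\<^sup>2) \<le> ennreal (LINT y|lebesgue. j (x - y) * (norm (f y))\<^sup>2)"
      by (intro ennreal_leI conv_mollifier_power2_le[OF i1 i2 j])
    also have "\<dots> = (\<integral>\<^sup>+y. ennreal (j (x - y) * (norm (f y))\<^sup>2) \<partial>lebesgue)"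
      using conv_integrable[OF i2 k, of x] j0 by (intro nn_integral_eq_integral[symmetric]) auto
    also have "\<dots> = (\<integral>\<^sup>+y. ennreal (j (x - y)) * F y \<partial>lebesgue)"
      using AE j0 by (intro nn_integral_cong_AE) (auto elim!: eventually_mono simp: ennreal_mult)
    finally show ?thesis by (simp add: nn_integral_completion)
  qed
  have "sqn (conv f j) \<le> (\<integral>\<^sup>+x. (\<integral>\<^sup>+y. ennreal (j (x - y)) * F y \<partial>lborel) \<partial>lborel)"
    unfolding sqn_def nn_integral_completion by (intro nn_integral_mono pt)
  also have "\<dots> = (\<integral>\<^sup>+y. (\<integral>\<^sup>+x. ennreal (j (x - y)) * F y \<partial>lborel) \<partial>lborel)"
    by (rule lborel_pair.Fubini') measurable
  also have "\<dots> = (\<integral>\<^sup>+y. F y \<partial>lborel)"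
  proof (rule nn_integral_cong)
    fix y
    have "(\<integral>\<^sup>+x. ennreal (j (x - y)) * F y \<partial>lborel) = (\<integral>\<^sup>+x. ennreal (j (x + - y)) \<partial>lborel) * F y"
      by (subst nn_integral_multc) auto
    also have "(\<integral>\<^sup>+x. ennreal (j (x + - y)) \<partial>lborel) = 1"
      using nn_integral_lborel_shift[of "\<lambda>x. ennreal (j x)" "- y"] mollifier_nn_integral[OF j] by simp
    finally show "(\<integral>\<^sup>+x. ennreal (j (x - y)) * F y \<partial>lborel) = F y" by simp
  qed
  also have "\<dots> = (\<integral>\<^sup>+y. F y \<partial>lebesgue)"
    by (simp add: nn_integral_completion)
  also have "\<dots> = sqn f"
    unfolding sqn_def using AE by (intro nn_integral_cong_AE) (auto elim!: eventually_mono)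
  finally show ?thesis .
qed

section \<open>Mollifiers and cutoff functions\<close>

abbreviation bump :: "'a::euclidean_space \<Rightarrow> real" where
  "bump \<equiv> \<lambda>x. flat 0 (1 - x \<bullet> x)"

lemma bump_nonneg: "bump x \<ge> 0" by (simp add: flat_def)

lemma bump_eq_0_iff: "bump x = 0 \<longleftrightarrow> norm x \<ge> 1"
  by (auto simp: flat_def norm_eq_sqrt_inner not_less real_sqrt_ge_1_iff)

lemma kernel_bump: "kernel (bump :: 'a::euclidean_space \<Rightarrow> real)"
proof -
  have "{x::'a. bump x \<noteq> 0} \<subseteq> ball 0 1"
    by (auto simp: bump_eq_0_iff)
  then show ?thesis
    unfolding kernel_def using C_inf_bump bounded_ball bounded_subset by blast
qed

lemma integral_kernel_scale:
  fixes \<phi> :: "'a::euclidean_space \<Rightarrow> real"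
  assumes "continuous_on UNIV \<phi>" "\<And>x. \<phi> x \<ge> 0" "e > 0"
  shows "(LINT x|lebesgue. \<phi> (x /\<^sub>R e)) = e ^ DIM('a) * (LINT x|lebesgue. \<phi> x)"
proof -
  have m[measurable]: "\<phi> \<in> borel_measurable borel"
    using assms(1) borel_measurable_continuous_onI by blast
  have m2: "(\<lambda>x. \<phi> (x /\<^sub>R e)) \<in> borel_measurable borel" by measurable
  have "(\<integral>\<^sup>+x. ennreal (\<phi> (x /\<^sub>R e)) \<partial>lborel) = ennreal (e ^ DIM('a)) * (\<integral>\<^sup>+x. ennreal (\<phi> x) \<partial>lborel)"
    using nn_integral_lborel_scale[of "\<lambda>x. ennreal (\<phi> (x /\<^sub>R e))" e] assms(3) by simp
  then show ?thesis
    using assms m m2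
    by (simp add: integral_completion integral_eq_nn_integral enn2real_mult)
qed

lemma integral_bump_pos: "(LINT x|lebesgue. bump (x::'a::euclidean_space)) > 0"
proof -
  have "(LINT x|lebesgue. bump (x::'a)) \<noteq> 0"
  proof
    assume "(LINT x|lebesgue. bump (x::'a)) = 0"
    then have "AE x::'a in lebesgue. bump x = 0"
      using integral_nonneg_eq_0_iff_AE[OF kernel_integrable[OF kernel_bump]] bump_nonneg by blast
    then have "AE x::'a in lebesgue. x \<notin> ball 0 1"
      by (auto simp: bump_eq_0_iff elim!: eventually_mono)
    then have "emeasure lebesgue (ball (0::'a) 1) = 0"
      by (subst (asm) AE_iff_measurable[OF _ refl]) (auto simp: ball_def)
    then show False
      using unit_ball_vol_pos[of "real DIM('a)"] by (simp add: emeasure_ball)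
  qed
  moreover have "(LINT x|lebesgue. bump (x::'a)) \<ge> 0"
    by (simp add: bump_nonneg)
  ultimately show ?thesis by linarith
qed

definition moll :: "real \<Rightarrow> 'a::euclidean_space \<Rightarrow> real" where
  "moll e x = bump (x /\<^sub>R e) / (e ^ DIM('a) * (LINT x|lebesgue. bump (x::'a)))"

lemma C_inf_moll: "C_inf (moll e :: 'a::euclidean_space \<Rightarrow> real)"
proof -
  have "C_inf (\<lambda>x::'a. bump ((1 / e) *\<^sub>R x + 0))"
    by (rule C_inf_affine) (rule C_inf_bump)
  from C_inf_bounded_linear[OF bounded_linear_mult_left this] show ?thesis
    unfolding moll_def[abs_def] by (simp add: divide_inverse)
qed

lemma mollifier_moll:
  assumes "e > 0"
  shows "mollifier (moll e :: 'a::euclidean_space \<Rightarrow> real) e"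
proof -
  have supp: "moll e x = 0" if "norm x \<ge> e" for x :: 'a
  proof -
    have "norm (x /\<^sub>R e) \<ge> 1"
      using that assms by (simp add: field_simps)
    then show ?thesis
      unfolding moll_def by (simp only: bump_eq_0_iff[THEN iffD2] div_0)
  qed
  then have "{x::'a. moll e x \<noteq> 0} \<subseteq> ball 0 e"
    by (auto simp: not_le[symmetric])
  then have "kernel (moll e :: 'a \<Rightarrow> real)"
    unfolding kernel_def using C_inf_moll bounded_ball bounded_subset by blast
  moreover have "integral\<^sup>L lebesgue (moll e :: 'a \<Rightarrow> real) = 1"
  proof -
    have "(LINT x|lebesgue. bump ((x::'a) /\<^sub>R e)) = e ^ DIM('a) * (LINT x|lebesgue. bump (x::'a))"
      using assms bump_nonneg C_inf_continuous_on[OF C_inf_bump] by (intro integral_kernel_scale)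
    then show ?thesis
      using assms integral_bump_pos[where 'a = 'a] by (simp add: moll_def[abs_def])
  qed
  moreover have "moll e x \<ge> 0" for x :: 'a
    unfolding moll_def using assms integral_bump_pos[where 'a = 'a]
    by (intro divide_nonneg_nonneg bump_nonneg) auto
  ultimately show ?thesis
    using supp unfolding mollifier_def by blast
qed

lemma moll_derivative:
  assumes "e > 0"
  shows "frechet_derivative (moll e) (at (x::'a::euclidean_space)) v
    = frechet_derivative bump (at (x /\<^sub>R e)) v / (e * (e ^ DIM('a) * (LINT x|lebesgue. bump (x::'a))))"
proof -
  have lin: "linear (frechet_derivative bump (at z))" for z :: 'a
    using C_inf_has_derivative[OF C_inf_bump] has_derivative_linear by blast
  have "((\<lambda>x. bump (x /\<^sub>R e)) has_derivative (\<lambda>v. frechet_derivative bump (at (x /\<^sub>R e)) (v /\<^sub>R e))) (at x)"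
    by (rule has_derivative_compose[OF _ C_inf_has_derivative[OF C_inf_bump]])
      (auto intro!: derivative_eq_intros)
  from bounded_linear.has_derivative[OF bounded_linear_divide this]
  have "(moll e has_derivative (\<lambda>v. frechet_derivative bump (at (x /\<^sub>R e)) (v /\<^sub>R e)
      / (e ^ DIM('a) * (LINT x|lebesgue. bump (x::'a))))) (at x)"
    unfolding moll_def[abs_def] .
  from frechet_derivative_at[OF this, symmetric] show ?thesis
    by (simp add: linear_scale[OF lin] divide_inverse)
qed

text \<open>By scaling, a partial derivative of \<open>moll e\<close> has L1 norm proportional to
  1/e. Convolving with a function bounded by 1 thus gives partial derivatives of order 1/e, the
  source of the gradient bound in \<open>cutoff\<close>.\<close>

lemma moll_derivative_integral:
  "\<exists>C\<ge>0. \<forall>e>0. \<forall>i\<in>Basis. (LINT x|lebesgue. \<bar>frechet_derivative (moll e) (at (x::'a::euclidean_space)) i\<bar>) \<le> C / e"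
proof -
  let ?J = "\<lambda>i::'a. (LINT x|lebesgue. \<bar>frechet_derivative bump (at (x::'a)) i\<bar>)"
  let ?I = "LINT x|lebesgue. bump (x::'a)"
  have "(LINT x|lebesgue. \<bar>frechet_derivative (moll e) (at (x::'a)) i\<bar>) \<le> ((\<Sum>i\<in>Basis. ?J i) / ?I) / e"
    if e: "e > 0" and i: "i \<in> Basis" for e i
  proof -
    have "continuous_on UNIV (\<lambda>x::'a. \<bar>frechet_derivative bump (at x) i\<bar>)"
      by (intro continuous_intros C_inf_continuous_on C_inf_derivatives(2) C_inf_bump)
    from integral_kernel_scale[OF this _ e]
    have "(LINT x|lebesgue. \<bar>frechet_derivative bump (at ((x::'a) /\<^sub>R e)) i\<bar>) = e ^ DIM('a) * ?J i" by simp
    then have "(LINT x|lebesgue. \<bar>frechet_derivative (moll e) (at (x::'a)) i\<bar>) = ?J i / ?I / e"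
      using e integral_bump_pos[where 'a = 'a] by (simp add: moll_derivative[OF e] abs_mult)
    also have "\<dots> \<le> ((\<Sum>i\<in>Basis. ?J i) / ?I) / e"
      using e integral_bump_pos[where 'a = 'a] i
      by (intro divide_right_mono member_le_sum) auto
    finally show ?thesis .
  qed
  moreover have "(\<Sum>i\<in>Basis. ?J i) / ?I \<ge> 0"
    using integral_bump_pos[where 'a = 'a] by (intro divide_nonneg_nonneg sum_nonneg) auto
  ultimately show ?thesis by blast
qed

section \<open>Cutoffs between concentric balls\<close>

definition cutoff :: "real \<Rightarrow> 'a::euclidean_space \<Rightarrow> real \<Rightarrow> real \<Rightarrow> ('a \<Rightarrow> real) \<Rightarrow> bool" where
  "cutoff C x0 r s \<kappa> \<longleftrightarrow> C_inf \<kappa> \<and> closure {x. \<kappa> x \<noteq> 0} \<subseteq> ball x0 s \<and> (\<forall>x. 0 \<le> \<kappa> x \<and> \<kappa> x \<le> 1) \<and>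
    (\<forall>x\<in>ball x0 r. \<kappa> x = 1) \<and> (\<forall>x. \<forall>i\<in>Basis. \<bar>frechet_derivative \<kappa> (at x) i\<bar> \<le> C / (s - r))"

text \<open>The cutoff is the mollified indicator of an intermediate ball. One C serves all centres
  and radii, so that the constant of the energy estimate does not change along the
  iteration.\<close>

lemma cutoff_exists:
  obtains C where "C > 0"
    "\<And>(x0::'a::euclidean_space) r s. 0 < r \<Longrightarrow> r < s \<Longrightarrow> \<exists>\<kappa>. cutoff C x0 r s \<kappa>"
proof -
  obtain C where C: "C \<ge> 0" "\<And>e i. e > 0 \<Longrightarrow> i \<in> Basis \<Longrightarrow>
      (LINT x|lebesgue. \<bar>frechet_derivative (moll e) (at (x::'a)) i\<bar>) \<le> C / e"
    using moll_derivative_integral by metis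
  show thesis
  \<comment> \<open>The mollifying radius is a quarter of s - r, whence \<open>C / e\<close> is
    \<open>4 * C / (s - r)\<close>; adding 1 makes the constant positive even if C is 0.\<close>
  proof (rule that[of "4 * C + 1"])
    show "0 < 4 * C + 1" using C(1) by simp
    fix x0 :: 'a and r s :: real assume r: "0 < r" "r < s"
    \<comment> \<open>The middle radius t is at distance 2 e from both r and s. Mollifying with
      radius e therefore keeps the value 1 on the ball of radius r and keeps the support inside the
      ball of radius s.\<close>
    define e where "e = (s - r) / 4"
    define t where "t = (r + s) / 2"
    have e: "e > 0" "r + e < t" "t + e < s" using r by (auto simp: e_def t_def field_simps)
    define f where "f = indicat_real (ball x0 t)"
    define \<kappa> where "\<kappa> = conv f (moll e)"
    note mm = mollifier_moll[OF e(1), where 'a = 'a]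
    have k: "kernel (moll e :: 'a \<Rightarrow> real)" and k0: "\<And>x::'a. moll e x \<ge> 0" and
      ks: "\<And>x::'a. norm x \<ge> e \<Longrightarrow> moll e x = 0" using mm by (auto simp: mollifier_def)
    have f: "integrable lebesgue f"
      unfolding f_def by (auto simp: emeasure_lborel_ball_finite[simplified])
    have f01: "0 \<le> f x" "f x \<le> 1" for x by (auto simp: f_def indicator_def)
    have "{x. \<kappa> x \<noteq> 0} \<subseteq> cball x0 (t + e)"
    proof (rule subsetI, rule ccontr)
      fix x assume x: "x \<in> {x. \<kappa> x \<noteq> 0}" "x \<notin> cball x0 (t + e)"
      have "\<kappa> x = 0"
        unfolding \<kappa>_def
      proof (rule conv_eq_0)
        fix y assume "f y \<noteq> 0"
        then have "dist x0 y < t" by (auto simp: f_def indicator_def split: if_splits)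
        then have "norm (x - y) \<ge> e"
          using x(2) dist_triangle[of x0 x y] by (simp add: dist_norm norm_minus_commute)
        then show "moll e (x - y) = 0" by (rule ks)
      qed
      then show False using x by simp
    qed
    then have "closure {x. \<kappa> x \<noteq> 0} \<subseteq> cball x0 (t + e)"
      by (rule closure_minimal[OF _ closed_cball])
    also have "\<dots> \<subseteq> ball x0 s" using e(3) by auto
    finally have supp: "closure {x. \<kappa> x \<noteq> 0} \<subseteq> ball x0 s" .
    have c0: "\<kappa> x \<ge> 0" for x
      unfolding \<kappa>_def conv_def using f01 k0 by (intro integral_nonneg_AE) auto
    have c1: "\<kappa> x \<le> 1" for x
    proof -
      have "\<kappa> x \<le> (LINT y|lebesgue. moll e (x - y))"
        unfolding \<kappa>_def conv_def
        using conv_integrable[OF f k] mollifier_reflect[OF mm] f01 k0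
        by (intro integral_mono) (auto intro: mult_left_le)
      then show ?thesis using mollifier_reflect(2)[OF mm] by simp
    qed
    have c2: "\<kappa> x = 1" if "x \<in> ball x0 r" for x
    proof -
      have "\<kappa> x = (LINT y|lebesgue. moll e (x - y))"
        unfolding \<kappa>_def conv_def
      proof (rule Bochner_Integration.integral_cong[OF refl])
        fix y
        show "moll e (x - y) *\<^sub>R f y = moll e (x - y)"
        proof (cases "norm (x - y) \<ge> e")
          case False
          then have "dist x0 y < t"
            using that e(2) dist_triangle[of x0 y x] by (simp add: dist_norm)
          then show ?thesis by (simp add: f_def)
        qed (simp add: ks)
      qed
      then show ?thesis using mollifier_reflect(2)[OF mm] by simp
    qed
    have c3: "\<bar>frechet_derivative \<kappa> (at x) i\<bar> \<le> (4 * C + 1) / (s - r)" if "i \<in> Basis" for x i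
    proof -
      let ?D = "\<lambda>z::'a. frechet_derivative (moll e) (at z) i"
      note kD = kernel_derivative[OF k, of i]
      have b: "?D \<in> borel_measurable borel"
        using kD by (simp add: kernel_def C_inf_continuous_on borel_measurable_continuous_onI)
      have "(\<integral>\<^sup>+y. ennreal \<bar>?D (x - y)\<bar> \<partial>lborel) = (\<integral>\<^sup>+y. ennreal \<bar>?D y\<bar> \<partial>lborel)"
        using nn_integral_lborel_reflect[of "\<lambda>z. ennreal \<bar>?D z\<bar>" x] b by simp
      then have n: "(\<integral>\<^sup>+y. ennreal \<bar>?D (x - y)\<bar> \<partial>lebesgue) = ennreal (LINT y|lebesgue. \<bar>?D y\<bar>)"
        using kernel_integrable[OF kD]
        by (simp add: nn_integral_completion nn_integral_eq_integral[symmetric])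
      have mD: "(\<lambda>y. ?D (x - y)) \<in> borel_measurable lebesgue"
        using kernel_measurable[OF kD] .
      have i: "integrable lebesgue (\<lambda>y. \<bar>?D (x - y)\<bar>)" and
        v: "(LINT y|lebesgue. \<bar>?D (x - y)\<bar>) = (LINT y|lebesgue. \<bar>?D y\<bar>)"
        using n mD nn_integral_eq_integrable[of "\<lambda>y. \<bar>?D (x - y)\<bar>" lebesgue "LINT y|lebesgue. \<bar>?D y\<bar>"] by auto
      have "\<bar>frechet_derivative \<kappa> (at x) i\<bar> = norm (LINT y|lebesgue. ?D (x - y) *\<^sub>R f y)"
        unfolding \<kappa>_def conv_frechet_derivative[OF f k] conv_def by simp
      also have "\<dots> \<le> (LINT y|lebesgue. \<bar>?D (x - y)\<bar>)"
        using conv_integrable[OF f kD] i f01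
        by (intro Bochner_Integration.integral_norm_bound_integral) (auto simp: abs_mult intro: mult_left_le)
      also have "\<dots> \<le> C / e" using v C(2)[OF e(1) that] by simp
      also have "\<dots> \<le> (4 * C + 1) / (s - r)"
        using r by (simp add: e_def field_simps)
      finally show ?thesis .
    qed
    have "C_inf \<kappa>" unfolding \<kappa>_def by (rule C_inf_conv[OF f k])
    then show "\<exists>\<kappa>. cutoff (4 * C + 1) x0 r s \<kappa>"
      using supp c0 c1 c2 c3 by (intro exI[of _ \<kappa>]) (simp add: cutoff_def)
  qed
qed

section \<open>Mollification converges in mean square\<close>

lemma ennreal_tendsto_0I:
  fixes u :: "nat \<Rightarrow> ennreal"
  assumes "\<And>\<alpha>. \<alpha> > 0 \<Longrightarrow> \<forall>\<^sub>F k in sequentially. u k \<le> ennreal \<alpha>"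
  shows "u \<longlonglongrightarrow> 0"
proof (rule order_tendstoI)
  fix a :: ennreal assume "0 < a"
  then obtain b where b: "0 < b" "b < a" using dense by blast
  then have "b = ennreal (enn2real b)" by (metis ennreal_enn2real less_top_ennreal less_trans top.not_eq_extremum order_less_le)
  then have "enn2real b > 0" using b(1) by (metis ennreal_less_zero_iff)
  from assms[OF this] show "\<forall>\<^sub>F k in sequentially. u k < a"
    using \<open>b = _\<close> b(2) by (auto elim!: eventually_mono)
qed simp

lemma sqn_indicator:
  fixes A :: "'a::euclidean_space set"
  assumes "A \<in> sets lebesgue"
  shows "sqn (indicat_real A) = emeasure lebesgue A"
proof -
  have "ennreal ((norm (indicat_real A x))\<^sup>2) = indicator A x" for x
    by (simp split: split_indicator)
  then show ?thesis
    unfolding sqn_def using assms by simp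
qed

text \<open>For M > 0 this is the radial projection onto the closed disc of radius M; being
  continuous, it may also be applied to continuous approximants.\<close>

definition trunc :: "real \<Rightarrow> complex \<Rightarrow> complex" where
  "trunc M z = z /\<^sub>R max 1 (norm z / M)"

lemma trunc_simps:
  assumes "M > 0"
  shows "norm (trunc M z) \<le> M" "norm z \<le> M \<Longrightarrow> trunc M z = z" "norm (z - trunc M z) \<le> norm z"
    "trunc M 0 = 0"
proof -
  show "norm (trunc M z) \<le> M"
    using assms by (auto simp: trunc_def max_def field_simps)
  show "norm z \<le> M \<Longrightarrow> trunc M z = z"
    using assms by (auto simp: trunc_def max_def field_simps)
  have "z - trunc M z = (1 - inverse (max 1 (norm z / M))) *\<^sub>R z"
    by (simp add: trunc_def algebra_simps)
  moreover have "0 < inverse (max 1 (norm z / M))" "inverse (max 1 (norm z / M)) \<le> 1"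
    by (auto simp: inverse_le_1_iff)
  ultimately show "norm (z - trunc M z) \<le> norm z"
    by (simp add: mult_left_le_one_le)
qed (simp add: trunc_def)

lemma continuous_on_trunc: "M > 0 \<Longrightarrow> continuous_on UNIV (trunc M)"
  unfolding trunc_def by (intro continuous_intros) (auto simp: max_def)

lemma sqn_trunc:
  fixes f :: "'a::euclidean_space \<Rightarrow> complex"
  assumes [measurable]: "f \<in> borel_measurable lebesgue" and fin: "sqn f < \<infinity>"
  shows "(\<lambda>n. sqn (\<lambda>x. f x - trunc (real (Suc n)) (f x))) \<longlonglongrightarrow> 0"
proof -
  have "(\<lambda>n. \<integral>\<^sup>+x. ennreal ((norm (f x - trunc (real (Suc n)) (f x)))\<^sup>2) \<partial>lebesgue)
      \<longlonglongrightarrow> (\<integral>\<^sup>+x. 0 \<partial>(lebesgue :: 'a measure))"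
  proof (rule nn_integral_dominated_convergence[where w = "\<lambda>x. ennreal ((norm (f x))\<^sup>2)"])
    have [measurable]: "trunc (real (Suc n)) \<in> borel_measurable borel" for n
      using continuous_on_trunc borel_measurable_continuous_onI by (metis of_nat_0_less_iff zero_less_Suc)
    show "(\<lambda>x. ennreal ((norm (f x - trunc (real (Suc n)) (f x)))\<^sup>2)) \<in> borel_measurable lebesgue" for n
      by measurable
    show "AE x in lebesgue. ennreal ((norm (f x - trunc (real (Suc n)) (f x)))\<^sup>2) \<le> ennreal ((norm (f x))\<^sup>2)" for n
      by (intro AE_I2 ennreal_leI power_mono trunc_simps) auto
    show "AE x in lebesgue. (\<lambda>n. ennreal ((norm (f x - trunc (real (Suc n)) (f x)))\<^sup>2)) \<longlonglongrightarrow> 0"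
    proof (rule AE_I2)
      fix x
      obtain N where "norm (f x) \<le> real N" using real_arch_simple by blast
      then have "trunc (real (Suc n)) (f x) = f x" if "n \<ge> N" for n
        using that by (intro trunc_simps) auto
      then have "\<forall>\<^sub>F n in sequentially. ennreal ((norm (f x - trunc (real (Suc n)) (f x)))\<^sup>2) = 0"
        unfolding eventually_sequentially by (intro exI[of _ N]) auto
      then show "(\<lambda>n. ennreal ((norm (f x - trunc (real (Suc n)) (f x)))\<^sup>2)) \<longlonglongrightarrow> 0"
        by (rule tendsto_eventually)
    qed
  qed (use fin in \<open>auto simp: sqn_def\<close>)
  then show ?thesis by (simp add: sqn_def)
qed

text \<open>A Lebesgue measurable f is almost everywhere a limit of continuous functions. Cutting
  these off in space and projecting their values to the disc of radius M does not alter the limit,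
  as f obeys both bounds, and it makes dominated convergence available.\<close>

lemma sqn_dense_bounded:
  fixes f :: "'a::euclidean_space \<Rightarrow> complex"
  assumes m: "f \<in> borel_measurable lebesgue" and M: "M > 0" "\<And>x. norm (f x) \<le> M"
    and supp: "{x. f x \<noteq> 0} \<subseteq> cball 0 R" and e: "e > 0"
  obtains g where "continuous_on UNIV g" "{x. g x \<noteq> 0} \<subseteq> cball 0 (R + 1)"
    "sqn (\<lambda>x. f x - g x) \<le> ennreal e"
proof -
  obtain N g where N: "negligible N" and g: "\<And>n. continuous_on UNIV (g n)"
    "\<And>x. x \<notin> N \<Longrightarrow> (\<lambda>n. g n x) \<longlonglongrightarrow> f x"
    using lebesgue_measurable_imp_measurable_on[OF m, of UNIV] unfolding measurable_on_def by auto
  define \<kappa> where "\<kappa> x = max 0 (min 1 (R + 1 - norm x))" for x :: 'a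
  define h where "h n x = \<kappa> x *\<^sub>R trunc M (g n x)" for n x
  have \<kappa>: "0 \<le> \<kappa> x" "\<kappa> x \<le> 1" "norm x \<le> R \<Longrightarrow> \<kappa> x = 1" "norm x > R + 1 \<Longrightarrow> \<kappa> x = 0" for x
    by (auto simp: \<kappa>_def)
  have ch: "continuous_on UNIV (h n)" for n
    unfolding h_def \<kappa>_def
    by (intro continuous_intros continuous_on_compose2[OF continuous_on_trunc[OF M(1)] g(1)]) auto
  have hM: "norm (h n x) \<le> M * indicat_real (cball 0 (R + 1)) x" for n x
    using \<kappa>(1,2)[of x] \<kappa>(4)[of x] trunc_simps(1)[OF M(1), of "g n x"]
    by (auto simp: h_def indicator_def intro: order_trans[OF mult_left_le_one_le])
  have fM: "norm (f x) \<le> M * indicat_real (cball 0 (R + 1)) x" for x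
    using M(2)[of x] supp by (auto simp: indicator_def)
  have [measurable]: "h n \<in> borel_measurable lebesgue" for n
    using ch borel_measurable_continuous_lebesgue by blast
  have [measurable]: "f \<in> borel_measurable lebesgue" by fact
  have [measurable]: "cball (0::'a) (R + 1) \<in> sets lebesgue" by simp
  have "(\<lambda>n. \<integral>\<^sup>+x. ennreal ((norm (f x - h n x))\<^sup>2) \<partial>lebesgue)
      \<longlonglongrightarrow> (\<integral>\<^sup>+x. 0 \<partial>(lebesgue :: 'a measure))"
  proof (rule nn_integral_dominated_convergence[where
        w = "\<lambda>x. ennreal ((2 * M)\<^sup>2) * indicator (cball 0 (R + 1)) x"])
    show "AE x in lebesgue. ennreal ((norm (f x - h n x))\<^sup>2)
        \<le> ennreal ((2 * M)\<^sup>2) * indicator (cball 0 (R + 1)) x" for n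
    proof (rule AE_I2)
      fix x
      have "norm (f x - h n x) \<le> 2 * M * indicat_real (cball 0 (R + 1)) x"
        using norm_triangle_ineq4[of "f x" "h n x"] fM[of x] hM[of n x] by linarith
      then have "(norm (f x - h n x))\<^sup>2 \<le> (2 * M)\<^sup>2 * indicat_real (cball 0 (R + 1)) x"
        using power_mono[of "norm (f x - h n x)" "2 * M" 2]
        by (auto simp: indicator_def split: if_splits)
      then show "ennreal ((norm (f x - h n x))\<^sup>2) \<le> ennreal ((2 * M)\<^sup>2) * indicator (cball 0 (R + 1)) x"
        by (auto simp: indicator_def intro: ennreal_leI split: if_splits)
    qed
    have "AE x in lebesgue. x \<notin> N"
      using N by (simp add: AE_not_in negligible_iff_null_sets)
    then show "AE x in lebesgue. (\<lambda>n. ennreal ((norm (f x - h n x))\<^sup>2)) \<longlonglongrightarrow> 0"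
    proof (rule eventually_mono)
      fix x assume "x \<notin> N"
      then have "(\<lambda>n. trunc M (g n x)) \<longlonglongrightarrow> trunc M (f x)"
        using continuous_on_trunc[OF M(1)] g(2) continuous_on_tendsto_compose by fastforce
      then have "(\<lambda>n. h n x) \<longlonglongrightarrow> \<kappa> x *\<^sub>R f x"
        unfolding h_def using trunc_simps(2)[OF M(1) M(2)] by (auto intro: tendsto_intros)
      moreover have "\<kappa> x *\<^sub>R f x = f x"
        using supp \<kappa>(3)[of x] by (cases "f x = 0") auto
      ultimately have "(\<lambda>n. h n x) \<longlonglongrightarrow> f x" by simp
      then have "(\<lambda>n. (norm (f x - h n x))\<^sup>2) \<longlonglongrightarrow> (norm (f x - f x))\<^sup>2"
        by (intro tendsto_intros)
      from tendsto_ennrealI[OF this] show "(\<lambda>n. ennreal ((norm (f x - h n x))\<^sup>2)) \<longlonglongrightarrow> 0" by simp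
    qed
    show "(\<integral>\<^sup>+x. ennreal ((2 * M)\<^sup>2) * indicator (cball 0 (R + 1)) x \<partial>(lebesgue :: 'a measure)) < \<infinity>"
      using emeasure_lborel_cball_finite[of "0::'a" "R + 1"]
      by (subst nn_integral_cmult_indicator) (simp_all add: ennreal_mult_less_top)
  qed measurable
  then have "(\<lambda>n. sqn (\<lambda>x. f x - h n x)) \<longlonglongrightarrow> 0" by (simp add: sqn_def)
  then have "\<forall>\<^sub>F n in sequentially. sqn (\<lambda>x. f x - h n x) < ennreal e"
    using e by (intro order_tendstoD(2)) auto
  then obtain n where n: "sqn (\<lambda>x. f x - h n x) < ennreal e"
    by (auto simp: eventually_sequentially)
  have "{x. h n x \<noteq> 0} \<subseteq> cball 0 (R + 1)"
    using \<kappa>(4) unfolding h_def by (force simp: not_le[symmetric])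
  then show thesis
    using that[OF ch[of n]] n by (auto intro: less_imp_le)
qed

text \<open>Truncation of the values reduces this to the bounded case. Each of the two errors is e /
  4, since \<open>sqn_add\<close> doubles both.\<close>

lemma sqn_dense:
  fixes f :: "'a::euclidean_space \<Rightarrow> complex"
  assumes m[measurable]: "f \<in> borel_measurable lebesgue" and fin: "sqn f < \<infinity>"
    and supp: "{x. f x \<noteq> 0} \<subseteq> cball 0 R" and e: "e > 0"
  obtains g where "continuous_on UNIV g" "{x. g x \<noteq> 0} \<subseteq> cball 0 (R + 1)"
    "sqn (\<lambda>x. f x - g x) \<le> ennreal e"
proof -
  have "\<forall>\<^sub>F n in sequentially. sqn (\<lambda>x. f x - trunc (real (Suc n)) (f x)) < ennreal (e / 4)"
    using e sqn_trunc[OF m fin] by (intro order_tendstoD(2)) auto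
  then obtain n where n: "sqn (\<lambda>x. f x - trunc (real (Suc n)) (f x)) < ennreal (e / 4)"
    by (auto simp: eventually_sequentially)
  define h where "h x = trunc (real (Suc n)) (f x)" for x
  have [measurable]: "trunc (real (Suc n)) \<in> borel_measurable borel"
    using continuous_on_trunc borel_measurable_continuous_onI by (metis of_nat_0_less_iff zero_less_Suc)
  have mh[measurable]: "h \<in> borel_measurable lebesgue"
    unfolding h_def by measurable
  have M: "real (Suc n) > 0" by simp
  have hM: "norm (h x) \<le> real (Suc n)" for x
    unfolding h_def by (rule trunc_simps(1)[OF M])
  have hs: "{x. h x \<noteq> 0} \<subseteq> cball 0 R"
    using supp trunc_simps(4)[OF M] unfolding h_def by force
  obtain g where g: "continuous_on UNIV g" "{x. g x \<noteq> 0} \<subseteq> cball 0 (R + 1)"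
    "sqn (\<lambda>x. h x - g x) \<le> ennreal (e / 4)"
    using sqn_dense_bounded[OF mh M hM hs, of "e / 4"] e by auto
  have [measurable]: "g \<in> borel_measurable lebesgue"
    using g(1) borel_measurable_continuous_lebesgue by blast
  have "sqn (\<lambda>x. f x - g x) = sqn (\<lambda>x. (f x - h x) + (h x - g x))" by simp
  also have "\<dots> \<le> 2 * sqn (\<lambda>x. f x - h x) + 2 * sqn (\<lambda>x. h x - g x)"
    by (rule sqn_add) measurable
  also have "\<dots> \<le> 2 * ennreal (e / 4) + 2 * ennreal (e / 4)"
    using n g(3) unfolding h_def by (intro add_mono mult_left_mono) auto
  also have "\<dots> = ennreal e"
    using e by (simp add: ennreal_mult'[symmetric] ennreal_plus[symmetric] flip: ennreal_numeral del: ennreal_plus)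
  finally show thesis using that g by blast
qed

lemma conv_mollifier_uniform:
  fixes g :: "'a::euclidean_space \<Rightarrow> complex"
  assumes g: "integrable lebesgue g" and j: "mollifier j r" and d: "\<And>y. norm (x - y) < r \<Longrightarrow> norm (g y - g x) \<le> w"
  shows "norm (conv g j x - g x) \<le> w"
proof -
  have k: "kernel j" and j0: "\<And>x. j x \<ge> 0" and js: "\<And>x. norm x \<ge> r \<Longrightarrow> j x = 0" using j by (auto simp: mollifier_def)
  note i = conv_integrable[OF g k, of x]
  note i2 = mollifier_reflect[OF j]
  have "conv g j x - g x = (LINT y|lebesgue. j (x - y) *\<^sub>R (g y - g x))"
    unfolding conv_def using i i2 by (simp add: scaleR_right_diff_distrib)
  also have "norm \<dots> \<le> (LINT y|lebesgue. j (x - y) * w)"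
  proof (rule Bochner_Integration.integral_norm_bound_integral)
    show "integrable lebesgue (\<lambda>y. j (x - y) *\<^sub>R (g y - g x))"
      using i i2 by (simp add: scaleR_right_diff_distrib)
    fix y
    show "norm (j (x - y) *\<^sub>R (g y - g x)) \<le> j (x - y) * w"
      using j0[of "x - y"] js[of "x - y"] d[of y] by (cases "norm (x - y) < r") (auto intro: mult_left_mono)
  qed (use i2 in auto)
  also have "\<dots> = w" using i2 by simp
  finally show ?thesis .
qed

lemma conv_moll_tendsto_continuous:
  fixes g :: "'a::euclidean_space \<Rightarrow> complex"
  assumes g: "continuous_on UNIV g" "{x. g x \<noteq> 0} \<subseteq> cball 0 R"
  shows "(\<lambda>k. sqn (\<lambda>x. conv g (moll (1 / real (Suc k))) x - g x)) \<longlonglongrightarrow> 0"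
proof (rule ennreal_tendsto_0I)
  fix \<alpha> :: real assume \<alpha>: "\<alpha> > 0"
  define V where "V = measure lebesgue (cball (0::'a) (R + 1))"
  have V: "emeasure lebesgue (cball (0::'a) (R + 1)) = ennreal V"
    unfolding V_def by (intro emeasure_eq_ennreal_measure) (simp add: emeasure_lborel_cball_finite[simplified] less_top)
  have V0: "V \<ge> 0" by (simp add: V_def)
  \<comment> \<open>The uniform error allowed on the ball of radius R + 1, off which g and its
    mollification both vanish. The summand 1 guards against V = 0.\<close>
  define w where "w = sqrt (\<alpha> / (V + 1))"
  have w: "w > 0" "w\<^sup>2 * V \<le> \<alpha>" using \<alpha> V0 by (auto simp: w_def field_simps)
  \<comment> \<open>Mollifying radii are at most 1, so values up to one unit beyond
    \<open>cball 0 (R + 1)\<close> enter.\<close>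
  have "uniformly_continuous_on (cball 0 (R + 2)) g"
    using g(1) by (intro compact_uniformly_continuous continuous_on_subset[OF g(1)]) auto
  then obtain d where d: "d > 0" "\<And>x y. x \<in> cball 0 (R + 2) \<Longrightarrow> y \<in> cball 0 (R + 2) \<Longrightarrow> dist y x < d \<Longrightarrow> dist (g y) (g x) < w"
    using w(1) unfolding uniformly_continuous_on_def by metis
  have gi: "integrable lebesgue g"
  proof -
    obtain B where B: "\<And>x. x \<in> cball 0 R \<Longrightarrow> norm (g x) \<le> B"
      using compact_imp_bounded[OF compact_continuous_image[OF continuous_on_subset[OF g(1)] compact_cball]]
      unfolding bounded_iff by (metis image_eqI subset_UNIV)
    show ?thesis
    proof (rule Bochner_Integration.integrable_bound[of _ "\<lambda>x. B * indicat_real (cball 0 R) x"])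
      show "AE x in lebesgue. norm (g x) \<le> norm (B * indicat_real (cball 0 R) x)"
        using B g(2) by (intro AE_I2) (force simp: indicator_def)
    qed (use g(1) in \<open>auto simp: emeasure_lborel_cball_finite[simplified] borel_measurable_continuous_lebesgue\<close>)
  qed
  have "\<forall>\<^sub>F k in sequentially. 1 / real (Suc k) < d"
    using d(1) order_tendstoD(2)[OF LIMSEQ_inverse_real_of_nat, of d] by (simp add: inverse_eq_divide)
  then show "\<forall>\<^sub>F k in sequentially. sqn (\<lambda>x. conv g (moll (1 / real (Suc k))) x - g x) \<le> ennreal \<alpha>"
  proof (rule eventually_mono)
    fix k assume k: "1 / real (Suc k) < d"
    have r: "1 / real (Suc k) > 0" "1 / real (Suc k) \<le> 1" by auto
    note j = mollifier_moll[OF r(1), where 'a = 'a]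
    have b: "norm (conv g (moll (1 / real (Suc k))) x - g x) \<le> w * indicat_real (cball 0 (R + 1)) x" for x
    proof (cases "x \<in> cball 0 (R + 1)")
      case True
      have "norm (conv g (moll (1 / real (Suc k))) x - g x) \<le> w"
      proof (rule conv_mollifier_uniform[OF gi j])
        fix y assume y: "norm (x - y) < 1 / real (Suc k)"
        then have "norm (x - y) < 1" using r(2) by linarith
        then have "norm y \<le> R + 2"
          using True norm_triangle_ineq2[of y x] by (simp add: norm_minus_commute)
        then have "dist (g y) (g x) < w"
          using True y k by (intro d(2)) (auto simp: dist_norm norm_minus_commute)
        then show "norm (g y - g x) \<le> w" by (simp add: dist_norm)
      qed
      then show ?thesis using True by simp
    next
      case False
      have "norm (conv g (moll (1 / real (Suc k))) x - g x) \<le> 0"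
      proof (rule conv_mollifier_uniform[OF gi j])
        fix y assume y: "norm (x - y) < 1 / real (Suc k)"
        then have "norm (x - y) < 1" using r(2) by linarith
        then have "y \<notin> cball 0 R" "x \<notin> cball 0 R"
          using False norm_triangle_ineq2[of x y] by auto
        then have "g y = 0" "g x = 0" using g(2) by blast+
        then show "norm (g y - g x) \<le> 0" by simp
      qed
      then show ?thesis using False by simp
    qed
    have "sqn (\<lambda>x. conv g (moll (1 / real (Suc k))) x - g x) \<le> ennreal (w\<^sup>2) * sqn (indicat_real (cball (0::'a) (R + 1)))"
      by (rule sqn_scaleR_le) (use b w in \<open>auto intro!: borel_measurable_indicator\<close>)
    also have "sqn (indicat_real (cball (0::'a) (R + 1))) = ennreal V"
      unfolding V[symmetric] by (rule sqn_indicator) auto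
    also have "ennreal (w\<^sup>2) * ennreal V \<le> ennreal \<alpha>"
      using w V0 by (simp add: ennreal_mult'[symmetric] ennreal_leI)
    finally show "sqn (\<lambda>x. conv g (moll (1 / real (Suc k))) x - g x) \<le> ennreal \<alpha>" .
  qed
qed

lemma sqn_continuous_finite:
  fixes g :: "'a::euclidean_space \<Rightarrow> complex"
  assumes g: "continuous_on UNIV g" "{x. g x \<noteq> 0} \<subseteq> cball 0 R"
  shows "sqn g < \<infinity>"
proof -
  obtain B where B: "\<And>x. x \<in> cball 0 R \<Longrightarrow> norm (g x) \<le> B"
    using compact_imp_bounded[OF compact_continuous_image[OF continuous_on_subset[OF g(1)] compact_cball]]
    unfolding bounded_iff by (metis image_eqI subset_UNIV)
  have "norm (g x) \<le> max B 0 * norm (indicat_real (cball 0 R) x)" for x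
    using B[of x] g(2) by (cases "g x = 0") (auto simp: indicator_def)
  then have "sqn g \<le> ennreal ((max B 0)\<^sup>2) * sqn (indicat_real (cball (0::'a) R))"
    by (rule sqn_scaleR_le) (auto intro!: borel_measurable_indicator)
  also have "sqn (indicat_real (cball (0::'a) R)) = emeasure lebesgue (cball (0::'a) R)"
    by (rule sqn_indicator) auto
  also have "ennreal ((max B 0)\<^sup>2) * emeasure lebesgue (cball (0::'a) R) < \<infinity>"
    using emeasure_lborel_cball_finite[of "0::'a" R] by (simp add: ennreal_mult_less_top)
  finally show ?thesis .
qed

text \<open>Density argument: for a continuous g close to f, the error splits into the mollification
  of f - g, the error for g, and g - f. The first part is controlled for all radii at once by
  \<open>sqn_conv_le\<close>.\<close>

lemma conv_moll_tendsto:
  fixes f :: "'a::euclidean_space \<Rightarrow> complex"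
  assumes m[measurable]: "f \<in> borel_measurable lebesgue" and fin: "sqn f < \<infinity>"
    and bd: "bounded {x. f x \<noteq> 0}"
  shows "(\<lambda>k. sqn (\<lambda>x. conv f (moll (1 / real (Suc k))) x - f x)) \<longlonglongrightarrow> 0"
proof (rule ennreal_tendsto_0I)
  fix \<alpha> :: real assume \<alpha>: "\<alpha> > 0"
  obtain R where R: "{x. f x \<noteq> 0} \<subseteq> cball 0 R"
    using bd bounded_subset_ballD[of _ 0] ball_subset_cball by (metis subset_trans)
  \<comment> \<open>The weights 4, 4, 2 of \<open>sqn_add3\<close> turn the errors \<alpha>/12,
    \<alpha>/8, \<alpha>/12 into \<alpha>/3 + \<alpha>/2 + \<alpha>/6.\<close>
  obtain g where g: "continuous_on UNIV g" "{x. g x \<noteq> 0} \<subseteq> cball 0 (R + 1)"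
    "sqn (\<lambda>x. f x - g x) \<le> ennreal (\<alpha> / 12)"
    using sqn_dense[OF m fin R, of "\<alpha> / 12"] \<alpha> by auto
  have mg[measurable]: "g \<in> borel_measurable lebesgue"
    using g(1) borel_measurable_continuous_lebesgue by blast
  note fing = sqn_continuous_finite[OF g(1,2)]
  have bg: "bounded {x. g x \<noteq> 0}" using g(2) bounded_subset by blast
  have bfg: "bounded {x. f x - g x \<noteq> 0}"
    by (rule bounded_subset[of "{x. f x \<noteq> 0} \<union> {x. g x \<noteq> 0}"]) (use bd bg in auto)
  have finfg: "sqn (\<lambda>x. f x - g x) < \<infinity>"
    using g(3) by (auto intro: le_less_trans)
  note if' = integrable_zero_off_bounded[OF m fin bd] and ig = integrable_zero_off_bounded[OF mg fing bg]
  have "\<forall>\<^sub>F k in sequentially. sqn (\<lambda>x. conv g (moll (1 / real (Suc k))) x - g x) < ennreal (\<alpha> / 8)"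
    using \<alpha> conv_moll_tendsto_continuous[OF g(1,2)] by (intro order_tendstoD(2)) auto
  then show "\<forall>\<^sub>F k in sequentially. sqn (\<lambda>x. conv f (moll (1 / real (Suc k))) x - f x) \<le> ennreal \<alpha>"
  proof (rule eventually_mono)
    fix k :: nat
    define j where "j = (moll (1 / real (Suc k)) :: 'a \<Rightarrow> real)"
    assume k: "sqn (\<lambda>x. conv g (moll (1 / real (Suc k))) x - g x) < ennreal (\<alpha> / 8)"
    have j: "mollifier j (1 / real (Suc k))" unfolding j_def by (rule mollifier_moll) auto
    then have kj: "kernel j" by (simp add: mollifier_def)
    have mc: "conv h j \<in> borel_measurable lebesgue" if "integrable lebesgue h" for h :: "'a \<Rightarrow> complex"
      using C_inf_conv[OF that kj] C_inf_continuous_on borel_measurable_continuous_lebesgue by blast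
    have ifg: "integrable lebesgue (\<lambda>x. f x - g x)" using if' ig by simp
    have eq: "conv f j x - f x = conv (\<lambda>x. f x - g x) j x + (conv g j x - g x) + (g x - f x)" for x
      using conv_integrable[OF if' kj, of x] conv_integrable[OF ig kj, of x]
      by (simp add: conv_def scaleR_right_diff_distrib)
    have "sqn (\<lambda>x. conv f j x - f x)
        = sqn (\<lambda>x. conv (\<lambda>x. f x - g x) j x + (conv g j x - g x) + (g x - f x))"
      by (intro arg_cong[where f = sqn] ext eq)
    also have "\<dots> \<le> 4 * sqn (conv (\<lambda>x. f x - g x) j) + 4 * sqn (\<lambda>x. conv g j x - g x) + 2 * sqn (\<lambda>x. g x - f x)"
      using mc[OF ifg] mc[OF ig] by (intro sqn_add3) auto
    also have "\<dots> \<le> 4 * ennreal (\<alpha> / 12) + 4 * ennreal (\<alpha> / 8) + 2 * ennreal (\<alpha> / 12)"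
      using order_trans[OF sqn_conv_le[OF _ finfg bfg j] g(3)] k g(3)
      by (intro add_mono mult_left_mono) (auto simp: j_def sqn_minus[of g f])
    also have "\<dots> = ennreal \<alpha>"
      using \<alpha> by (simp add: ennreal_mult'[symmetric] ennreal_plus[symmetric] flip: ennreal_numeral del: ennreal_plus)
    finally show "sqn (\<lambda>x. conv f (moll (1 / real (Suc k))) x - f x) \<le> ennreal \<alpha>" by (simp add: j_def)
  qed
qed

section \<open>An interpolation inequality\<close>

text \<open>The fundamental theorem of calculus along the segment from x to x + h, followed by
  Cauchy-Schwarz on the unit interval; the latter comes from 2 c t \<le> c^2 + t^2 with c the mean
  of the norm of the derivative.\<close>

lemma kernel_translation_pointwise:
  fixes \<psi> :: "'a::euclidean_space \<Rightarrow> complex"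
  assumes k: "kernel \<psi>"
  shows "ennreal ((norm (\<psi> (x + h) - \<psi> x))\<^sup>2)
    \<le> (\<integral>\<^sup>+t. ennreal ((norm (frechet_derivative \<psi> (at (x + t *\<^sub>R h)) h))\<^sup>2) * indicator {0..1} t \<partial>lborel)"
proof -
  let ?p = "\<lambda>t. frechet_derivative \<psi> (at (x + t *\<^sub>R h)) h"
  have C: "C_inf \<psi>" using k kernel_def by blast
  have cp: "continuous_on S ?p" for S
    by (rule continuous_on_compose2[OF C_inf_continuous_on[OF C_inf_derivatives(2)[OF C], of UNIV]])
      (auto intro!: continuous_intros)
  have "(?p has_integral \<psi> (x + 1 *\<^sub>R h) - \<psi> (x + 0 *\<^sub>R h)) {0..1}"
  proof (rule fundamental_theorem_of_calculus)
    fix t :: real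
    have "((\<lambda>t. \<psi> (x + t *\<^sub>R h)) has_derivative (\<lambda>s. frechet_derivative \<psi> (at (x + t *\<^sub>R h)) (s *\<^sub>R h))) (at t within {0..1})"
      by (rule has_derivative_compose[OF _ C_inf_has_derivative[OF C]]) (auto intro!: derivative_eq_intros)
    then show "((\<lambda>t. \<psi> (x + t *\<^sub>R h)) has_vector_derivative ?p t) (at t within {0..1})"
      using linear_scale[OF has_derivative_linear[OF C_inf_has_derivative[OF C]]]
      by (simp add: has_vector_derivative_def)
  qed simp
  then have I: "integral {0..1} ?p = \<psi> (x + h) - \<psi> x" by (simp add: integral_unique)
  define c where "c = integral {0..1} (\<lambda>t. norm (?p t))"
  have i: "(\<lambda>t. norm (?p t)) integrable_on {0..1}" "?p integrable_on {0..1}"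
     "(\<lambda>t. (norm (?p t))\<^sup>2) integrable_on {0..1}"
    by (intro integrable_continuous_interval continuous_intros cp)+
  have nc: "norm (\<psi> (x + h) - \<psi> x) \<le> c"
    unfolding c_def I[symmetric] using i by (intro integral_norm_bound_integral) auto
  have "integral {0..1} (\<lambda>t. 2 * c * norm (?p t)) \<le> integral {0..1} (\<lambda>t. c\<^sup>2 + (norm (?p t))\<^sup>2)"
  proof (rule integral_le)
    fix t show "2 * c * norm (?p t) \<le> c\<^sup>2 + (norm (?p t))\<^sup>2"
      using zero_le_power2[of "c - norm (?p t)"] by (simp add: power2_diff)
  qed (use i in \<open>auto intro!: integrable_on_mult_right integrable_add\<close>)
  moreover have "integral {0..1} (\<lambda>t. c\<^sup>2 + (norm (?p t))\<^sup>2) = c\<^sup>2 + integral {0..1} (\<lambda>t. (norm (?p t))\<^sup>2)"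
    by (subst Henstock_Kurzweil_Integration.integral_add) (use i in auto)
  ultimately have "2 * c * c \<le> c\<^sup>2 + integral {0..1} (\<lambda>t. (norm (?p t))\<^sup>2)"
    by (simp add: c_def)
  then have "c\<^sup>2 \<le> integral {0..1} (\<lambda>t. (norm (?p t))\<^sup>2)" by (simp add: power2_eq_square)
  then have "(norm (\<psi> (x + h) - \<psi> x))\<^sup>2 \<le> integral {0..1} (\<lambda>t. (norm (?p t))\<^sup>2)"
    using power_mono[OF nc, of 2] by simp
  moreover have "(\<integral>\<^sup>+t. ennreal ((norm (?p t))\<^sup>2) * indicator {0..1} t \<partial>lborel)
     = ennreal (integral {0..1} (\<lambda>t. (norm (?p t))\<^sup>2))"
    using i by (intro nn_integral_has_integral_lebesgue') auto
  ultimately show ?thesis by (metis ennreal_leI)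
qed

lemma norm_linear_power2_le:
  fixes L :: "'a::euclidean_space \<Rightarrow> 'b::real_normed_vector"
  assumes "linear L"
  shows "(norm (L h))\<^sup>2 \<le> (norm h)\<^sup>2 * real DIM('a) * (\<Sum>i\<in>Basis. (norm (L i))\<^sup>2)"
proof -
  have "(norm (L h))\<^sup>2 \<le> (norm h)\<^sup>2 * (\<Sum>i\<in>Basis. norm (L i))\<^sup>2"
    using power_mono[OF norm_linear_le_sum_Basis[OF assms, of h], of 2] by (simp add: power_mult_distrib)
  also have "(\<Sum>i\<in>Basis. norm (L i))\<^sup>2 \<le> real DIM('a) * (\<Sum>i\<in>Basis. (norm (L i))\<^sup>2)"
    using Cauchy_Schwarz_ineq_sum[of "\<lambda>_. 1" "\<lambda>i. norm (L i)" Basis] by simp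
  finally show ?thesis by (simp add: mult_left_mono mult.assoc)
qed

lemma kernel_pd: "kernel \<psi> \<Longrightarrow> kernel (pd \<psi> i)"
  using kernel_derivative[of \<psi> i] by (simp add: pd_def[abs_def])

lemma kernel_borel: "kernel \<phi> \<Longrightarrow> \<phi> \<in> borel_measurable borel"
  by (simp add: kernel_def C_inf_continuous_on borel_measurable_continuous_onI)

text \<open>After integration over x, translation invariance makes every point of the segment
  contribute the same integral, that of the squared derivative along h.\<close>

lemma kernel_translation:
  fixes \<psi> :: "'a::euclidean_space \<Rightarrow> complex"
  assumes k: "kernel \<psi>"
  shows "sqn (\<lambda>x. \<psi> (x + h) - \<psi> x) \<le> ennreal ((norm h)\<^sup>2 * real DIM('a)) * (\<Sum>i\<in>Basis. sqn (pd \<psi> i))"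
proof -
  let ?P = "\<lambda>x. frechet_derivative \<psi> (at x) h"
  have [measurable]: "?P \<in> borel_measurable borel"
    using kernel_borel[OF kernel_derivative[OF k]] .
  have [measurable]: "\<psi> \<in> borel_measurable borel" "pd \<psi> i \<in> borel_measurable borel" for i
    using kernel_borel[OF k] kernel_borel[OF kernel_pd[OF k]] .
  have "sqn (\<lambda>x. \<psi> (x + h) - \<psi> x)
     \<le> (\<integral>\<^sup>+x. (\<integral>\<^sup>+t. ennreal ((norm (?P (x + t *\<^sub>R h)))\<^sup>2) * indicator {0..1} t \<partial>lborel) \<partial>lborel)"
    unfolding sqn_def nn_integral_completion by (intro nn_integral_mono kernel_translation_pointwise k)
  also have "\<dots> = (\<integral>\<^sup>+t. (\<integral>\<^sup>+x. ennreal ((norm (?P (x + t *\<^sub>R h)))\<^sup>2) * indicator {0..1} t \<partial>lborel) \<partial>lborel)"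
    by (rule lborel_pair.Fubini') measurable
  also have "\<dots> = (\<integral>\<^sup>+t. sqn ?P * indicator {0..1} t \<partial>(lborel :: real measure))"
  proof (rule nn_integral_cong)
    fix t :: real
    have "(\<integral>\<^sup>+x. ennreal ((norm (?P (x + t *\<^sub>R h)))\<^sup>2) * indicator {0..1} t \<partial>lborel)
        = (\<integral>\<^sup>+x. ennreal ((norm (?P (x + t *\<^sub>R h)))\<^sup>2) \<partial>lborel) * indicator {0..1} t"
      by (rule nn_integral_multc) measurable
    also have "(\<integral>\<^sup>+x. ennreal ((norm (?P (x + t *\<^sub>R h)))\<^sup>2) \<partial>lborel) = sqn ?P"
      using nn_integral_lborel_shift[of "\<lambda>x. ennreal ((norm (?P x))\<^sup>2)" "t *\<^sub>R h"]
      by (simp add: sqn_def nn_integral_completion)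
    finally show "(\<integral>\<^sup>+x. ennreal ((norm (?P (x + t *\<^sub>R h)))\<^sup>2) * indicator {0..1} t \<partial>lborel) = sqn ?P * indicator {0..1} t" .
  qed
  also have "\<dots> = sqn ?P" by (simp add: nn_integral_cmult_indicator)
  also have "\<dots> \<le> (\<integral>\<^sup>+x. ennreal ((norm h)\<^sup>2 * real DIM('a)) * (\<Sum>i\<in>Basis. ennreal ((norm (pd \<psi> i x))\<^sup>2)) \<partial>lebesgue)"
    unfolding sqn_def
  proof (rule nn_integral_mono)
    fix x
    have lin: "linear (frechet_derivative \<psi> (at x))"
      using k C_inf_has_derivative has_derivative_linear kernel_def by blast
    have "ennreal ((norm (?P x))\<^sup>2) \<le> ennreal ((norm h)\<^sup>2 * real DIM('a) * (\<Sum>i\<in>Basis. (norm (pd \<psi> i x))\<^sup>2))"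
      unfolding pd_def by (intro ennreal_leI norm_linear_power2_le lin)
    also have "\<dots> = ennreal ((norm h)\<^sup>2 * real DIM('a)) * (\<Sum>i\<in>Basis. ennreal ((norm (pd \<psi> i x))\<^sup>2))"
      by (simp add: ennreal_mult' sum_ennreal)
    finally show "ennreal ((norm (?P x))\<^sup>2)
        \<le> ennreal ((norm h)\<^sup>2 * real DIM('a)) * (\<Sum>i\<in>Basis. ennreal ((norm (pd \<psi> i x))\<^sup>2))" .
  qed
  also have "\<dots> = ennreal ((norm h)\<^sup>2 * real DIM('a)) * (\<Sum>i\<in>Basis. sqn (pd \<psi> i))"
    unfolding sqn_def nn_integral_completion
    by (subst nn_integral_cmult, measurable, subst nn_integral_sum, measurable)
  finally show ?thesis .
qed

text \<open>Meant for A = |\<psi>(x)| and B = |\<psi>(x + h)|. If B is at most half of A, then d is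
  at least A / 2; otherwise A \<le> 2 B, and the power A^q inside A^2 is traded for B^q.\<close>

lemma power2_le_diff_plus_powr:
  fixes A B q :: real
  assumes "A \<ge> 0" "B \<ge> 0" "\<bar>A - B\<bar> \<le> d" "1 < q" "q < 2"
  shows "A\<^sup>2 \<le> 4 * d\<^sup>2 + 2 powr q * A powr (2 - q) * B powr q"
proof (cases "B \<le> A / 2")
  case True
  then have "A \<le> 2 * d" using assms by linarith
  then have "A\<^sup>2 \<le> (2 * d)\<^sup>2" using assms(1) by (intro power_mono)
  then have "A\<^sup>2 \<le> 4 * d\<^sup>2" by (simp add: power_mult_distrib)
  moreover have "0 \<le> 2 powr q * A powr (2 - q) * B powr q" by simp
  ultimately show ?thesis by linarith
next
  case False
  then have B: "A \<le> 2 * B" "B > 0" using assms by auto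
  have "A\<^sup>2 = A powr (2 - q) * A powr q"
    using assms by (cases "A = 0") (auto simp flip: powr_add powr_numeral)
  also have "\<dots> \<le> A powr (2 - q) * (2 * B) powr q"
    using assms B by (intro mult_left_mono powr_mono2) auto
  also have "\<dots> = 2 powr q * A powr (2 - q) * B powr q"
    using B by (simp add: powr_mult)
  finally show ?thesis using zero_le_power2[of d] by linarith
qed

text \<open>Where the value A of the modulus is at most 4 times the level tau, A^2 is absorbed by A^q; where it is larger,
  few translates can be comparable to A, so the average squared difference dominates A^2.\<close>

lemma power2_le_average:
  fixes \<psi> :: "'a::euclidean_space \<Rightarrow> complex"
  assumes [measurable]: "\<psi> \<in> borel_measurable borel" and q: "1 < q" "q < 2" and l: "l > 0" and \<tau>: "\<tau> \<ge> 0"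
    and V: "V = measure lborel (ball (0::'a) l)"
    and Y: "(\<integral>\<^sup>+x. ennreal (norm (\<psi> x) powr q) \<partial>lborel) \<le> ennreal (V * \<tau> powr q)"
  shows "ennreal (V * (norm (\<psi> x))\<^sup>2)
    \<le> 8 * (\<integral>\<^sup>+h. ennreal ((norm (\<psi> (x + h) - \<psi> x))\<^sup>2) * indicator (ball 0 l) h \<partial>lborel)
       + ennreal (V * (4 * \<tau>) powr (2 - q)) * ennreal (norm (\<psi> x) powr q)"
    (is "_ \<le> 8 * ?D + ?E")
proof -
  define A where "A = norm (\<psi> x)"
  have A0: "A \<ge> 0" by (simp add: A_def)
  have [measurable]: "ball (0::'a) l \<in> sets borel" by simp
  have Vpos: "V > 0" unfolding V using l content_ball_pos by blast
  have eV: "emeasure lborel (ball (0::'a) l) = ennreal V"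
    unfolding V using emeasure_lborel_ball_finite[of "0::'a" l] by (subst emeasure_eq_ennreal_measure) auto
  have A2: "A\<^sup>2 = A powr (2 - q) * A powr q"
    using q A0 by (cases "A = 0") (auto simp flip: powr_add powr_numeral)
  show ?thesis
  proof (cases "A \<le> 4 * \<tau>")
    case True
    have "V * A\<^sup>2 \<le> V * ((4 * \<tau>) powr (2 - q) * A powr q)"
      unfolding A2 using True A0 q Vpos by (intro mult_left_mono mult_right_mono powr_mono2) auto
    then have "ennreal (V * A\<^sup>2) \<le> ?E"
      using Vpos by (simp add: ennreal_mult[symmetric] A_def mult.assoc ennreal_leI)
    then show ?thesis unfolding A_def by (simp add: add_increasing)
  next
    case False
    then have Ap: "A > 4 * \<tau>" "A > 0" using \<tau> by auto
    have "ennreal (V * A\<^sup>2) \<le> 8 * ?D"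
    proof (cases "?D = \<infinity>")
      case True then show ?thesis by (simp add: ennreal_mult_top)
    next
      case False
      then obtain d where d: "?D = ennreal d" "d \<ge> 0" by (cases ?D) auto
      have "ennreal (V * A\<^sup>2) = (\<integral>\<^sup>+h. ennreal (A\<^sup>2) * indicator (ball (0::'a) l) h \<partial>lborel)"
        using Vpos by (subst nn_integral_cmult_indicator) (auto simp: eV ennreal_mult[symmetric] mult.commute)
      also have "\<dots> \<le> (\<integral>\<^sup>+h. 4 * (ennreal ((norm (\<psi> (x + h) - \<psi> x))\<^sup>2) * indicator (ball 0 l) h)
          + ennreal (2 powr q * A powr (2 - q)) * ennreal (norm (\<psi> (x + h)) powr q) \<partial>lborel)"
      proof (rule nn_integral_mono)
        fix h :: 'a
        have "A\<^sup>2 \<le> 4 * (norm (\<psi> (x + h) - \<psi> x))\<^sup>2 + 2 powr q * A powr (2 - q) * norm (\<psi> (x + h)) powr q"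
          unfolding A_def
          using q norm_triangle_ineq3[of "\<psi> x" "\<psi> (x + h)"] norm_minus_commute[of "\<psi> x" "\<psi> (x + h)"]
          by (intro power2_le_diff_plus_powr) auto
        then have "ennreal (A\<^sup>2) \<le> ennreal (4 * (norm (\<psi> (x + h) - \<psi> x))\<^sup>2 + 2 powr q * A powr (2 - q) * norm (\<psi> (x + h)) powr q)"
          by (rule ennreal_leI)
        also have "\<dots> = 4 * ennreal ((norm (\<psi> (x + h) - \<psi> x))\<^sup>2) + ennreal (2 powr q * A powr (2 - q)) * ennreal (norm (\<psi> (x + h)) powr q)"
          by (simp add: ennreal_mult)
        finally show "ennreal (A\<^sup>2) * indicator (ball 0 l) h \<le> 4 * (ennreal ((norm (\<psi> (x + h) - \<psi> x))\<^sup>2) * indicator (ball 0 l) h)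
          + ennreal (2 powr q * A powr (2 - q)) * ennreal (norm (\<psi> (x + h)) powr q)"
          by (auto simp: indicator_def)
      qed
      also have "\<dots> = 4 * ?D + ennreal (2 powr q * A powr (2 - q)) * (\<integral>\<^sup>+h. ennreal (norm (\<psi> (x + h)) powr q) \<partial>lborel)"
        by (simp add: nn_integral_add nn_integral_cmult)
      also have "(\<integral>\<^sup>+h. ennreal (norm (\<psi> (x + h)) powr q) \<partial>lborel) = (\<integral>\<^sup>+h. ennreal (norm (\<psi> h) powr q) \<partial>lborel)"
        using nn_integral_lborel_shift[of "\<lambda>h. ennreal (norm (\<psi> h) powr q)" x] by (simp add: add.commute)
      also have "4 * ?D + ennreal (2 powr q * A powr (2 - q)) * (\<integral>\<^sup>+h. ennreal (norm (\<psi> h) powr q) \<partial>lborel)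
          \<le> 4 * ?D + ennreal (2 powr q * A powr (2 - q)) * ennreal (V * \<tau> powr q)"
        by (intro add_left_mono mult_left_mono Y) auto
      also have "\<dots> = ennreal (4 * d + 2 powr q * A powr (2 - q) * (V * \<tau> powr q))"
        using d Vpos by (simp add: ennreal_mult)
      finally have "V * A\<^sup>2 \<le> 4 * d + 2 powr q * A powr (2 - q) * (V * \<tau> powr q)"
        using d Vpos by (subst (asm) ennreal_le_iff) auto
      \<comment> \<open>Here A > 4 \<tau> enters: 2 \<tau> lies below A / 2, so this term is at most
        V A^2 / 2^q \<le> V A^2 / 2. It is absorbed on the left, which turns the factor 4 into
        8.\<close>
      also have "2 powr q * A powr (2 - q) * (V * \<tau> powr q) = V * A powr (2 - q) * (2 * \<tau>) powr q"
        using \<tau> by (simp add: powr_mult)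
      also have "\<dots> \<le> V * A powr (2 - q) * (A / 2) powr q"
        using Ap \<tau> Vpos q by (intro mult_left_mono powr_mono2) auto
      also have "\<dots> = V * A\<^sup>2 * (1 / 2) powr q"
        using Ap by (simp add: A2 powr_divide)
      also have "\<dots> \<le> V * A\<^sup>2 * (1 / 2) powr 1"
        using Vpos q by (intro mult_left_mono powr_mono') auto
      finally have "V * A\<^sup>2 \<le> 8 * d" by simp
      then have "ennreal (V * A\<^sup>2) \<le> ennreal (8 * d)" by (rule ennreal_leI)
      then show ?thesis using d by (simp add: ennreal_mult)
    qed
    then show ?thesis unfolding A_def by (simp add: add_increasing2)
  qed
qed

text \<open>\<open>power2_le_average\<close> integrated over x. After exchanging the integrals, each
  translate by |h| < l costs at most l^2 N times the gradient term, and the total mass V of these h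
  divides out. The level \<tau> is normalised so that the mean of |\<psi>|^q over any ball of radius
  l is at most \<tau>^q.\<close>

lemma kernel_interpolation:
  fixes \<psi> :: "'a::euclidean_space \<Rightarrow> complex"
  assumes k: "kernel \<psi>" and q: "1 < q" "q < 2" and l: "l > 0" and \<tau>: "\<tau> \<ge> 0"
    and V: "V = measure lborel (ball (0::'a) l)"
    and Y: "(\<integral>\<^sup>+x. ennreal (norm (\<psi> x) powr q) \<partial>lborel) \<le> ennreal (V * \<tau> powr q)"
  shows "sqn \<psi> \<le> ennreal (8 * l\<^sup>2 * real DIM('a)) * (\<Sum>i\<in>Basis. sqn (pd \<psi> i))
    + ennreal ((4 * \<tau>) powr (2 - q) * (V * \<tau> powr q))"
proof -
  have [measurable]: "\<psi> \<in> borel_measurable borel" using kernel_borel[OF k] .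
  have Vpos: "V > 0" unfolding V using l content_ball_pos by blast
  have eV: "emeasure lborel (ball (0::'a) l) = ennreal V"
    unfolding V using emeasure_lborel_ball_finite[of "0::'a" l] by (subst emeasure_eq_ennreal_measure) auto
  have [measurable]: "ball (0::'a) l \<in> sets borel" by simp
  let ?S = "\<Sum>i\<in>Basis. sqn (pd \<psi> i)"
  let ?d = "\<lambda>x h. ennreal ((norm (\<psi> (x + h) - \<psi> x))\<^sup>2) * indicator (ball 0 l) h"
  have [measurable]: "(\<lambda>x. \<integral>\<^sup>+h. ?d x h \<partial>lborel) \<in> borel_measurable lborel"
    by (rule lborel.borel_measurable_nn_integral) measurable
  have "ennreal V * sqn \<psi> = (\<integral>\<^sup>+x. ennreal (V * (norm (\<psi> x))\<^sup>2) \<partial>lborel)"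
    unfolding sqn_def nn_integral_completion using Vpos
    by (subst nn_integral_cmult[symmetric]) (auto simp: ennreal_mult)
  also have "\<dots> \<le> (\<integral>\<^sup>+x. 8 * (\<integral>\<^sup>+h. ?d x h \<partial>lborel)
       + ennreal (V * (4 * \<tau>) powr (2 - q)) * ennreal (norm (\<psi> x) powr q) \<partial>lborel)"
    by (intro nn_integral_mono power2_le_average[OF _ q l \<tau> V Y]) measurable
  also have "\<dots> = 8 * (\<integral>\<^sup>+x. (\<integral>\<^sup>+h. ?d x h \<partial>lborel) \<partial>lborel)
      + ennreal (V * (4 * \<tau>) powr (2 - q)) * (\<integral>\<^sup>+x. ennreal (norm (\<psi> x) powr q) \<partial>lborel)"
    by (subst nn_integral_add, measurable, subst nn_integral_cmult, measurable, subst nn_integral_cmult, measurable)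
  also have "(\<integral>\<^sup>+x. (\<integral>\<^sup>+h. ?d x h \<partial>lborel) \<partial>lborel) = (\<integral>\<^sup>+h. (\<integral>\<^sup>+x. ?d x h \<partial>lborel) \<partial>lborel)"
    by (rule lborel_pair.Fubini') measurable
  also have "\<dots> \<le> (\<integral>\<^sup>+h. (ennreal (l\<^sup>2 * real DIM('a)) * ?S) * indicator (ball (0::'a) l) h \<partial>lborel)"
  proof (rule nn_integral_mono)
    fix h :: 'a
    have "(\<integral>\<^sup>+x. ?d x h \<partial>lborel) = sqn (\<lambda>x. \<psi> (x + h) - \<psi> x) * indicator (ball 0 l) h"
      unfolding sqn_def nn_integral_completion by (rule nn_integral_multc) measurable
    also have "\<dots> \<le> (ennreal ((norm h)\<^sup>2 * real DIM('a)) * ?S) * indicator (ball 0 l) h"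
      by (intro mult_right_mono kernel_translation k) auto
    also have "\<dots> \<le> (ennreal (l\<^sup>2 * real DIM('a)) * ?S) * indicator (ball 0 l) h"
    proof (cases "h \<in> ball 0 l")
      case True
      then have "(norm h)\<^sup>2 * real DIM('a) \<le> l\<^sup>2 * real DIM('a)"
        by (intro mult_right_mono power_mono) auto
      then show ?thesis by (intro mult_right_mono ennreal_leI) auto
    qed auto
    finally show "(\<integral>\<^sup>+x. ?d x h \<partial>lborel) \<le> (ennreal (l\<^sup>2 * real DIM('a)) * ?S) * indicator (ball 0 l) h" .
  qed
  also have "\<dots> = ennreal (l\<^sup>2 * real DIM('a)) * ?S * ennreal V"
    by (subst nn_integral_cmult_indicator) (auto simp: eV)
  finally have "ennreal V * sqn \<psi> \<le> 8 * (ennreal (l\<^sup>2 * real DIM('a)) * ?S * ennreal V)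
      + ennreal (V * (4 * \<tau>) powr (2 - q)) * (\<integral>\<^sup>+x. ennreal (norm (\<psi> x) powr q) \<partial>lborel)"
    by (simp add: add_right_mono mult_left_mono)
  also have "\<dots> \<le> 8 * (ennreal (l\<^sup>2 * real DIM('a)) * ?S * ennreal V)
      + ennreal (V * (4 * \<tau>) powr (2 - q)) * ennreal (V * \<tau> powr q)"
    by (intro add_left_mono mult_left_mono Y) auto
  also have "\<dots> = ennreal V * (ennreal (8 * l\<^sup>2 * real DIM('a)) * ?S + ennreal ((4 * \<tau>) powr (2 - q) * (V * \<tau> powr q)))"
    using Vpos by (simp add: ennreal_mult distrib_left mult_ac)
  finally show ?thesis
    using Vpos ennreal_mult_le_mult_iff[of "ennreal V"] by simp
qed

text \<open>The space of H1 functions on U vanishing on the boundary, for functions extended by zero off U; unlike H1_0,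
  no weak gradient identity is required, since it follows from the approximation.\<close>

definition H10c :: "'a::euclidean_space set \<Rightarrow> ('a \<Rightarrow> complex) \<Rightarrow> ('a \<Rightarrow> 'a \<Rightarrow> complex) \<Rightarrow> bool" where
  "H10c U u Du \<longleftrightarrow> u \<in> borel_measurable lebesgue \<and> (\<forall>i\<in>Basis. Du i \<in> borel_measurable lebesgue)
    \<and> sqn u < \<infinity> \<and> (\<forall>i\<in>Basis. sqn (Du i) < \<infinity>) \<and> (\<forall>x. x \<notin> U \<longrightarrow> u x = 0)
    \<and> (\<forall>x. x \<notin> U \<longrightarrow> (\<forall>i\<in>Basis. Du i x = 0))
    \<and> (\<exists>\<psi>. (\<forall>k. test_fun U (\<psi> k)) \<and> (\<lambda>k. sqn (\<lambda>x. \<psi> k x - u x)) \<longlonglongrightarrow> 0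
      \<and> (\<forall>i\<in>Basis. (\<lambda>k. sqn (\<lambda>x. pd (\<psi> k) i x - Du i x)) \<longlonglongrightarrow> 0))"

section \<open>Interpolation for limits of test functions\<close>

lemma test_fun_kernel: "test_fun U \<phi> \<Longrightarrow> kernel \<phi>"
  unfolding test_fun_def kernel_def
  using bounded_subset[OF compact_imp_bounded closure_subset] by blast

lemma test_fun_support:
  assumes "test_fun U \<phi>" "x \<notin> U"
  shows "\<phi> x = 0" "pd \<phi> i x = 0"
proof -
  have "x \<notin> closure {x. \<phi> x \<noteq> 0}" using assms by (auto simp: test_fun_def)
  then show "\<phi> x = 0" "pd \<phi> i x = 0"
    using closure_subset[of "{x. \<phi> x \<noteq> 0}"] frechet_derivative_off_support[of x \<phi>] by (auto simp: pd_def)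
qed

lemma kernel_lebesgue: "kernel \<phi> \<Longrightarrow> \<phi> \<in> borel_measurable lebesgue"
  by (simp add: kernel_def C_inf_continuous_on borel_measurable_continuous_lebesgue)

lemma powr_add_le:
  fixes a b q :: real
  assumes "a \<ge> 0" "b \<ge> 0" "1 < q" "q < 2"
  shows "(a + b) powr q \<le> 4 * a powr q + 4 * b powr q"
proof -
  have "(a + b) powr q \<le> (2 * max a b) powr q"
    using assms by (intro powr_mono2) auto
  also have "\<dots> = 2 powr q * max a b powr q" using assms by (simp add: powr_mult)
  also have "\<dots> \<le> 2 powr 2 * max a b powr q"
    using assms by (intro mult_right_mono powr_mono) auto
  also have "\<dots> \<le> 4 * (a powr q + b powr q)"
    by (auto simp: max_def)
  finally show ?thesis by simp
qed

text \<open>Where w^q exceeds s, the factor w^(q-2) is at most s^((q-2)/q), because the exponent is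
  negative. Integrated over a set of finite measure, this turns L2 convergence into control of L^q
  integrals, with s as small as desired.\<close>

lemma powr_le_const_plus_power2:
  fixes w q s :: real
  assumes "w \<ge> 0" "1 < q" "q < 2" "s > 0"
  shows "w powr q \<le> s + s powr ((q - 2) / q) * w\<^sup>2"
proof (cases "w powr q \<le> s")
  case True
  then show ?thesis by (simp add: add_increasing2)
next
  case False
  then have w: "w > 0" using assms by (cases "w = 0") auto
  have "w powr q = w powr (q - 2) * w\<^sup>2"
    using w by (simp flip: powr_add powr_numeral)
  also have "w powr (q - 2) = (w powr q) powr ((q - 2) / q)"
    using assms by (simp add: powr_powr)
  also have "\<dots> \<le> s powr ((q - 2) / q)"
    using False assms by (intro powr_mono2') (auto simp: divide_nonpos_pos)
  finally show ?thesis using assms by (simp add: mult_right_mono)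
qed

text \<open>\<open>kernel_interpolation\<close> for the approximating test functions, then the
  limit. Of their L^q integrals only an upper bound is needed: eventually 9 Y, made of 4 Y from u, 4
  Y from the constant s over U, and a last Y from the vanishing L2 error. This is the 9 in
  \<tau>.\<close>

lemma H10c_interpolation:
  fixes u :: "'a::euclidean_space \<Rightarrow> complex"
  assumes H: "H10c U u Du" and U: "open U" "bounded U" and q: "1 < q" "q < 2" and l: "l > 0" and Y: "Y > 0"
    and uY: "(\<integral>\<^sup>+x. ennreal (norm (u x) powr q) \<partial>lebesgue) \<le> ennreal Y"
    and V: "V = measure lborel (ball (0::'a) l)" and \<tau>: "\<tau> = (9 * Y / V) powr (1 / q)"
  shows "sqn u \<le> ennreal (32 * l\<^sup>2 * real DIM('a)) * (\<Sum>i\<in>Basis. sqn (Du i))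
    + ennreal (2 * ((4 * \<tau>) powr (2 - q) * (9 * Y)))"
proof -
  obtain \<psi> where \<psi>: "\<And>k. test_fun U (\<psi> k)" "(\<lambda>k. sqn (\<lambda>x. \<psi> k x - u x)) \<longlonglongrightarrow> 0"
    "\<And>i. i \<in> Basis \<Longrightarrow> (\<lambda>k. sqn (\<lambda>x. pd (\<psi> k) i x - Du i x)) \<longlonglongrightarrow> 0"
    using H unfolding H10c_def by blast
  have k: "kernel (\<psi> k)" for k using test_fun_kernel[OF \<psi>(1)] .
  have [measurable]: "u \<in> borel_measurable lebesgue" and mD[measurable]: "i \<in> Basis \<Longrightarrow> Du i \<in> borel_measurable lebesgue"
    and u0: "x \<notin> U \<Longrightarrow> u x = 0" for i x using H by (auto simp: H10c_def)
  have [measurable]: "\<psi> k \<in> borel_measurable lebesgue" "pd (\<psi> k) i \<in> borel_measurable lebesgue" for k i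
    using kernel_lebesgue[OF k] kernel_lebesgue[OF kernel_pd[OF k]] .
  have Vpos: "V > 0" unfolding V using l content_ball_pos by blast
  have V\<tau>: "V * \<tau> powr q = 9 * Y"
    using Vpos Y q by (simp add: \<tau> powr_powr)
  have [measurable]: "U \<in> sets lebesgue" using U(1) by simp
  have "emeasure lebesgue U < \<infinity>"
    using emeasure_bounded_finite[OF U(2)] U(1) by simp
  then obtain \<mu> where \<mu>: "emeasure lebesgue U = ennreal \<mu>" "\<mu> \<ge> 0" by (cases "emeasure lebesgue U") auto
  define s where "s = Y / (\<mu> + 1)"
  have s: "s > 0" "s * \<mu> \<le> Y" using Y \<mu> by (auto simp: s_def field_simps)
  define c where "c = s powr ((q - 2) / q)"
  have c: "c > 0" using s by (simp add: c_def)
  have qint: "(\<integral>\<^sup>+x. ennreal (norm (\<psi> k x) powr q) \<partial>lborel)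
      \<le> ennreal (8 * Y) + ennreal (4 * c) * sqn (\<lambda>x. \<psi> k x - u x)" for k
  proof -
    have "(\<integral>\<^sup>+x. ennreal (norm (\<psi> k x) powr q) \<partial>lborel) = (\<integral>\<^sup>+x. ennreal (norm (\<psi> k x) powr q) \<partial>lebesgue)"
      by (simp add: nn_integral_completion)
    also have "\<dots> \<le> (\<integral>\<^sup>+x. 4 * ennreal (norm (u x) powr q) + (ennreal (4 * s) * indicator U x
        + ennreal (4 * c) * ennreal ((norm (\<psi> k x - u x))\<^sup>2)) \<partial>lebesgue)"
    proof (rule nn_integral_mono)
      fix x
      show "ennreal (norm (\<psi> k x) powr q) \<le> 4 * ennreal (norm (u x) powr q) + (ennreal (4 * s) * indicator U x
        + ennreal (4 * c) * ennreal ((norm (\<psi> k x - u x))\<^sup>2))"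
      proof (cases "x \<in> U")
        case False
        then show ?thesis using test_fun_support(1)[OF \<psi>(1)] by simp
      next
        case True
        have "norm (\<psi> k x) powr q \<le> (norm (u x) + norm (\<psi> k x - u x)) powr q"
          using q norm_triangle_sub[of "\<psi> k x" "u x"] by (intro powr_mono2) auto
        also have "\<dots> \<le> 4 * norm (u x) powr q + 4 * norm (\<psi> k x - u x) powr q"
          using q by (intro powr_add_le) auto
        also have "\<dots> \<le> 4 * norm (u x) powr q + 4 * (s + c * (norm (\<psi> k x - u x))\<^sup>2)"
          using powr_le_const_plus_power2[OF _ q s(1), of "norm (\<psi> k x - u x)"] unfolding c_def by simp
        finally have "ennreal (norm (\<psi> k x) powr q) \<le> ennreal (4 * norm (u x) powr q + (4 * s + 4 * c * (norm (\<psi> k x - u x))\<^sup>2))"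
          by (intro ennreal_leI) (simp add: algebra_simps)
        also have "\<dots> = 4 * ennreal (norm (u x) powr q) + (ennreal (4 * s) + ennreal (4 * c) * ennreal ((norm (\<psi> k x - u x))\<^sup>2))"
          using s c by (simp add: ennreal_mult)
        finally show ?thesis using True by simp
      qed
    qed
    also have "\<dots> = 4 * (\<integral>\<^sup>+x. ennreal (norm (u x) powr q) \<partial>lebesgue) + (ennreal (4 * s) * emeasure lebesgue U
        + ennreal (4 * c) * sqn (\<lambda>x. \<psi> k x - u x))"
      unfolding sqn_def
      by (simp add: nn_integral_add nn_integral_cmult nn_integral_cmult_indicator)
    also have "\<dots> \<le> 4 * ennreal Y + (ennreal (4 * Y) + ennreal (4 * c) * sqn (\<lambda>x. \<psi> k x - u x))"
    proof -
      have "ennreal (4 * s) * emeasure lebesgue U \<le> ennreal (4 * Y)"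
        using s \<mu> by (simp add: ennreal_mult[symmetric] ennreal_leI)
      then show ?thesis using uY by (intro add_mono mult_left_mono) auto
    qed
    also have "\<dots> = ennreal (8 * Y) + ennreal (4 * c) * sqn (\<lambda>x. \<psi> k x - u x)"
    proof -
      have "4 * ennreal Y + ennreal (4 * Y) = ennreal (8 * Y)"
        using Y by (simp add: ennreal_mult'[symmetric] ennreal_plus[symmetric] flip: ennreal_numeral del: ennreal_plus)
      then show ?thesis by (simp add: add.assoc[symmetric])
    qed
    finally show ?thesis .
  qed
  have "(\<lambda>k. ennreal (4 * c) * sqn (\<lambda>x. \<psi> k x - u x)) \<longlonglongrightarrow> ennreal (4 * c) * 0"
    using \<psi>(2) by (intro ennreal_tendsto_cmult) auto
  from order_tendstoD(2)[OF this, of "ennreal Y"]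
  have "\<forall>\<^sub>F k in sequentially. ennreal (4 * c) * sqn (\<lambda>x. \<psi> k x - u x) < ennreal Y"
    using Y by simp
  then have ev: "\<forall>\<^sub>F k in sequentially. (\<integral>\<^sup>+x. ennreal (norm (\<psi> k x) powr q) \<partial>lborel) \<le> ennreal (V * \<tau> powr q)"
  proof (rule eventually_mono)
    fix k assume k: "ennreal (4 * c) * sqn (\<lambda>x. \<psi> k x - u x) < ennreal Y"
    have "(\<integral>\<^sup>+x. ennreal (norm (\<psi> k x) powr q) \<partial>lborel) \<le> ennreal (8 * Y) + ennreal Y"
      using order_trans[OF qint add_left_mono[OF less_imp_le[OF k]]] .
    also have "\<dots> = ennreal (V * \<tau> powr q)"
      unfolding V\<tau> using Y by (simp add: ennreal_plus[symmetric] del: ennreal_plus)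
    finally show "(\<integral>\<^sup>+x. ennreal (norm (\<psi> k x) powr q) \<partial>lborel) \<le> ennreal (V * \<tau> powr q)" .
  qed
  have two: "(2::ennreal) < top" by simp
  \<comment> \<open>The bound for \<open>sqn u\<close> at stage k. Comparing u with the test
    function doubles 8 to 16, and comparing the gradients with \<open>Du\<close> doubles it once
    more, to the 32 of the limit.\<close>
  define X where "X k = ennreal (16 * l\<^sup>2 * real DIM('a)) * (\<Sum>i\<in>Basis. 2 * sqn (Du i) + 2 * sqn (\<lambda>x. pd (\<psi> k) i x - Du i x))
      + ennreal (2 * ((4 * \<tau>) powr (2 - q) * (9 * Y))) + 2 * sqn (\<lambda>x. \<psi> k x - u x)" for k
  have "X \<longlonglongrightarrow> ennreal (16 * l\<^sup>2 * real DIM('a)) * (\<Sum>i\<in>Basis. 2 * sqn (Du i) + 2 * 0)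
      + ennreal (2 * ((4 * \<tau>) powr (2 - q) * (9 * Y))) + 2 * 0"
    unfolding X_def[abs_def]
  proof (intro tendsto_add tendsto_const)
    show "(\<lambda>k. ennreal (16 * l\<^sup>2 * real DIM('a)) * (\<Sum>i\<in>Basis. 2 * sqn (Du i) + 2 * sqn (\<lambda>x. pd (\<psi> k) i x - Du i x)))
      \<longlonglongrightarrow> ennreal (16 * l\<^sup>2 * real DIM('a)) * (\<Sum>i\<in>Basis. 2 * sqn (Du i) + 2 * 0)"
      by (intro ennreal_tendsto_cmult ennreal_less_top tendsto_sum tendsto_add tendsto_const two \<psi>(3))
    show "(\<lambda>k. 2 * sqn (\<lambda>x. \<psi> k x - u x)) \<longlonglongrightarrow> 2 * 0"
      by (intro ennreal_tendsto_cmult two \<psi>(2))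
  qed
  also have "ennreal (16 * l\<^sup>2 * real DIM('a)) * (\<Sum>i\<in>Basis. 2 * sqn (Du i) + 2 * 0)
      + ennreal (2 * ((4 * \<tau>) powr (2 - q) * (9 * Y))) + 2 * 0
      = ennreal (32 * l\<^sup>2 * real DIM('a)) * (\<Sum>i\<in>Basis. sqn (Du i)) + ennreal (2 * ((4 * \<tau>) powr (2 - q) * (9 * Y)))"
  proof -
    have "ennreal (16 * l\<^sup>2 * real DIM('a)) * 2 = ennreal (32 * l\<^sup>2 * real DIM('a))"
      by (simp add: ennreal_mult'[symmetric] mult.commute flip: ennreal_numeral)
    then show ?thesis by (simp add: sum_distrib_left[symmetric] mult.assoc[symmetric])
  qed
  finally have lim: "X \<longlonglongrightarrow> ennreal (32 * l\<^sup>2 * real DIM('a)) * (\<Sum>i\<in>Basis. sqn (Du i)) + ennreal (2 * ((4 * \<tau>) powr (2 - q) * (9 * Y)))" .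
  from ev have "\<forall>\<^sub>F k in sequentially. sqn u \<le> X k"
  proof (rule eventually_mono)
    fix n assume n: "(\<integral>\<^sup>+x. ennreal (norm (\<psi> n x) powr q) \<partial>lborel) \<le> ennreal (V * \<tau> powr q)"
    have "sqn u = sqn (\<lambda>x. \<psi> n x + (u x - \<psi> n x))" by simp
    also have "\<dots> \<le> 2 * sqn (\<psi> n) + 2 * sqn (\<lambda>x. u x - \<psi> n x)"
      by (rule sqn_add) measurable
    also have "sqn (\<lambda>x. u x - \<psi> n x) = sqn (\<lambda>x. \<psi> n x - u x)" by (rule sqn_minus)
    also have "sqn (\<psi> n) \<le> ennreal (8 * l\<^sup>2 * real DIM('a)) * (\<Sum>i\<in>Basis. sqn (pd (\<psi> n) i))
        + ennreal ((4 * \<tau>) powr (2 - q) * (V * \<tau> powr q))"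
      by (rule kernel_interpolation[OF k q l _ V n]) (simp add: \<tau>)
    also have "(\<Sum>i\<in>Basis. sqn (pd (\<psi> n) i)) \<le> (\<Sum>i\<in>Basis. 2 * sqn (Du i) + 2 * sqn (\<lambda>x. pd (\<psi> n) i x - Du i x))"
    proof (rule sum_mono)
      fix i :: 'a assume [measurable]: "i \<in> Basis"
      have [measurable]: "Du i \<in> borel_measurable lebesgue" using mD[OF \<open>i \<in> Basis\<close>] .
      have "sqn (pd (\<psi> n) i) = sqn (\<lambda>x. Du i x + (pd (\<psi> n) i x - Du i x))" by simp
      also have "\<dots> \<le> 2 * sqn (Du i) + 2 * sqn (\<lambda>x. pd (\<psi> n) i x - Du i x)"
        by (rule sqn_add) measurable
      finally show "sqn (pd (\<psi> n) i) \<le> 2 * sqn (Du i) + 2 * sqn (\<lambda>x. pd (\<psi> n) i x - Du i x)" .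
    qed
    also have "2 * (ennreal (8 * l\<^sup>2 * real DIM('a)) * (\<Sum>i\<in>Basis. 2 * sqn (Du i) + 2 * sqn (\<lambda>x. pd (\<psi> n) i x - Du i x))
        + ennreal ((4 * \<tau>) powr (2 - q) * (V * \<tau> powr q))) + 2 * sqn (\<lambda>x. \<psi> n x - u x) = X n"
    proof -
      have "2 * ennreal (8 * l\<^sup>2 * real DIM('a)) = ennreal (16 * l\<^sup>2 * real DIM('a))"
        "2 * ennreal ((4 * \<tau>) powr (2 - q) * (9 * Y)) = ennreal (2 * ((4 * \<tau>) powr (2 - q) * (9 * Y)))"
        by (simp_all add: ennreal_mult'[symmetric] flip: ennreal_numeral)
      then show ?thesis unfolding X_def V\<tau> by (simp add: distrib_left mult.assoc[symmetric])
    qed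
    finally show "sqn u \<le> X n" by (simp add: add_right_mono mult_left_mono add_mono)
  qed
  then show ?thesis
    by (rule tendsto_lowerbound[OF lim]) simp
qed

section \<open>Localisation by smooth cutoffs\<close>

text \<open>Extension by zero moves a function on U to the whole space, where convolution,
  translation and \<open>sqn\<close> are defined.\<close>

definition restr :: "'a set \<Rightarrow> ('a \<Rightarrow> complex) \<Rightarrow> 'a \<Rightarrow> complex" where
  "restr U f x = (if x \<in> U then f x else 0)"

lemma restr_L2:
  assumes m: "set_borel_measurable lebesgue \<Omega> f" and i: "set_integrable lebesgue K (\<lambda>x. (cmod (f x))\<^sup>2)"
    and U: "U \<in> sets lebesgue" "U \<subseteq> \<Omega>" "U \<subseteq> K"
  shows "restr U f \<in> borel_measurable lebesgue" "sqn (restr U f) < \<infinity>"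
proof -
  have eq: "restr U f = (\<lambda>x. indicat_real U x *\<^sub>R (indicat_real \<Omega> x *\<^sub>R f x))"
    using U by (intro ext) (auto simp: restr_def indicator_def)
  show "restr U f \<in> borel_measurable lebesgue"
    unfolding eq
    by (intro borel_measurable_scaleR borel_measurable_indicator U(1) m[unfolded set_borel_measurable_def])
  have "sqn (restr U f) \<le> (\<integral>\<^sup>+x. ennreal (norm (indicat_real K x *\<^sub>R (cmod (f x))\<^sup>2)) \<partial>lebesgue)"
    unfolding sqn_def using U by (intro nn_integral_mono) (auto simp: restr_def indicator_def)
  also have "\<dots> < \<infinity>"
    using i unfolding set_integrable_def integrable_iff_bounded by simp
  finally show "sqn (restr U f) < \<infinity>" .
qed

abbreviation fd :: "('a::euclidean_space \<Rightarrow> real) \<Rightarrow> 'a \<Rightarrow> 'a \<Rightarrow> real" where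
  "fd \<eta> i x \<equiv> frechet_derivative \<eta> (at x) i"

lemma kernel_scaleR_L2:
  fixes f :: "'a::euclidean_space \<Rightarrow> complex" and \<phi> :: "'a \<Rightarrow> real"
  assumes "kernel \<phi>" and f: "f \<in> borel_measurable lebesgue" "sqn f < \<infinity>"
  shows "(\<lambda>x. \<phi> x *\<^sub>R f x) \<in> borel_measurable lebesgue" "sqn (\<lambda>x. \<phi> x *\<^sub>R f x) < \<infinity>"
    "bounded {x. \<phi> x *\<^sub>R f x \<noteq> 0}"
proof -
  show "(\<lambda>x. \<phi> x *\<^sub>R f x) \<in> borel_measurable lebesgue"
    using kernel_lebesgue[OF assms(1)] f(1) by (rule borel_measurable_scaleR)
  obtain B where "B \<ge> 0" "\<And>x. norm (\<phi> x) \<le> B" using kernel_bound[OF assms(1)] by blast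
  then have "sqn (\<lambda>x. \<phi> x *\<^sub>R f x) \<le> ennreal (B\<^sup>2) * sqn f"
    using f by (intro sqn_scaleR_le) (auto intro: mult_right_mono)
  also have "\<dots> < \<infinity>" using f(2) by (simp add: ennreal_mult_less_top)
  finally show "sqn (\<lambda>x. \<phi> x *\<^sub>R f x) < \<infinity>" .
  show "bounded {x. \<phi> x *\<^sub>R f x \<noteq> 0}"
    by (rule bounded_subset[of "{x. \<phi> x \<noteq> 0}"]) (use assms(1) in \<open>auto simp: kernel_def\<close>)
qed

lemma kernel_product_rule_L2:
  fixes f h :: "'a::euclidean_space \<Rightarrow> complex" and \<eta> :: "'a \<Rightarrow> real"
  assumes k: "kernel \<eta>" and f: "f \<in> borel_measurable lebesgue" "sqn f < \<infinity>"
    and h: "h \<in> borel_measurable lebesgue" "sqn h < \<infinity>"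
  shows "(\<lambda>x. \<eta> x *\<^sub>R h x + fd \<eta> i x *\<^sub>R f x) \<in> borel_measurable lebesgue"
    "sqn (\<lambda>x. \<eta> x *\<^sub>R h x + fd \<eta> i x *\<^sub>R f x) < \<infinity>"
    "bounded {x. \<eta> x *\<^sub>R h x + fd \<eta> i x *\<^sub>R f x \<noteq> 0}"
proof -
  note 1 = kernel_scaleR_L2[OF k h] and 2 = kernel_scaleR_L2[OF kernel_derivative[OF k, of i] f]
  show "(\<lambda>x. \<eta> x *\<^sub>R h x + fd \<eta> i x *\<^sub>R f x) \<in> borel_measurable lebesgue"
    using 1(1) 2(1) by (rule borel_measurable_add)
  have "sqn (\<lambda>x. \<eta> x *\<^sub>R h x + fd \<eta> i x *\<^sub>R f x)
      \<le> 2 * sqn (\<lambda>x. \<eta> x *\<^sub>R h x) + 2 * sqn (\<lambda>x. fd \<eta> i x *\<^sub>R f x)"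
    by (rule sqn_add[OF 1(1) 2(1)])
  also have "\<dots> < \<infinity>" using 1(2) 2(2) by (simp add: ennreal_mult_less_top)
  finally show "sqn (\<lambda>x. \<eta> x *\<^sub>R h x + fd \<eta> i x *\<^sub>R f x) < \<infinity>" .
  show "bounded {x. \<eta> x *\<^sub>R h x + fd \<eta> i x *\<^sub>R f x \<noteq> 0}"
    by (rule bounded_subset[OF bounded_Un[THEN iffD2, OF conjI[OF 1(3) 2(3)]]]) auto
qed

lemma frechet_derivative_scaleR:
  fixes \<eta> :: "'a::euclidean_space \<Rightarrow> real" and \<phi> :: "'a \<Rightarrow> complex"
  assumes "C_inf \<eta>" "C_inf \<phi>"
  shows "frechet_derivative (\<lambda>x. \<eta> x *\<^sub>R \<phi> x) (at x) i
    = \<eta> x *\<^sub>R frechet_derivative \<phi> (at x) i + fd \<eta> i x *\<^sub>R \<phi> x"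
  using frechet_derivative_at[OF has_derivative_scaleR[OF C_inf_has_derivative[OF assms(1)] C_inf_has_derivative[OF assms(2)]], of x]
  by metis

lemma C_inf_scaleR:
  "C_inf \<eta> \<Longrightarrow> C_inf \<phi> \<Longrightarrow> C_inf (\<lambda>x. \<eta> x *\<^sub>R \<phi> x)"
  for \<phi> :: "'a::euclidean_space \<Rightarrow> complex"
  by (rule C_inf_bilinear[OF bounded_bilinear_scaleR])

lemma test_fun_scaleR:
  assumes "C_inf \<eta>" "test_fun \<Omega> \<phi>" "closure {x. \<eta> x \<noteq> 0} \<subseteq> W"
  shows "test_fun (\<Omega> \<inter> W) (\<lambda>x. \<eta> x *\<^sub>R \<phi> x)"
proof -
  have cl: "closure {x. \<eta> x *\<^sub>R \<phi> x \<noteq> 0} \<subseteq> closure {x. \<eta> x \<noteq> 0}"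
    "closure {x. \<eta> x *\<^sub>R \<phi> x \<noteq> 0} \<subseteq> closure {x. \<phi> x \<noteq> 0}"
    by (auto intro!: closure_mono)
  then have "compact (closure {x. \<eta> x *\<^sub>R \<phi> x \<noteq> 0})"
    using assms(2) bounded_subset[OF compact_imp_bounded cl(2)]
    by (simp add: test_fun_def compact_eq_bounded_closed)
  then show ?thesis
    using cl assms C_inf_scaleR unfolding test_fun_def by blast
qed

lemma kernel_cutoff:
  "C_inf \<eta> \<Longrightarrow> closure {x. \<eta> x \<noteq> 0} \<subseteq> ball x0 s \<Longrightarrow> kernel \<eta>"
  unfolding kernel_def using bounded_subset[OF bounded_ball] closure_subset by blast

text \<open>The weak gradient is tested against \<eta> \<phi>, whose support lies in U because that
  of \<eta> does; \<phi> itself may then be any kernel on the whole space. Mollification requires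
  this freedom, since it tests with reflected translates of j that do not respect U.\<close>

lemma weak_derivative_cutoff:
  fixes g :: "'a::euclidean_space \<Rightarrow> complex" and \<eta> :: "'a \<Rightarrow> real" and \<phi> :: "'a \<Rightarrow> complex"
  assumes wg: "weak_grad \<Omega> g Dg" and U: "U \<subseteq> \<Omega>"
    and g: "restr U g \<in> borel_measurable lebesgue" "sqn (restr U g) < \<infinity>"
    and Dg: "restr U (Dg i) \<in> borel_measurable lebesgue" "sqn (restr U (Dg i)) < \<infinity>"
    and \<eta>: "kernel \<eta>" "closure {x. \<eta> x \<noteq> 0} \<subseteq> U" and \<phi>: "kernel \<phi>" and i: "i \<in> Basis"
  shows "(LINT x|lebesgue. (\<eta> x *\<^sub>R restr U g x) * pd \<phi> i x)
    = - (LINT x|lebesgue. (\<eta> x *\<^sub>R restr U (Dg i) x + fd \<eta> i x *\<^sub>R restr U g x) * \<phi> x)"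
proof -
  have C: "C_inf \<eta>" "C_inf \<phi>" using \<eta> \<phi> by (auto simp: kernel_def)
  have \<eta>0: "\<eta> x = 0" "fd \<eta> i x = 0" if "x \<notin> U" for x
  proof -
    have "x \<notin> closure {x. \<eta> x \<noteq> 0}" using that \<eta>(2) by blast
    then show "\<eta> x = 0" "fd \<eta> i x = 0"
      using closure_subset[of "{x. \<eta> x \<noteq> 0}"] frechet_derivative_off_support[of x \<eta>] by auto
  qed
  have "test_fun UNIV \<phi>"
    using \<phi> by (auto simp: test_fun_def kernel_def compact_closure)
  then have "test_fun \<Omega> (\<lambda>x. \<eta> x *\<^sub>R \<phi> x)"
    using test_fun_scaleR[OF C(1) _ order_trans[OF \<eta>(2) U]] by fastforce
  then have eq: "(LINT x:\<Omega>|lebesgue. g x * pd (\<lambda>x. \<eta> x *\<^sub>R \<phi> x) i x) = - (LINT x:\<Omega>|lebesgue. Dg i x * (\<eta> x *\<^sub>R \<phi> x))"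
    using wg i unfolding weak_grad_def by blast
  have l: "(LINT x:\<Omega>|lebesgue. g x * pd (\<lambda>x. \<eta> x *\<^sub>R \<phi> x) i x)
    = (LINT x|lebesgue. (\<eta> x *\<^sub>R restr U g x) * pd \<phi> i x + (fd \<eta> i x *\<^sub>R restr U g x) * \<phi> x)"
    unfolding set_lebesgue_integral_def
    using U \<eta>0 frechet_derivative_scaleR[OF C]
    by (intro Bochner_Integration.integral_cong[OF refl])
      (auto simp: indicator_def restr_def pd_def algebra_simps)
  have r: "(LINT x:\<Omega>|lebesgue. Dg i x * (\<eta> x *\<^sub>R \<phi> x)) = (LINT x|lebesgue. (\<eta> x *\<^sub>R restr U (Dg i) x) * \<phi> x)"
    unfolding set_lebesgue_integral_def
    using U \<eta>0 by (intro Bochner_Integration.integral_cong[OF refl]) (auto simp: indicator_def restr_def)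
  have int: "integrable lebesgue (\<lambda>x. f x * k x)"
    if f: "f \<in> borel_measurable lebesgue" "sqn f < \<infinity>" "bounded {x. f x \<noteq> 0}" and k: "kernel k" for f k :: "'a \<Rightarrow> complex"
  proof -
    obtain B where B: "B \<ge> 0" "\<And>x. norm (k x) \<le> B" using kernel_bound[OF k] by blast
    show ?thesis
    proof (rule Bochner_Integration.integrable_bound[OF integrable_scaleR_right[OF integrable_zero_off_bounded[OF f], of B]])
      show "(\<lambda>x. f x * k x) \<in> borel_measurable lebesgue"
        using f(1) kernel_lebesgue[OF k] by (rule borel_measurable_times)
      show "AE x in lebesgue. norm (f x * k x) \<le> norm (B *\<^sub>R f x)"
        using B by (intro AE_I2) (simp add: norm_mult mult.commute[of "cmod (f _)"] mult_right_mono)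
    qed
  qed
  note k\<eta>' = kernel_derivative[OF \<eta>(1), of i]
  have i1: "integrable lebesgue (\<lambda>x. (\<eta> x *\<^sub>R restr U g x) * pd \<phi> i x)"
    by (intro int kernel_scaleR_L2 \<eta>(1) g kernel_pd \<phi>)
  have i2: "integrable lebesgue (\<lambda>x. (fd \<eta> i x *\<^sub>R restr U g x) * \<phi> x)"
    by (intro int kernel_scaleR_L2 k\<eta>' g \<phi>)
  have i3: "integrable lebesgue (\<lambda>x. (\<eta> x *\<^sub>R restr U (Dg i) x) * \<phi> x)"
    by (intro int kernel_scaleR_L2 \<eta>(1) Dg \<phi>)
  have "(LINT x|lebesgue. (\<eta> x *\<^sub>R restr U g x) * pd \<phi> i x) + (LINT x|lebesgue. (fd \<eta> i x *\<^sub>R restr U g x) * \<phi> x)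
      = - (LINT x|lebesgue. (\<eta> x *\<^sub>R restr U (Dg i) x) * \<phi> x)"
    using eq l r i1 i2 by simp
  moreover have "(LINT x|lebesgue. (\<eta> x *\<^sub>R restr U (Dg i) x + fd \<eta> i x *\<^sub>R restr U g x) * \<phi> x)
      = (LINT x|lebesgue. (\<eta> x *\<^sub>R restr U (Dg i) x) * \<phi> x) + (LINT x|lebesgue. (fd \<eta> i x *\<^sub>R restr U g x) * \<phi> x)"
    unfolding distrib_right by (rule Bochner_Integration.integral_add[OF i3 i2])
  moreover have "p = - d" if "p + q = - r" "d = r + q" for p q r d :: complex
    using that by algebra
  ultimately show ?thesis by blast
qed

text \<open>The test function is j(x - y) as a function of y; the sign from the reflection cancels
  the sign from the integration by parts.\<close>

lemma pd_conv_weak: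
  fixes u :: "'a::euclidean_space \<Rightarrow> complex" and j :: "'a \<Rightarrow> real"
  assumes u: "integrable lebesgue u" and j: "kernel j"
    and weak: "\<And>\<phi>. kernel \<phi> \<Longrightarrow> (LINT x|lebesgue. u x * pd \<phi> i x) = - (LINT x|lebesgue. Dui x * \<phi> x)"
  shows "pd (conv u j) i x = conv Dui j x"
proof -
  define \<phi> where "\<phi> y = complex_of_real (j (x - y))" for y
  have C: "C_inf j" using j by (simp add: kernel_def)
  have "C_inf (\<lambda>y. complex_of_real (j ((-1) *\<^sub>R y + x)))"
    by (intro C_inf_bounded_linear[OF bounded_linear_of_real] C_inf_affine C)
  moreover have "bounded {y. \<phi> y \<noteq> 0}"
  proof -
    obtain r where "{z. j z \<noteq> 0} \<subseteq> ball 0 r"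
      using j bounded_subset_ballD unfolding kernel_def by metis
    then have "{y. \<phi> y \<noteq> 0} \<subseteq> ball x r"
    proof (intro subsetI)
      fix y assume "y \<in> {y. \<phi> y \<noteq> 0}"
      then have "x - y \<in> {z. j z \<noteq> 0}" by (simp add: \<phi>_def)
      then have "x - y \<in> ball 0 r" using \<open>{z. j z \<noteq> 0} \<subseteq> ball 0 r\<close> by blast
      then show "y \<in> ball x r" by (simp add: dist_norm norm_minus_commute)
    qed
    then show ?thesis using bounded_ball bounded_subset by blast
  qed
  ultimately have k: "kernel \<phi>"
    unfolding kernel_def \<phi>_def[abs_def] by simp
  have "(\<phi> has_derivative (\<lambda>v. complex_of_real (frechet_derivative j (at (x - y)) (- v)))) (at y)" for y
    unfolding \<phi>_def[abs_def]
    by (rule bounded_linear.has_derivative[OF bounded_linear_of_real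
        has_derivative_compose[OF _ C_inf_has_derivative[OF C]]]) (auto intro!: derivative_eq_intros)
  from frechet_derivative_at[OF this, symmetric]
  have "pd \<phi> i y = - complex_of_real (frechet_derivative j (at (x - y)) i)" for y
    using linear_neg[OF has_derivative_linear[OF C_inf_has_derivative[OF C]]] by (simp add: pd_def)
  then have "(LINT y|lebesgue. u y * pd \<phi> i y) = - (LINT y|lebesgue. frechet_derivative j (at (x - y)) i *\<^sub>R u y)"
    by (simp add: scaleR_conv_of_real mult.commute)
  then have "(LINT y|lebesgue. frechet_derivative j (at (x - y)) i *\<^sub>R u y) = (LINT y|lebesgue. Dui y * \<phi> y)"
    using weak[OF k] by simp
  also have "\<dots> = conv Dui j x"
    unfolding conv_def \<phi>_def by (simp add: scaleR_conv_of_real mult.commute)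
  finally show ?thesis
    unfolding pd_def conv_frechet_derivative[OF u j] conv_def .
qed

lemma test_fun_conv:
  fixes u :: "'a::euclidean_space \<Rightarrow> complex"
  assumes u: "integrable lebesgue u" "{x. u x \<noteq> 0} \<subseteq> cball x0 s" and j: "mollifier j e" and e: "s + e < r"
  shows "test_fun (ball x0 r) (conv u j)"
proof -
  have js: "\<And>x. norm x \<ge> e \<Longrightarrow> j x = 0" and k: "kernel j" using j by (auto simp: mollifier_def)
  have "{x. conv u j x \<noteq> 0} \<subseteq> cball x0 (s + e)"
  proof (rule subsetI, rule ccontr)
    fix x assume x: "x \<in> {x. conv u j x \<noteq> 0}" "x \<notin> cball x0 (s + e)"
    have "conv u j x = 0"
    proof (rule conv_eq_0)
      fix y assume "u y \<noteq> 0"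
      then have "dist x0 y \<le> s" using u(2) by auto
      then have "norm (x - y) \<ge> e"
        using x(2) dist_triangle[of x0 x y] by (simp add: dist_norm norm_minus_commute)
      then show "j (x - y) = 0" by (rule js)
    qed
    then show False using x by simp
  qed
  then have cl: "closure {x. conv u j x \<noteq> 0} \<subseteq> cball x0 (s + e)"
    by (rule closure_minimal[OF _ closed_cball])
  moreover have "cball x0 (s + e) \<subseteq> ball x0 r" using e by auto
  moreover have "compact (closure {x. conv u j x \<noteq> 0})"
    using bounded_subset[OF bounded_cball cl] by (simp add: compact_eq_bounded_closed)
  ultimately show ?thesis
    unfolding test_fun_def using C_inf_conv[OF u(1) k] by blast
qed

text \<open>If the ball lies inside the domain, mollifications of \<eta> g are the approximating
  test functions, and their gradients are the mollified weak gradients, which converge as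
  well.\<close>

lemma H10c_cutoff_interior:
  fixes g :: "'a::euclidean_space \<Rightarrow> complex" and \<eta> :: "'a \<Rightarrow> real"
  assumes wg: "weak_grad \<Omega> g Dg" and U: "ball x0 r \<subseteq> \<Omega>"
    and g: "restr (ball x0 r) g \<in> borel_measurable lebesgue" "sqn (restr (ball x0 r) g) < \<infinity>"
    and Dg: "\<And>i. i \<in> Basis \<Longrightarrow> restr (ball x0 r) (Dg i) \<in> borel_measurable lebesgue"
      "\<And>i. i \<in> Basis \<Longrightarrow> sqn (restr (ball x0 r) (Dg i)) < \<infinity>"
    and \<eta>: "C_inf \<eta>" "closure {x. \<eta> x \<noteq> 0} \<subseteq> ball x0 s" and s: "s < r"
  shows "H10c (ball x0 r) (\<lambda>x. \<eta> x *\<^sub>R restr (ball x0 r) g x)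
    (\<lambda>i x. \<eta> x *\<^sub>R restr (ball x0 r) (Dg i) x + fd \<eta> i x *\<^sub>R restr (ball x0 r) g x)"
    (is "H10c ?U ?u ?Du")
proof -
  have k: "kernel \<eta>" using \<eta> kernel_cutoff by blast
  note kd = kernel_derivative[OF k]
  have sub: "closure {x. \<eta> x \<noteq> 0} \<subseteq> ?U" using \<eta>(2) s by (meson less_imp_le order_trans subset_ball)
  note u = kernel_scaleR_L2[OF k g]
  note ui = integrable_zero_off_bounded[OF u]
  have Du: "?Du i \<in> borel_measurable lebesgue" "sqn (?Du i) < \<infinity>" "bounded {x. ?Du i x \<noteq> 0}"
    if "i \<in> Basis" for i
    by (rule kernel_product_rule_L2[OF k g Dg[OF that]])+
  have e: "1 / real (Suc n) > 0" for n by simp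
  \<comment> \<open>Shifting the index by N keeps the mollifying radius below r - s, so that all
    supports stay in the ball of radius r.\<close>
  obtain N where N: "1 / real (Suc N) < r - s"
    using s nat_approx_posE[of "r - s"] by (metis diff_gt_0_iff_gt)
  have N': "1 / real (Suc (n + N)) < r - s" for n
  proof -
    have "1 / real (Suc (n + N)) \<le> 1 / real (Suc N)" by (simp add: frac_le)
    then show ?thesis using N by linarith
  qed
  define \<psi> where "\<psi> n = conv ?u (moll (1 / real (Suc (n + N))))" for n
  note mm = mollifier_moll[OF e, where 'a = 'a]
  have supp: "{x. ?u x \<noteq> 0} \<subseteq> cball x0 s"
    using \<eta>(2) closure_subset[of "{x. \<eta> x \<noteq> 0}"] ball_subset_cball by force
  have "test_fun ?U (\<psi> n)" for n
    unfolding \<psi>_def by (rule test_fun_conv[OF ui supp mm]) (use N'[of n] in linarith)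
  moreover have "(\<lambda>n. sqn (\<lambda>x. \<psi> n x - ?u x)) \<longlonglongrightarrow> 0"
    unfolding \<psi>_def using LIMSEQ_ignore_initial_segment[OF conv_moll_tendsto[OF u], of N] .
  moreover have "(\<lambda>n. sqn (\<lambda>x. pd (\<psi> n) i x - ?Du i x)) \<longlonglongrightarrow> 0" if i: "i \<in> Basis" for i
  proof -
    have "pd (\<psi> n) i x = conv (?Du i) (moll (1 / real (Suc (n + N)))) x" for n x
      unfolding \<psi>_def
    proof (rule pd_conv_weak[OF ui])
      show "kernel (moll (1 / real (Suc (n + N))) :: 'a \<Rightarrow> real)"
        using mm[of "n + N"] unfolding mollifier_def by blast
    qed (rule weak_derivative_cutoff[OF wg U g Dg[OF i] k sub _ i])
    then show ?thesis
      using LIMSEQ_ignore_initial_segment[OF conv_moll_tendsto[OF Du[OF i]], of N] by simp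
  qed
  ultimately show ?thesis
    unfolding H10c_def using u Du by (auto simp: restr_def)
qed

text \<open>Near the boundary, mollification would spread the support out of the domain. Instead the
  test functions that approximate g in \<open>H1_0\<close> are multiplied by \<eta>, which confines
  them to U and, by the product rule, preserves the convergence of the gradients.\<close>

lemma H10c_cutoff_global:
  fixes g :: "'a::euclidean_space \<Rightarrow> complex" and \<eta> :: "'a \<Rightarrow> real"
  assumes H: "H1_0 \<Omega> g Dg" and \<Omega>: "open \<Omega>" and U: "U = \<Omega> \<inter> ball x0 r"
    and \<eta>: "C_inf \<eta>" "closure {x. \<eta> x \<noteq> 0} \<subseteq> ball x0 r"
  shows "H10c U (\<lambda>x. \<eta> x *\<^sub>R restr U g x)
    (\<lambda>i x. \<eta> x *\<^sub>R restr U (Dg i) x + fd \<eta> i x *\<^sub>R restr U g x)"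
    (is "H10c U ?u ?Du")
proof -
  have k: "kernel \<eta>" using \<eta> kernel_cutoff by blast
  note kd = kernel_derivative[OF k]
  have sU: "U \<in> sets lebesgue" "U \<subseteq> \<Omega>" using \<Omega> U by auto
  have g: "restr U g \<in> borel_measurable lebesgue" "sqn (restr U g) < \<infinity>"
    using H sU restr_L2[of \<Omega> g \<Omega> U] by (auto simp: H1_0_def L2_def)
  have Dg: "restr U (Dg i) \<in> borel_measurable lebesgue" "sqn (restr U (Dg i)) < \<infinity>" if "i \<in> Basis" for i
    using H sU restr_L2[of \<Omega> "Dg i" \<Omega> U] that by (auto simp: H1_0_def L2_def)
  obtain \<phi> where \<phi>: "\<And>n. test_fun \<Omega> (\<phi> n)"
    and lim: "(\<lambda>k. set_nn_integral lebesgue \<Omega> (\<lambda>x. ennreal ((cmod (\<phi> k x - g x))\<^sup>2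
            + (\<Sum>i\<in>Basis. (cmod (pd (\<phi> k) i x - Dg i x))\<^sup>2)))) \<longlonglongrightarrow> 0"
    using H unfolding H1_0_def by blast
  let ?a = "\<lambda>k x. (cmod (\<phi> k x - g x))\<^sup>2 + (\<Sum>i\<in>Basis. (cmod (pd (\<phi> k) i x - Dg i x))\<^sup>2)"
  let ?A = "\<lambda>k. set_nn_integral lebesgue \<Omega> (\<lambda>x. ennreal (?a k x))"
  obtain B where B: "B \<ge> 0" "\<And>x. norm (\<eta> x) \<le> B" using kernel_bound[OF k] by blast
  note u = kernel_scaleR_L2[OF k g]
  have Du: "?Du i \<in> borel_measurable lebesgue" "sqn (?Du i) < \<infinity>" "bounded {x. ?Du i x \<noteq> 0}"
    if "i \<in> Basis" for i
    by (rule kernel_product_rule_L2[OF k g Dg[OF that]])+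
  define \<psi> where "\<psi> n x = \<eta> x *\<^sub>R \<phi> n x" for n x
  have C\<phi>: "C_inf (\<phi> n)" for n using \<phi> by (simp add: test_fun_def)
  have tf: "test_fun U (\<psi> n)" for n
    unfolding \<psi>_def[abs_def] U by (rule test_fun_scaleR[OF \<eta>(1) \<phi> \<eta>(2)])
  \<comment> \<open>Both required limits follow from this: the errors are dominated on U by a
    multiple of the integrand of the H1 distance.\<close>
  have bound: "(\<lambda>n. sqn (w n)) \<longlonglongrightarrow> 0"
    if w: "\<And>n x. x \<in> U \<Longrightarrow> (norm (w n x))\<^sup>2 \<le> c * ?a n x" "\<And>n x. x \<notin> U \<Longrightarrow> w n x = 0" and c: "c \<ge> 0"
    for w :: "nat \<Rightarrow> 'a \<Rightarrow> complex" and c :: real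
  proof (rule tendsto_sandwich[OF _ _ tendsto_const])
    have "(\<lambda>n. ennreal c * ?A n) \<longlonglongrightarrow> ennreal c * 0"
      by (intro ennreal_tendsto_cmult lim) simp
    then show "(\<lambda>n. ennreal c * ?A n) \<longlonglongrightarrow> 0" by simp
    have "sqn (w n) \<le> ennreal c * ?A n" for n
    proof -
      have "sqn (w n) \<le> (\<integral>\<^sup>+x. ennreal c * (ennreal (?a n x) * indicator \<Omega> x) \<partial>lebesgue)"
        unfolding sqn_def
      proof (rule nn_integral_mono)
        fix x
        show "ennreal ((norm (w n x))\<^sup>2) \<le> ennreal c * (ennreal (?a n x) * indicator \<Omega> x)"
        proof (cases "x \<in> U")
          case True
          then have "ennreal ((norm (w n x))\<^sup>2) \<le> ennreal (c * ?a n x)" by (intro ennreal_leI w)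
          also have "\<dots> = ennreal c * ennreal (?a n x)" using c by (rule ennreal_mult')
          finally show ?thesis using True sU by auto
        qed (simp add: w)
      qed
      also have "\<dots> = ennreal c * ?A n"
      proof (rule nn_integral_cmult)
        have m1: "(\<lambda>x. indicat_real \<Omega> x *\<^sub>R f x) \<in> borel_measurable lebesgue" if "L2 \<Omega> f" for f :: "'a \<Rightarrow> complex"
          using that by (simp add: L2_def set_borel_measurable_def)
        have [measurable]: "\<Omega> \<in> sets lebesgue" using \<Omega> by simp
        have [measurable]: "\<phi> n \<in> borel_measurable lebesgue" "\<And>i. pd (\<phi> n) i \<in> borel_measurable lebesgue"
          using kernel_lebesgue[OF test_fun_kernel[OF \<phi>]] kernel_lebesgue[OF kernel_pd[OF test_fun_kernel[OF \<phi>]]] by auto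
        have [measurable]: "(\<lambda>x. indicat_real \<Omega> x *\<^sub>R g x) \<in> borel_measurable lebesgue"
          using H by (intro m1) (simp add: H1_0_def)
        \<comment> \<open>Measurability of g and of the components of \<open>Dg\<close> is known
          after multiplication by the indicator of \<Omega>; the factor
          \<open>indicator \<Omega> x\<close> outside makes the modified integrand equal to the
          original one.\<close>
        have "(\<lambda>x. ennreal (((cmod (\<phi> n x - indicat_real \<Omega> x *\<^sub>R g x))\<^sup>2 + (\<Sum>i\<in>Basis. (cmod (pd (\<phi> n) i x - indicat_real \<Omega> x *\<^sub>R Dg i x))\<^sup>2))) * indicator \<Omega> x) \<in> borel_measurable lebesgue"
        proof -
          have [measurable]: "(\<lambda>x. \<Sum>i\<in>Basis. (cmod (pd (\<phi> n) i x - indicat_real \<Omega> x *\<^sub>R Dg i x))\<^sup>2) \<in> borel_measurable lebesgue"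
          proof (rule borel_measurable_sum)
            fix i :: 'a assume "i \<in> Basis"
            then have [measurable]: "(\<lambda>x. indicat_real \<Omega> x *\<^sub>R Dg i x) \<in> borel_measurable lebesgue"
              using H by (intro m1) (simp add: H1_0_def)
            show "(\<lambda>x. (cmod (pd (\<phi> n) i x - indicat_real \<Omega> x *\<^sub>R Dg i x))\<^sup>2) \<in> borel_measurable lebesgue"
              by measurable
          qed
          show ?thesis by measurable
        qed
        also have "(\<lambda>x. ennreal (((cmod (\<phi> n x - indicat_real \<Omega> x *\<^sub>R g x))\<^sup>2 + (\<Sum>i\<in>Basis. (cmod (pd (\<phi> n) i x - indicat_real \<Omega> x *\<^sub>R Dg i x))\<^sup>2))) * indicator \<Omega> x)
           = (\<lambda>x. ennreal (?a n x) * indicator \<Omega> x)"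
          by (auto simp: indicator_def)
        finally show "(\<lambda>x. ennreal (?a n x) * indicator \<Omega> x) \<in> borel_measurable lebesgue" .
      qed
      finally show ?thesis .
    qed
    then show "\<forall>\<^sub>F n in sequentially. sqn (w n) \<le> ennreal c * ?A n" by simp
  qed simp
  have "(\<lambda>n. sqn (\<lambda>x. \<psi> n x - ?u x)) \<longlonglongrightarrow> 0"
  proof (rule bound[where c = "B\<^sup>2"])
    fix n x
    show "x \<notin> U \<Longrightarrow> \<psi> n x - ?u x = 0"
      using test_fun_support(1)[OF tf] by (simp add: restr_def)
    assume x: "x \<in> U"
    then have "norm (\<psi> n x - ?u x) \<le> B * cmod (\<phi> n x - g x)"
      using B by (simp add: \<psi>_def restr_def flip: scaleR_diff_right) (simp add: mult_right_mono)
    then have "(norm (\<psi> n x - ?u x))\<^sup>2 \<le> B\<^sup>2 * (cmod (\<phi> n x - g x))\<^sup>2"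
      using power_mono[of _ _ 2] by (fastforce simp: power_mult_distrib)
    also have "\<dots> \<le> B\<^sup>2 * ?a n x"
      by (intro mult_left_mono) (auto simp: sum_nonneg)
    finally show "(norm (\<psi> n x - ?u x))\<^sup>2 \<le> B\<^sup>2 * ?a n x" .
  qed simp
  moreover have "(\<lambda>n. sqn (\<lambda>x. pd (\<psi> n) i x - ?Du i x)) \<longlonglongrightarrow> 0" if i: "i \<in> Basis" for i
  proof -
    obtain B' where B': "B' \<ge> 0" "\<And>x. norm (fd \<eta> i x) \<le> B'" using kernel_bound[OF kd[of i]] by blast
    show ?thesis
    proof (rule bound[where c = "2 * B\<^sup>2 + 2 * B'\<^sup>2"])
      fix n x
      show "x \<notin> U \<Longrightarrow> pd (\<psi> n) i x - ?Du i x = 0"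
        using test_fun_support(2)[OF tf] by (simp add: restr_def)
      assume x: "x \<in> U"
      have le: "(cmod (\<phi> n x - g x))\<^sup>2 \<le> ?a n x" "(cmod (pd (\<phi> n) i x - Dg i x))\<^sup>2 \<le> ?a n x"
        using i by (auto simp: sum_nonneg intro!: add_increasing member_le_sum[where f = "\<lambda>i. (cmod (pd (\<phi> n) i x - Dg i x))\<^sup>2"])
      have "pd (\<psi> n) i x - ?Du i x = \<eta> x *\<^sub>R (pd (\<phi> n) i x - Dg i x) + fd \<eta> i x *\<^sub>R (\<phi> n x - g x)"
        using x frechet_derivative_scaleR[OF \<eta>(1) C\<phi>, of n x i]
        by (simp add: \<psi>_def[abs_def] pd_def restr_def algebra_simps)
      then have "(norm (pd (\<psi> n) i x - ?Du i x))\<^sup>2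
          \<le> 2 * (norm (\<eta> x *\<^sub>R (pd (\<phi> n) i x - Dg i x)))\<^sup>2 + 2 * (norm (fd \<eta> i x *\<^sub>R (\<phi> n x - g x)))\<^sup>2"
        using power2_norm_add_le by metis
      also have "(norm (\<eta> x *\<^sub>R (pd (\<phi> n) i x - Dg i x)))\<^sup>2 \<le> B\<^sup>2 * ?a n x"
        using B le(2) power_mono[OF B(2)[of x], of 2]
        by (simp add: power_mult_distrib) (intro mult_mono, auto)
      also have "(norm (fd \<eta> i x *\<^sub>R (\<phi> n x - g x)))\<^sup>2 \<le> B'\<^sup>2 * ?a n x"
        using B' le(1) power_mono[OF B'(2)[of x], of 2]
        by (simp add: power_mult_distrib) (intro mult_mono, auto)
      finally show "(norm (pd (\<psi> n) i x - ?Du i x))\<^sup>2 \<le> (2 * B\<^sup>2 + 2 * B'\<^sup>2) * ?a n x"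
        by (simp add: distrib_right)
    qed simp
  qed
  ultimately show ?thesis
    unfolding H10c_def using u Du tf by (auto simp: restr_def)
qed

section \<open>The energy estimate\<close>

definition L2z :: "'a::euclidean_space set \<Rightarrow> ('a \<Rightarrow> complex) \<Rightarrow> bool" where
  "L2z U f \<longleftrightarrow> f \<in> borel_measurable lebesgue \<and> sqn f < \<infinity> \<and> (\<forall>x. x \<notin> U \<longrightarrow> f x = 0)"

lemma L2z_add:
  assumes "L2z U f" "L2z U g"
  shows "L2z U (\<lambda>x. f x + g x)"
proof -
  have "sqn (\<lambda>x. f x + g x) \<le> 2 * sqn f + 2 * sqn g"
    using assms by (intro sqn_add) (auto simp: L2z_def)
  also have "\<dots> < \<infinity>" using assms by (simp add: L2z_def ennreal_mult_less_top)
  finally show ?thesis using assms by (auto simp: L2z_def)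
qed

lemma L2z_mult:
  assumes f: "L2z U f" and k: "k \<in> borel_measurable lebesgue" "\<And>x. x \<in> U \<Longrightarrow> cmod (k x) \<le> B" "B \<ge> 0"
  shows "L2z U (\<lambda>x. k x * f x)"
proof -
  have "sqn (\<lambda>x. k x * f x) \<le> ennreal (B\<^sup>2) * sqn f"
  proof (rule sqn_scaleR_le)
    fix x show "norm (k x * f x) \<le> B * norm (f x)"
      using k(2)[of x] f by (cases "x \<in> U") (auto simp: L2z_def norm_mult mult_right_mono)
  qed (use f k in \<open>auto simp: L2z_def\<close>)
  also have "\<dots> < \<infinity>" using f by (simp add: L2z_def ennreal_mult_less_top)
  finally show ?thesis using f k(1) by (auto simp: L2z_def)
qed

text \<open>The modulus |z|^m of the nonlinearity is at most 1 + |z|, and the constant 1 is square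
  integrable over the bounded set U.\<close>

lemma L2z_nl:
  assumes g: "L2z U g" and U: "open U" "bounded U" and m: "0 < m" "m < 1"
  shows "L2z U (\<lambda>x. nl m (g x))"
proof -
  have [measurable]: "g \<in> borel_measurable lebesgue" using g by (simp add: L2z_def)
  have [measurable]: "U \<in> sets lebesgue" using U(1) by simp
  have [measurable]: "nl m \<in> borel_measurable borel" unfolding nl_def[abs_def] by measurable
  have "(\<lambda>x. nl m (g x)) \<in> borel_measurable lebesgue" by measurable
  moreover have "sqn (\<lambda>x. nl m (g x)) < \<infinity>"
  proof -
    have "cmod (nl m z) \<le> 1 + cmod z" for z
    proof (cases "z = 0")
      case False
      then have "cmod (nl m z) = cmod z powr (m - 1) * cmod z powr 1"
        by (simp add: nl_def norm_mult)
      also have "\<dots> = cmod z powr m" using False by (simp only: powr_add[symmetric]) simp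
      also have "\<dots> \<le> (1 + cmod z) powr m" using m by (intro powr_mono2) auto
      also have "\<dots> \<le> (1 + cmod z) powr 1" using m by (intro powr_mono) auto
      finally show ?thesis by simp
    qed (simp add: nl_def)
    then have "norm (nl m (g x)) \<le> 1 * norm (indicat_real U x + norm (g x))" for x
      using g by (cases "x \<in> U") (auto simp: L2z_def nl_def)
    then have "sqn (\<lambda>x. nl m (g x)) \<le> ennreal (1\<^sup>2) * sqn (\<lambda>x. indicat_real U x + norm (g x))"
    proof (rule sqn_scaleR_le)
      show "(\<lambda>x. indicat_real U x + norm (g x)) \<in> borel_measurable lebesgue" by measurable
    qed simp
    also have "sqn (\<lambda>x. indicat_real U x + norm (g x)) \<le> 2 * sqn (indicat_real U) + 2 * sqn (\<lambda>x. norm (g x))"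
      by (rule sqn_add) measurable
    also have "sqn (indicat_real U) = emeasure lebesgue U"
      using U by (intro sqn_indicator) auto
    also have "sqn (\<lambda>x. norm (g x)) = sqn g" by (simp add: sqn_def)
    finally have "sqn (\<lambda>x. nl m (g x)) \<le> ennreal (1\<^sup>2) * (2 * emeasure lebesgue U + 2 * sqn g)"
      by (simp add: mult_left_mono)
    also have "\<dots> < \<infinity>"
      using g emeasure_bounded_finite[OF U(2)] U(1) by (simp add: L2z_def ennreal_mult_less_top)
    finally show ?thesis .
  qed
  ultimately show ?thesis using g by (auto simp: L2z_def nl_def)
qed

text \<open>The origin of |g|^(1+m) in the energy: it is the nonlinearity tested against g
  itself.\<close>

lemma nl_mult_cnj:
  assumes "0 < m" "m < 1"
  shows "nl m z * cnj z = complex_of_real (cmod z powr (1 + m))"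
proof (cases "z = 0")
  case False
  then have "nl m z * cnj z = complex_of_real (cmod z powr (m - 1) * (cmod z) powr 2)"
    by (simp add: nl_def mult.assoc complex_norm_square[symmetric])
  also have "cmod z powr (m - 1) * (cmod z) powr 2 = cmod z powr (1 + m)"
    by (simp only: powr_add[symmetric]) (simp add: add.commute)
  finally show ?thesis .
qed (simp add: nl_def)

section \<open>Pairings in L2 and admissible test functions\<close>

lemma L2_times_integrable:
  fixes f h :: "'a::euclidean_space \<Rightarrow> complex"
  assumes [measurable]: "f \<in> borel_measurable lebesgue" "h \<in> borel_measurable lebesgue"
    and fin: "sqn f < \<infinity>" "sqn h < \<infinity>"
  shows "integrable lebesgue (\<lambda>x. f x * cnj (h x))"
proof -
  have [measurable]: "cnj \<in> borel_measurable borel"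
    by (intro borel_measurable_continuous_onI continuous_intros)
  show ?thesis
  proof (rule Bochner_Integration.integrable_bound[of _ "\<lambda>x. (norm (f x))\<^sup>2 + (norm (h x))\<^sup>2"])
    show "integrable lebesgue (\<lambda>x. (norm (f x))\<^sup>2 + (norm (h x))\<^sup>2)"
      by (intro Bochner_Integration.integrable_add sqn_finite_integrable assms)
    show "AE x in lebesgue. norm (f x * cnj (h x)) \<le> norm ((norm (f x))\<^sup>2 + (norm (h x))\<^sup>2)"
    proof (rule AE_I2)
      fix x
      have "0 \<le> norm (f x) * norm (h x)" by simp
      then have "norm (f x) * norm (h x) \<le> (norm (f x))\<^sup>2 + (norm (h x))\<^sup>2"
        using zero_le_power2[of "norm (f x) - norm (h x)"] unfolding power2_diff by linarith
      then show "norm (f x * cnj (h x)) \<le> norm ((norm (f x))\<^sup>2 + (norm (h x))\<^sup>2)"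
        by (simp add: norm_mult)
    qed
  qed measurable
qed

lemma L2_pairing_bound:
  fixes f h :: "'a::euclidean_space \<Rightarrow> complex"
  assumes [measurable]: "f \<in> borel_measurable lebesgue" "h \<in> borel_measurable lebesgue"
    and fin: "sqn f < \<infinity>" "sqn h < \<infinity>"
  shows "ennreal ((norm (LINT x|lebesgue. f x * cnj (h x)))\<^sup>2) \<le> sqn f * sqn h"
proof -
  have "ennreal (norm (LINT x|lebesgue. f x * cnj (h x))) \<le> (\<integral>\<^sup>+x. ennreal (norm (f x * cnj (h x))) \<partial>lebesgue)"
    by (intro integral_norm_bound_ennreal L2_times_integrable assms)
  also have "\<dots> = (\<integral>\<^sup>+x. ennreal (norm (f x)) * ennreal (norm (h x)) \<partial>lebesgue)"
    by (simp add: norm_mult ennreal_mult)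
  finally have "(ennreal (norm (LINT x|lebesgue. f x * cnj (h x))))\<^sup>2
      \<le> (\<integral>\<^sup>+x. ennreal (norm (f x)) * ennreal (norm (h x)) \<partial>lebesgue)\<^sup>2"
    by (rule power_mono) simp
  also have "\<dots> \<le> (\<integral>\<^sup>+x. (ennreal (norm (f x)))\<^sup>2 \<partial>lebesgue) * (\<integral>\<^sup>+x. (ennreal (norm (h x)))\<^sup>2 \<partial>lebesgue)"
    by (rule Cauchy_Schwarz_nn_integral) measurable
  finally show ?thesis by (simp add: sqn_def ennreal_power)
qed

lemma L2_pairing_tendsto:
  fixes f h :: "'a::euclidean_space \<Rightarrow> complex"
  assumes f: "f \<in> borel_measurable lebesgue" "sqn f < \<infinity>" and h: "h \<in> borel_measurable lebesgue" "sqn h < \<infinity>"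
    and w: "\<And>k. w k \<in> borel_measurable lebesgue" "\<And>k. sqn (w k) < \<infinity>"
    and lim: "(\<lambda>k. sqn (\<lambda>x. w k x - h x)) \<longlonglongrightarrow> 0"
  shows "(\<lambda>k. LINT x|lebesgue. f x * cnj (w k x)) \<longlonglongrightarrow> (LINT x|lebesgue. f x * cnj (h x))"
proof -
  let ?d = "\<lambda>k. norm ((LINT x|lebesgue. f x * cnj (w k x)) - (LINT x|lebesgue. f x * cnj (h x)))"
  have b: "ennreal ((?d k)\<^sup>2) \<le> sqn f * sqn (\<lambda>x. w k x - h x)" for k
  proof -
    have m: "(\<lambda>x. w k x - h x) \<in> borel_measurable lebesgue" using w h by (intro borel_measurable_diff)
    have "sqn (\<lambda>x. w k x - h x) = sqn (\<lambda>x. w k x + (- h x))" by simp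
    also have "\<dots> \<le> 2 * sqn (w k) + 2 * sqn (\<lambda>x. - h x)"
      using w h by (intro sqn_add) auto
    also have "\<dots> < \<infinity>" using w(2) h(2) by (simp add: ennreal_mult_less_top sqn_def)
    finally have fin: "sqn (\<lambda>x. w k x - h x) < \<infinity>" .
    have "(LINT x|lebesgue. f x * cnj (w k x)) - (LINT x|lebesgue. f x * cnj (h x)) = (LINT x|lebesgue. f x * cnj (w k x - h x))"
      using L2_times_integrable[OF f(1) w(1) f(2) w(2)] L2_times_integrable[OF f(1) h(1) f(2) h(2)]
      by (simp add: right_diff_distrib)
    then show ?thesis using L2_pairing_bound[OF f(1) m f(2) fin] by simp
  qed
  have "(\<lambda>k. sqn f * sqn (\<lambda>x. w k x - h x)) \<longlonglongrightarrow> sqn f * 0"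
    using f(2) by (intro ennreal_tendsto_cmult lim) auto
  then have "(\<lambda>k. sqn f * sqn (\<lambda>x. w k x - h x)) \<longlonglongrightarrow> 0" by simp
  then have "(\<lambda>k. ennreal ((?d k)\<^sup>2)) \<longlonglongrightarrow> 0"
    by (rule tendsto_sandwich[OF _ _ tendsto_const, rotated 2]) (auto simp: b)
  then have "(\<lambda>k. (?d k)\<^sup>2) \<longlonglongrightarrow> 0"
    using tendsto_ennreal_iff[of "\<lambda>k. (?d k)\<^sup>2" sequentially 0] by simp
  from tendsto_real_sqrt[OF this] show ?thesis
    by (simp add: tendsto_norm_zero_iff LIM_zero_iff)
qed

lemma kernel_sqn_finite:
  fixes \<psi> :: "'a::euclidean_space \<Rightarrow> complex"
  assumes "kernel \<psi>"
  shows "sqn \<psi> < \<infinity>"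
proof -
  obtain r where "{x. \<psi> x \<noteq> 0} \<subseteq> cball 0 r"
    using assms bounded_subset_ballD[of _ 0] ball_subset_cball unfolding kernel_def by (metis subset_trans)
  then show ?thesis
    using assms by (intro sqn_continuous_finite) (auto simp: kernel_def C_inf_continuous_on)
qed

text \<open>Testing with both psi and i psi removes the real part from the weak formulation.\<close>

definition weak_eq :: "'a::euclidean_space set \<Rightarrow> ('a \<Rightarrow> 'a \<Rightarrow> complex) \<Rightarrow> ('a \<Rightarrow> complex) \<Rightarrow> ('a \<Rightarrow> complex) \<Rightarrow> bool" where
  "weak_eq U Dg F G \<longleftrightarrow> (\<forall>\<psi>. test_fun U \<psi> \<longrightarrow>
     (\<Sum>i\<in>Basis. LINT x|lebesgue. Dg i x * cnj (pd \<psi> i x)) + (LINT x|lebesgue. F x * cnj (\<psi> x))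
      = (LINT x|lebesgue. G x * cnj (\<psi> x)))"

text \<open>All data being square integrable, both sides are continuous in the test function for the
  H1 distance, so the equation passes to limits of test functions. A squared cutoff times g becomes
  admissible in this way.\<close>

lemma weak_eq_H10c:
  fixes F G v :: "'a::euclidean_space \<Rightarrow> complex"
  assumes w: "weak_eq U Dg F G" and Dg: "\<And>i. i \<in> Basis \<Longrightarrow> L2z U (Dg i)" and F: "L2z U F" and G: "L2z U G"
    and v: "H10c U v Dv"
  shows "(\<Sum>i\<in>Basis. LINT x|lebesgue. Dg i x * cnj (Dv i x)) + (LINT x|lebesgue. F x * cnj (v x))
      = (LINT x|lebesgue. G x * cnj (v x))"
proof -
  obtain \<psi> where \<psi>: "\<And>k. test_fun U (\<psi> k)" "(\<lambda>k. sqn (\<lambda>x. \<psi> k x - v x)) \<longlonglongrightarrow> 0"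
    "\<And>i. i \<in> Basis \<Longrightarrow> (\<lambda>k. sqn (\<lambda>x. pd (\<psi> k) i x - Dv i x)) \<longlonglongrightarrow> 0"
    using v unfolding H10c_def by blast
  have k: "kernel (\<psi> k)" for k using test_fun_kernel[OF \<psi>(1)] .
  have v1: "v \<in> borel_measurable lebesgue" "sqn v < \<infinity>"
    and Dv: "\<And>i. i \<in> Basis \<Longrightarrow> Dv i \<in> borel_measurable lebesgue" "\<And>i. i \<in> Basis \<Longrightarrow> sqn (Dv i) < \<infinity>"
    using v by (auto simp: H10c_def)
  have 1: "(\<lambda>k. LINT x|lebesgue. f x * cnj (\<psi> k x)) \<longlonglongrightarrow> (LINT x|lebesgue. f x * cnj (v x))" if "L2z U f" for f
    using that
    by (intro L2_pairing_tendsto[OF _ _ v1 kernel_lebesgue[OF k] kernel_sqn_finite[OF k] \<psi>(2)]) (auto simp: L2z_def)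
  have 2: "(\<lambda>n. LINT x|lebesgue. Dg i x * cnj (pd (\<psi> n) i x)) \<longlonglongrightarrow> (LINT x|lebesgue. Dg i x * cnj (Dv i x))" if i: "i \<in> Basis" for i
    using Dg[OF i]
    by (intro L2_pairing_tendsto[OF _ _ Dv[OF i] kernel_lebesgue[OF kernel_pd[OF k]] kernel_sqn_finite[OF kernel_pd[OF k]] \<psi>(3)[OF i]])
      (auto simp: L2z_def)
  have "(\<lambda>n. (\<Sum>i\<in>Basis. LINT x|lebesgue. Dg i x * cnj (pd (\<psi> n) i x)) + (LINT x|lebesgue. F x * cnj (\<psi> n x)))
      \<longlonglongrightarrow> (\<Sum>i\<in>Basis. LINT x|lebesgue. Dg i x * cnj (Dv i x)) + (LINT x|lebesgue. F x * cnj (v x))"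
    by (intro tendsto_add tendsto_sum 1 2 F)
  also have "(\<lambda>n. (\<Sum>i\<in>Basis. LINT x|lebesgue. Dg i x * cnj (pd (\<psi> n) i x)) + (LINT x|lebesgue. F x * cnj (\<psi> n x)))
      = (\<lambda>n. LINT x|lebesgue. G x * cnj (\<psi> n x))"
    using w \<psi>(1) unfolding weak_eq_def by blast
  finally show ?thesis using 1[OF G] LIMSEQ_unique by blast
qed

text \<open>Here P, Q, S, T stand for the weighted integrals of the squared gradient, of |g| to the power 1 + m,
  of the square of |g| and of the square of |x| |g|.\<close>

definition coercive :: "real \<Rightarrow> complex \<Rightarrow> complex \<Rightarrow> complex \<Rightarrow> real \<Rightarrow> bool" where
  "coercive R a b c K \<longleftrightarrow> (\<forall>P Q S T. P \<ge> 0 \<longrightarrow> Q \<ge> 0 \<longrightarrow> S \<ge> 0 \<longrightarrow> T \<ge> 0 \<longrightarrow> T \<le> R\<^sup>2 * S \<longrightarrow>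
    P + Q + S \<le> K * cmod (complex_of_real P + (a * complex_of_real Q + b * complex_of_real S + c * complex_of_real T)))"

text \<open>Let W be the complex number inside \<open>cmod\<close>. For a large l, Re W - l Im W
  dominates a positive multiple of P + Q + S, and it is at most (1 + l) |W|. As all imaginary parts
  are nonpositive, increasing l never lowers a coefficient.\<close>

lemma coercivity:
  assumes "Im a \<le> 0" "Im b < 0" "Im c \<le> 0" "Re a \<le> 0 \<longrightarrow> Im a < 0"
  obtains K where "K \<ge> 1" "coercive R a b c K"
proof -
  \<comment> \<open>The coefficient of Q. If \<open>Re a > 0\<close>, it is positive from the start;
    otherwise \<open>Im a < 0\<close>, and a large multiple makes it positive.\<close>
  have "\<exists>l1\<ge>0. \<exists>\<alpha>>0. \<forall>t\<ge>l1. Re a - t * Im a \<ge> \<alpha>"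
  proof (cases "Re a \<le> 0")
    case True
    then have ia: "Im a < 0" using assms by blast
    have "Re a - t * Im a \<ge> 1" if "t \<ge> (1 - Re a) / (- Im a)" for t
      using that ia by (simp add: field_simps)
    moreover have "(1 - Re a) / (- Im a) \<ge> 0" using True ia by (intro divide_nonneg_pos) auto
    ultimately show ?thesis by (meson zero_less_one)
  next
    case False
    have "Re a - t * Im a \<ge> Re a" if "t \<ge> 0" for t
      using that assms(1) by (simp add: mult_nonneg_nonpos)
    then show ?thesis using False by (intro exI[of _ 0]) (auto intro!: exI[of _ "Re a"])
  qed
  then obtain l1 \<alpha> where h1: "l1 \<ge> 0" "\<alpha> > 0" "\<And>t. t \<ge> l1 \<Longrightarrow> Re a - t * Im a \<ge> \<alpha>" by blast
  \<comment> \<open>Large enough for the coefficient of S to pay for its own real part and for the T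
    term, which is bounded through T \<le> R^2 S, with 1 to spare.\<close>
  define l2 where "l2 = (1 + \<bar>Re c\<bar> * R\<^sup>2 + \<bar>Re b\<bar>) / (- Im b)"
  define l where "l = max l1 l2"
  define \<beta> where "\<beta> = min 1 \<alpha>"
  have l0: "l \<ge> 0" using h1(1) by (simp add: l_def)
  have la: "Re a - l * Im a \<ge> \<beta>" using h1(3)[of l] by (auto simp: l_def \<beta>_def)
  have "l2 * (- Im b) \<le> l * (- Im b)"
    using assms(2) by (intro mult_right_mono) (auto simp: l_def)
  moreover have "l2 * (- Im b) = 1 + \<bar>Re c\<bar> * R\<^sup>2 + \<bar>Re b\<bar>"
    using assms(2) by (simp add: l2_def)
  ultimately have "l * (- Im b) \<ge> 1 + \<bar>Re c\<bar> * R\<^sup>2 + \<bar>Re b\<bar>" by simp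
  then have lb: "Re b - l * Im b \<ge> \<beta> + \<bar>Re c\<bar> * R\<^sup>2" by (auto simp: \<beta>_def)
  have \<beta>: "\<beta> > 0" "\<beta> \<le> 1" using h1(2) by (auto simp: \<beta>_def)
  show thesis
  proof (rule that[of "(1 + l) / \<beta>"])
    show "(1 + l) / \<beta> \<ge> 1" using l0 \<beta> by (simp add: field_simps)
    show "coercive R a b c ((1 + l) / \<beta>)"
      unfolding coercive_def
    proof (intro allI impI)
      fix P Q S T :: real
      assume nn: "P \<ge> 0" "Q \<ge> 0" "S \<ge> 0" "T \<ge> 0" "T \<le> R\<^sup>2 * S"
      define W where "W = complex_of_real P + (a * complex_of_real Q + b * complex_of_real S + c * complex_of_real T)"
      have re: "Re W = P + Re a * Q + Re b * S + Re c * T" and im: "Im W = Im a * Q + Im b * S + Im c * T"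
        unfolding W_def by simp_all
      have c1: "(Re c - l * Im c) * T \<ge> - (\<bar>Re c\<bar> * R\<^sup>2 * S)"
      proof -
        have "l * Im c * T \<le> 0" using l0 assms(3) nn(4) by (simp add: mult_nonneg_nonpos mult_nonpos_nonneg)
        moreover have "\<bar>Re c\<bar> * T \<le> \<bar>Re c\<bar> * (R\<^sup>2 * S)" using nn(5) by (intro mult_left_mono) auto
        moreover have "- (\<bar>Re c\<bar> * T) \<le> Re c * T" using nn(4) by (metis abs_ge_minus_self minus_le_iff mult_minus_left mult_right_mono)
        ultimately show ?thesis by (simp add: algebra_simps)
    qed
    have a1: "(Re a - l * Im a) * Q \<ge> \<beta> * Q" using la nn(2) by (intro mult_right_mono)
    have b1: "(Re b - l * Im b) * S \<ge> (\<beta> + \<bar>Re c\<bar> * R\<^sup>2) * S" using lb nn(3) by (intro mult_right_mono)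
    have "\<beta> * P \<le> 1 * P" using \<beta> nn(1) by (intro mult_right_mono) auto
    then have "\<beta> * (P + Q + S) \<le> P + (Re a - l * Im a) * Q + (Re b - l * Im b) * S + (Re c - l * Im c) * T"
      using a1 b1 c1 by (simp add: algebra_simps)
    also have "\<dots> = Re W - l * Im W" unfolding re im by (simp add: algebra_simps)
    also have "\<dots> \<le> cmod W + l * cmod W"
      using abs_Re_le_cmod[of W] mult_left_mono[OF order_trans[OF abs_ge_minus_self abs_Im_le_cmod[of W]] l0] by simp
    finally show "P + Q + S \<le> (1 + l) / \<beta> * cmod (complex_of_real P
        + (a * complex_of_real Q + b * complex_of_real S + c * complex_of_real T))"
      unfolding W_def[symmetric] using \<beta> by (simp add: field_simps)
    qed
  qed
qed

section \<open>Weighted integrals and the tested equation\<close>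

lemma L2z_product_integrable:
  fixes f h :: "'a::euclidean_space \<Rightarrow> complex" and k :: "'a \<Rightarrow> real"
  assumes f: "L2z U f" and h: "L2z U h" and k: "k \<in> borel_measurable lebesgue" "\<And>x. \<bar>k x\<bar> \<le> B"
  shows "integrable lebesgue (\<lambda>x. k x * (cmod (f x) * cmod (h x)))"
proof -
  have [measurable]: "f \<in> borel_measurable lebesgue" "h \<in> borel_measurable lebesgue" "k \<in> borel_measurable lebesgue"
    using f h k by (auto simp: L2z_def)
  have i: "integrable lebesgue (\<lambda>x. B * norm (f x * cnj (h x)))"
    using f h by (intro integrable_mult_right integrable_norm L2_times_integrable) (auto simp: L2z_def)
  then show ?thesis
  proof (rule Bochner_Integration.integrable_bound)
    show "AE x in lebesgue. norm (k x * (cmod (f x) * cmod (h x))) \<le> norm (B * norm (f x * cnj (h x)))"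
    proof (rule AE_I2)
      fix x
      have "\<bar>k x\<bar> \<le> \<bar>B\<bar>" using k(2)[of x] by linarith
      then show "norm (k x * (cmod (f x) * cmod (h x))) \<le> norm (B * norm (f x * cnj (h x)))"
        by (simp add: abs_mult norm_mult mult_right_mono)
    qed
  qed measurable
qed

lemma L2z_square_integrable:
  fixes f :: "'a::euclidean_space \<Rightarrow> complex" and k :: "'a \<Rightarrow> real"
  assumes "L2z U f" "k \<in> borel_measurable lebesgue" "\<And>x. \<bar>k x\<bar> \<le> B"
  shows "integrable lebesgue (\<lambda>x. k x * (cmod (f x))\<^sup>2)"
  using L2z_product_integrable[OF assms(1) assms(1,2,3)] by (simp add: power2_eq_square)

lemma L2z_powr_integrable:
  fixes g :: "'a::euclidean_space \<Rightarrow> complex" and k :: "'a \<Rightarrow> real"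
  assumes g: "L2z U g" and U: "open U" "bounded U" and m: "0 < m" "m < 1"
    and k: "k \<in> borel_measurable lebesgue" "\<And>x. \<bar>k x\<bar> \<le> B"
  shows "integrable lebesgue (\<lambda>x. k x * cmod (g x) powr (1 + m))"
proof -
  have "cmod (nl m z) * cmod z = cmod z powr (1 + m)" for z
    using arg_cong[OF nl_mult_cnj[OF m, of z], of cmod] by (simp add: norm_mult)
  then show ?thesis
    using L2z_product_integrable[OF L2z_nl[OF g U m] g k] by simp
qed

definition reaction :: "real \<Rightarrow> complex \<Rightarrow> complex \<Rightarrow> complex \<Rightarrow> ('a::euclidean_space \<Rightarrow> complex) \<Rightarrow> 'a \<Rightarrow> complex" where
  "reaction m a b c g x = a * nl m (g x) + b * g x + c * complex_of_real ((norm x)\<^sup>2) * g x"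

lemma L2z_reaction:
  assumes g: "L2z U g" and U: "open U" "bounded U" "U \<subseteq> ball 0 R" and m: "0 < m" "m < 1"
  shows "L2z U (reaction m a b c g)"
  unfolding reaction_def[abs_def]
proof (intro L2z_add)
  show "L2z U (\<lambda>x. a * nl m (g x))"
    by (rule L2z_mult[where B = "cmod a"]) (use L2z_nl[OF g U(1,2) m] in auto)
  show "L2z U (\<lambda>x. b * g x)"
    by (rule L2z_mult[where B = "cmod b"]) (use g in auto)
  show "L2z U (\<lambda>x. c * complex_of_real ((norm x)\<^sup>2) * g x)"
  proof (rule L2z_mult[where B = "cmod c * R\<^sup>2", OF g])
    show "(\<lambda>x. c * complex_of_real ((norm x)\<^sup>2)) \<in> borel_measurable lebesgue"
      by (intro borel_measurable_continuous_lebesgue continuous_intros)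
    fix x assume "x \<in> U"
    then have "(norm x)\<^sup>2 \<le> R\<^sup>2" using U(3) by (intro power_mono) auto
    then show "cmod (c * complex_of_real ((norm x)\<^sup>2)) \<le> cmod c * R\<^sup>2"
      by (simp add: norm_mult mult_left_mono norm_power)
  qed simp
qed

lemma fd_power2:
  fixes \<kappa> :: "'a::euclidean_space \<Rightarrow> real"
  assumes "C_inf \<kappa>"
  shows "C_inf (\<lambda>x. (\<kappa> x)\<^sup>2)" "fd (\<lambda>x. (\<kappa> x)\<^sup>2) i x = 2 * \<kappa> x * fd \<kappa> i x"
proof -
  show "C_inf (\<lambda>x. (\<kappa> x)\<^sup>2)"
    unfolding power2_eq_square by (rule C_inf_bilinear[OF bounded_bilinear_mult assms assms])
  have "((\<lambda>x. (\<kappa> x)\<^sup>2) has_derivative (\<lambda>i. 2 * \<kappa> x * fd \<kappa> i x)) (at x)"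
    using C_inf_has_derivative[OF assms, of x] by (auto intro!: derivative_eq_intros)
  from frechet_derivative_at[OF this, symmetric]
  show "fd (\<lambda>x. (\<kappa> x)\<^sup>2) i x = 2 * \<kappa> x * fd \<kappa> i x" by simp
qed

text \<open>The equation tested with \<kappa>^2 g, combined with coercivity. The cutoff is squared
  so that the cross term, whose coefficient is 2 \<kappa> times a derivative of \<kappa>, retains a
  factor \<kappa> and can later be absorbed into the weighted energy.\<close>

lemma energy_identity_bound:
  fixes g G :: "'a::euclidean_space \<Rightarrow> complex" and \<kappa> :: "'a \<Rightarrow> real"
  assumes U: "open U" "bounded U" "U \<subseteq> ball 0 R" and m: "0 < m" "m < 1"
    and g: "L2z U g" and Dg: "\<And>i. i \<in> Basis \<Longrightarrow> L2z U (Dg i)" and G: "L2z U G"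
    and weak: "weak_eq U Dg (reaction m a b c g) G"
    and K0: "K \<ge> 0" and K: "coercive R a b c K"
    and \<kappa>: "kernel \<kappa>"
    and H: "H10c U (\<lambda>x. (\<kappa> x)\<^sup>2 *\<^sub>R g x) (\<lambda>i x. (\<kappa> x)\<^sup>2 *\<^sub>R Dg i x + fd (\<lambda>x. (\<kappa> x)\<^sup>2) i x *\<^sub>R g x)"
  shows "(\<Sum>i\<in>Basis. LINT x|lebesgue. (\<kappa> x)\<^sup>2 * (cmod (Dg i x))\<^sup>2)
      + (LINT x|lebesgue. (\<kappa> x)\<^sup>2 * cmod (g x) powr (1 + m))
      + (LINT x|lebesgue. (\<kappa> x)\<^sup>2 * (cmod (g x))\<^sup>2)
    \<le> K * ((LINT x|lebesgue. (\<kappa> x)\<^sup>2 * (cmod (G x) * cmod (g x)))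
      + (\<Sum>i\<in>Basis. LINT x|lebesgue. \<bar>2 * \<kappa> x * fd \<kappa> i x\<bar> * (cmod (Dg i x) * cmod (g x))))"
proof -
  have C: "C_inf \<kappa>" using \<kappa> by (simp add: kernel_def)
  have k\<kappa>': "kernel (fd \<kappa> i)" for i using kernel_derivative[OF \<kappa>] .
  have [measurable]: "\<kappa> \<in> borel_measurable lebesgue" "\<And>i. fd \<kappa> i \<in> borel_measurable lebesgue"
    using kernel_lebesgue[OF \<kappa>] kernel_lebesgue[OF k\<kappa>'] by auto
  obtain B where B: "B \<ge> 0" "\<And>x. norm (\<kappa> x) \<le> B" using kernel_bound[OF \<kappa>] by blast
  have "\<exists>B'. B' \<ge> 0 \<and> (\<forall>x. norm (fd \<kappa> i x) \<le> B')" for i using kernel_bound[OF k\<kappa>', of i] by metis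
  then obtain B' where B': "\<And>i. B' i \<ge> 0" "\<And>i x. norm (fd \<kappa> i x) \<le> B' i" by metis
  have k2: "(\<lambda>x. (\<kappa> x)\<^sup>2) \<in> borel_measurable lebesgue" "\<And>x. \<bar>(\<kappa> x)\<^sup>2\<bar> \<le> B\<^sup>2"
  proof -
    show "(\<lambda>x. (\<kappa> x)\<^sup>2) \<in> borel_measurable lebesgue" by measurable
    show "\<bar>(\<kappa> x)\<^sup>2\<bar> \<le> B\<^sup>2" for x using power_mono[OF B(2)[of x], of 2] by simp
  qed
  define e where "e i x = 2 * \<kappa> x * fd \<kappa> i x" for i x
  have e: "e i \<in> borel_measurable lebesgue" "\<bar>e i x\<bar> \<le> 2 * B * B' i" for i x
  proof -
    show "e i \<in> borel_measurable lebesgue" unfolding e_def by measurable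
    show "\<bar>e i x\<bar> \<le> 2 * B * B' i"
      unfolding e_def using B(1) B(2)[of x] B'(1)[of i] B'(2)[of x i] by (auto simp: abs_mult intro!: mult_mono)
  qed
  have ea: "(\<lambda>x. \<bar>e i x\<bar>) \<in> borel_measurable lebesgue" for i using e(1) by measurable
  define P Q S T where "P = (\<Sum>i\<in>Basis. LINT x|lebesgue. (\<kappa> x)\<^sup>2 * (cmod (Dg i x))\<^sup>2)"
    and "Q = (LINT x|lebesgue. (\<kappa> x)\<^sup>2 * cmod (g x) powr (1 + m))"
    and "S = (LINT x|lebesgue. (\<kappa> x)\<^sup>2 * (cmod (g x))\<^sup>2)"
    and "T = (LINT x|lebesgue. (\<kappa> x)\<^sup>2 * ((norm x)\<^sup>2 * (cmod (g x))\<^sup>2))"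
  define Z where "Z = (LINT x|lebesgue. G x * cnj ((\<kappa> x)\<^sup>2 *\<^sub>R g x))"
  define X where "X i = (LINT x|lebesgue. complex_of_real (e i x) * (Dg i x * cnj (g x)))" for i
  have iQ: "integrable lebesgue (\<lambda>x. (\<kappa> x)\<^sup>2 * cmod (g x) powr (1 + m))"
    by (rule L2z_powr_integrable[OF g U(1,2) m k2])
  have iS: "integrable lebesgue (\<lambda>x. (\<kappa> x)\<^sup>2 * (cmod (g x))\<^sup>2)"
    by (rule L2z_square_integrable[OF g k2])
  have g0: "g x = 0" if "x \<notin> U" for x using g that by (simp add: L2z_def)
  have nR: "(norm x)\<^sup>2 \<le> R\<^sup>2" if "x \<in> U" for x using that U(3) by (intro power_mono) auto
  have iT: "integrable lebesgue (\<lambda>x. (\<kappa> x)\<^sup>2 * ((norm x)\<^sup>2 * (cmod (g x))\<^sup>2))"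
  proof (rule Bochner_Integration.integrable_bound[OF integrable_mult_right[OF iS, of "R\<^sup>2"]])
    have [measurable]: "g \<in> borel_measurable lebesgue" using g by (simp add: L2z_def)
    have [measurable]: "(\<lambda>x::'a. (norm x)\<^sup>2) \<in> borel_measurable lebesgue"
      by (intro borel_measurable_continuous_lebesgue continuous_intros)
    show "(\<lambda>x. (\<kappa> x)\<^sup>2 * ((norm x)\<^sup>2 * (cmod (g x))\<^sup>2)) \<in> borel_measurable lebesgue" by measurable
    show "AE x in lebesgue. norm ((\<kappa> x)\<^sup>2 * ((norm x)\<^sup>2 * (cmod (g x))\<^sup>2)) \<le> norm (R\<^sup>2 * ((\<kappa> x)\<^sup>2 * (cmod (g x))\<^sup>2))"
    proof (rule AE_I2)
      fix x
      show "norm ((\<kappa> x)\<^sup>2 * ((norm x)\<^sup>2 * (cmod (g x))\<^sup>2)) \<le> norm (R\<^sup>2 * ((\<kappa> x)\<^sup>2 * (cmod (g x))\<^sup>2))"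
        using nR[of x] g0[of x] by (cases "x \<in> U") (auto simp: abs_mult mult.left_commute[of "(\<kappa> x)\<^sup>2"] intro!: mult_right_mono)
    qed
  qed
  have iX: "integrable lebesgue (\<lambda>x. complex_of_real (e i x) * (Dg i x * cnj (g x)))" if i: "i \<in> Basis" for i
  proof (rule Bochner_Integration.integrable_bound[OF L2z_product_integrable[OF Dg[OF i] g, of "\<lambda>x. \<bar>e i x\<bar>" "2 * B * B' i"]])
    have [measurable]: "g \<in> borel_measurable lebesgue" "Dg i \<in> borel_measurable lebesgue" "e i \<in> borel_measurable lebesgue"
      using g Dg[OF i] e by (auto simp: L2z_def)
    have [measurable]: "cnj \<in> borel_measurable borel"
      by (intro borel_measurable_continuous_onI continuous_intros)
    show "(\<lambda>x. complex_of_real (e i x) * (Dg i x * cnj (g x))) \<in> borel_measurable lebesgue" by measurable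
  qed (use ea e in \<open>auto simp: norm_mult abs_mult\<close>)
  have T: "T \<le> R\<^sup>2 * S"
  proof -
    have "T \<le> (LINT x|lebesgue. R\<^sup>2 * ((\<kappa> x)\<^sup>2 * (cmod (g x))\<^sup>2))"
      unfolding T_def
    proof (rule integral_mono[OF iT])
      fix x show "(\<kappa> x)\<^sup>2 * ((norm x)\<^sup>2 * (cmod (g x))\<^sup>2) \<le> R\<^sup>2 * ((\<kappa> x)\<^sup>2 * (cmod (g x))\<^sup>2)"
        using nR[of x] g0[of x] by (cases "x \<in> U") (auto simp: mult.left_commute[of "(\<kappa> x)\<^sup>2"] intro!: mult_right_mono)
    qed (use iS in simp)
    then show ?thesis by (simp add: S_def)
  qed
  have t1: "(LINT x|lebesgue. Dg i x * cnj ((\<kappa> x)\<^sup>2 *\<^sub>R Dg i x + fd (\<lambda>x. (\<kappa> x)\<^sup>2) i x *\<^sub>R g x))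
     = complex_of_real (LINT x|lebesgue. (\<kappa> x)\<^sup>2 * (cmod (Dg i x))\<^sup>2) + X i" if i: "i \<in> Basis" for i
  proof -
    have "(LINT x|lebesgue. Dg i x * cnj ((\<kappa> x)\<^sup>2 *\<^sub>R Dg i x + fd (\<lambda>x. (\<kappa> x)\<^sup>2) i x *\<^sub>R g x))
      = (LINT x|lebesgue. complex_of_real ((\<kappa> x)\<^sup>2 * (cmod (Dg i x))\<^sup>2) + complex_of_real (e i x) * (Dg i x * cnj (g x)))"
      unfolding fd_power2(2)[OF C] e_def
      by (intro Bochner_Integration.integral_cong[OF refl])
        (simp add: scaleR_conv_of_real complex_norm_square algebra_simps del: of_real_power)
    also have "\<dots> = (LINT x|lebesgue. complex_of_real ((\<kappa> x)\<^sup>2 * (cmod (Dg i x))\<^sup>2)) + X i"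
      unfolding X_def
      using L2z_square_integrable[OF Dg[OF i] k2]
      by (intro Bochner_Integration.integral_add iX i) (simp only: integrable_of_real)
    finally show ?thesis by (simp only: integral_complex_of_real)
  qed
  have t2: "(LINT x|lebesgue. reaction m a b c g x * cnj ((\<kappa> x)\<^sup>2 *\<^sub>R g x))
     = a * complex_of_real Q + b * complex_of_real S + c * complex_of_real T"
  proof -
    have pt: "reaction m a b c g x * cnj ((\<kappa> x)\<^sup>2 *\<^sub>R g x) = a * complex_of_real ((\<kappa> x)\<^sup>2 * cmod (g x) powr (1 + m))
      + b * complex_of_real ((\<kappa> x)\<^sup>2 * (cmod (g x))\<^sup>2) + c * complex_of_real ((\<kappa> x)\<^sup>2 * ((norm x)\<^sup>2 * (cmod (g x))\<^sup>2))" for x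
    proof -
      have "reaction m a b c g x * cnj ((\<kappa> x)\<^sup>2 *\<^sub>R g x) = complex_of_real ((\<kappa> x)\<^sup>2) * (a * (nl m (g x) * cnj (g x)) + b * (g x * cnj (g x))
          + c * complex_of_real ((norm x)\<^sup>2) * (g x * cnj (g x)))"
        by (simp add: reaction_def scaleR_conv_of_real algebra_simps)
      also have "g x * cnj (g x) = complex_of_real ((cmod (g x))\<^sup>2)" by (rule complex_norm_square[symmetric])
      finally show ?thesis unfolding nl_mult_cnj[OF m] by (simp add: algebra_simps)
    qed
    have of: "integrable lebesgue (\<lambda>x. complex_of_real (f x))" if "integrable lebesgue f" for f :: "'a \<Rightarrow> real"
      using that by (simp only: integrable_of_real)
    have lin: "(LINT x|lebesgue. a * p x + b * q x + c * r x) = a * integral\<^sup>L lebesgue p + b * integral\<^sup>L lebesgue q + c * integral\<^sup>L lebesgue r"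
      if "integrable lebesgue p" "integrable lebesgue q" "integrable lebesgue r" for p q r :: "'a \<Rightarrow> complex"
      using that by simp
    show ?thesis
      unfolding pt Q_def S_def T_def integral_complex_of_real[symmetric]
      by (rule lin[OF of[OF iQ] of[OF iS] of[OF iT]])
  qed
  have "(\<Sum>i\<in>Basis. LINT x|lebesgue. Dg i x * cnj ((\<kappa> x)\<^sup>2 *\<^sub>R Dg i x + fd (\<lambda>x. (\<kappa> x)\<^sup>2) i x *\<^sub>R g x))
     + (LINT x|lebesgue. reaction m a b c g x * cnj ((\<kappa> x)\<^sup>2 *\<^sub>R g x)) = Z"
    unfolding Z_def by (rule weak_eq_H10c[OF weak Dg L2z_reaction[OF g U m] G H])
  moreover have "(\<Sum>i\<in>Basis. LINT x|lebesgue. Dg i x * cnj ((\<kappa> x)\<^sup>2 *\<^sub>R Dg i x + fd (\<lambda>x. (\<kappa> x)\<^sup>2) i x *\<^sub>R g x))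
      = complex_of_real P + (\<Sum>i\<in>Basis. X i)"
    unfolding P_def of_real_sum sum.distrib[symmetric] by (rule sum.cong[OF refl t1])
  ultimately have eq: "complex_of_real P + (a * complex_of_real Q + b * complex_of_real S + c * complex_of_real T) = Z - (\<Sum>i\<in>Basis. X i)"
    unfolding t2 by (simp only: eq_diff_eq) (simp only: add_ac)
  have "P + Q + S \<le> K * cmod (Z - (\<Sum>i\<in>Basis. X i))"
    unfolding eq[symmetric]
    by (rule K[unfolded coercive_def, rule_format, OF _ _ _ _ T])
      (auto simp: P_def Q_def S_def T_def intro!: sum_nonneg)
  also have "cmod (Z - (\<Sum>i\<in>Basis. X i)) \<le> cmod Z + (\<Sum>i\<in>Basis. cmod (X i))"
    by (rule order_trans[OF norm_triangle_ineq4 add_left_mono[OF norm_sum]])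
  also have "cmod Z \<le> (LINT x|lebesgue. (\<kappa> x)\<^sup>2 * (cmod (G x) * cmod (g x)))"
  proof -
    have "cmod Z \<le> (LINT x|lebesgue. norm (G x * cnj ((\<kappa> x)\<^sup>2 *\<^sub>R g x)))"
      unfolding Z_def by (rule integral_norm_bound)
    also have "\<dots> = (LINT x|lebesgue. (\<kappa> x)\<^sup>2 * (cmod (G x) * cmod (g x)))"
      by (intro Bochner_Integration.integral_cong[OF refl]) (simp add: norm_mult)
    finally show ?thesis .
  qed
  also have "(\<Sum>i\<in>Basis. cmod (X i)) \<le> (\<Sum>i\<in>Basis. LINT x|lebesgue. \<bar>2 * \<kappa> x * fd \<kappa> i x\<bar> * (cmod (Dg i x) * cmod (g x)))"
  proof (rule sum_mono)
    fix i
    have "cmod (X i) \<le> (LINT x|lebesgue. norm (complex_of_real (e i x) * (Dg i x * cnj (g x))))"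
      unfolding X_def by (rule integral_norm_bound)
    also have "\<dots> = (LINT x|lebesgue. \<bar>2 * \<kappa> x * fd \<kappa> i x\<bar> * (cmod (Dg i x) * cmod (g x)))"
      by (intro Bochner_Integration.integral_cong[OF refl]) (simp add: norm_mult abs_mult e_def)
    finally show "cmod (X i) \<le> (LINT x|lebesgue. \<bar>2 * \<kappa> x * fd \<kappa> i x\<bar> * (cmod (Dg i x) * cmod (g x)))" .
  qed
  finally show ?thesis
    using K0 by (simp add: P_def Q_def S_def mult_left_mono)
qed

definition bint :: "'a::euclidean_space \<Rightarrow> ('a \<Rightarrow> real) \<Rightarrow> real \<Rightarrow> real" where
  "bint x0 f r = (LINT x|lebesgue. indicat_real (ball x0 r) x * f x)"

abbreviation bsq :: "'a::euclidean_space \<Rightarrow> ('a \<Rightarrow> complex) \<Rightarrow> real \<Rightarrow> real" where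
  "bsq x0 f \<equiv> bint x0 (\<lambda>x. (cmod (f x))\<^sup>2)"

lemma cutoff_facts:
  assumes "cutoff C x0 r s \<kappa>" and "r < s"
  shows "kernel \<kappa>" "C_inf \<kappa>" "closure {x. \<kappa> x \<noteq> 0} \<subseteq> ball x0 s"
    "indicat_real (ball x0 r) x \<le> (\<kappa> x)\<^sup>2" "(\<kappa> x)\<^sup>2 \<le> indicat_real (ball x0 s) x" "\<kappa> x \<ge> 0" "\<kappa> x \<le> 1"
    "i \<in> Basis \<Longrightarrow> (fd \<kappa> i x)\<^sup>2 \<le> (C / (s - r))\<^sup>2 * indicat_real (ball x0 s) x"
proof -
  show c: "C_inf \<kappa>" "closure {x. \<kappa> x \<noteq> 0} \<subseteq> ball x0 s" "\<kappa> x \<ge> 0" "\<kappa> x \<le> 1"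
    using assms(1) by (auto simp: cutoff_def)
  then show "kernel \<kappa>" using kernel_cutoff by blast
  have off: "\<kappa> x = 0" "fd \<kappa> i x = 0" if "x \<notin> ball x0 s"
  proof -
    have "x \<notin> closure {x. \<kappa> x \<noteq> 0}" using that c(2) by blast
    then show "\<kappa> x = 0" "fd \<kappa> i x = 0"
      using closure_subset[of "{x. \<kappa> x \<noteq> 0}"] frechet_derivative_off_support[of x \<kappa>] by auto
  qed
  show "indicat_real (ball x0 r) x \<le> (\<kappa> x)\<^sup>2"
    using assms(1) by (cases "x \<in> ball x0 r") (auto simp: cutoff_def simp del: mem_ball)
  show "(\<kappa> x)\<^sup>2 \<le> indicat_real (ball x0 s) x"
    using off(1) c(3,4) by (cases "x \<in> ball x0 s") (auto simp: power_le_one simp del: mem_ball)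
  assume i: "i \<in> Basis"
  show "(fd \<kappa> i x)\<^sup>2 \<le> (C / (s - r))\<^sup>2 * indicat_real (ball x0 s) x"
  proof (cases "x \<in> ball x0 s")
    case True
    have "\<bar>fd \<kappa> i x\<bar> \<le> C / (s - r)" using assms(1) i by (auto simp: cutoff_def)
    then have "\<bar>fd \<kappa> i x\<bar>\<^sup>2 \<le> (C / (s - r))\<^sup>2" by (intro power_mono) auto
    then show ?thesis using True by simp
  qed (use off in simp)
qed

lemma ball_indicator_measurable: "indicat_real (ball (x0::'a::euclidean_space) r) \<in> borel_measurable lebesgue"
  by (intro borel_measurable_indicator) simp

lemma bint_integrable:
  assumes "L2z U f"
  shows "integrable lebesgue (\<lambda>x. indicat_real (ball x0 r) x * (cmod (f x))\<^sup>2)"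
  by (rule L2z_square_integrable[OF assms ball_indicator_measurable, of _ _ 1]) (auto simp: indicator_def)

lemma weighted_le_bint:
  assumes f: "L2z U f" and w: "w \<in> borel_measurable lebesgue" "\<And>x. 0 \<le> w x" "\<And>x. w x \<le> B * indicat_real (ball x0 s) x"
  shows "(LINT x|lebesgue. w x * (cmod (f x))\<^sup>2) \<le> B * bsq x0 f s"
proof -
  have "(LINT x|lebesgue. w x * (cmod (f x))\<^sup>2) \<le> (LINT x|lebesgue. B * (indicat_real (ball x0 s) x * (cmod (f x))\<^sup>2))"
  proof (rule integral_mono)
    have "\<bar>w x\<bar> \<le> \<bar>B\<bar>" for x
      using w(2)[of x] w(3)[of x] by (cases "x \<in> ball x0 s") (auto simp del: mem_ball)
    then show "integrable lebesgue (\<lambda>x. w x * (cmod (f x))\<^sup>2)"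
      using L2z_square_integrable[OF f w(1)] by blast
    show "w x * (cmod (f x))\<^sup>2 \<le> B * (indicat_real (ball x0 s) x * (cmod (f x))\<^sup>2)" for x
      using mult_right_mono[OF w(3)[of x], of "(cmod (f x))\<^sup>2"] by (simp add: mult.assoc)
  qed (use bint_integrable[OF f] in simp)
  then show ?thesis by (simp add: bint_def)
qed

text \<open>Young's inequality splits the cross term in two ways. Absorbing its gradient factor
  leaves |g|^2 on the right, the form used in the iteration. Absorbing its factor |g| into the
  coercive term S leaves the squared gradient, the form that lets a small gradient start the
  iteration.\<close>

lemma energy_local:
  fixes g G :: "'a::euclidean_space \<Rightarrow> complex" and \<kappa> :: "'a \<Rightarrow> real"
  assumes U: "open U" "bounded U" "U \<subseteq> ball 0 R" and m: "0 < m" "m < 1"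
    and g: "L2z U g" and Dg: "\<And>i. i \<in> Basis \<Longrightarrow> L2z U (Dg i)" and G: "L2z U G"
    and weak: "weak_eq U Dg (reaction m a b c g) G"
    and K0: "K \<ge> 1" and K: "coercive R a b c K"
    and Hc: "\<And>\<eta>. C_inf \<eta> \<Longrightarrow> closure {x. \<eta> x \<noteq> 0} \<subseteq> ball x0 s \<Longrightarrow>
      H10c U (\<lambda>x. \<eta> x *\<^sub>R g x) (\<lambda>i x. \<eta> x *\<^sub>R Dg i x + fd \<eta> i x *\<^sub>R g x)"
    and \<kappa>: "cutoff C x0 r s \<kappa>" and rs: "r < s" and C: "C > 0"
    and M: "M = 8 * real DIM('a) * K\<^sup>2 * (1 + C\<^sup>2)"
  shows "(\<Sum>i\<in>Basis. bsq x0 (Dg i) r) + bint x0 (\<lambda>x. cmod (g x) powr (1 + m)) r + bsq x0 g r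
      \<le> M * (bsq x0 G s + bsq x0 g s / (s - r)\<^sup>2)" (is "?L \<le> M * (?G + ?A)")
    and "(\<Sum>i\<in>Basis. bsq x0 (Dg i) r) + bint x0 (\<lambda>x. cmod (g x) powr (1 + m)) r + bsq x0 g r
      \<le> M * (bsq x0 G s + (\<Sum>i\<in>Basis. bsq x0 (Dg i) s) / (s - r)\<^sup>2)" (is "_ \<le> M * (?G + ?B)")
proof -
  note cf = cutoff_facts[OF \<kappa> rs]
  have k\<kappa>': "kernel (fd \<kappa> i)" for i using kernel_derivative[OF cf(1)] .
  have [measurable]: "\<kappa> \<in> borel_measurable lebesgue" "\<And>i. fd \<kappa> i \<in> borel_measurable lebesgue"
    using kernel_lebesgue[OF cf(1)] kernel_lebesgue[OF k\<kappa>'] by auto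
  have k2: "(\<lambda>x. (\<kappa> x)\<^sup>2) \<in> borel_measurable lebesgue" "\<And>x. \<bar>(\<kappa> x)\<^sup>2\<bar> \<le> 1"
    using cf(6,7) by (measurable, simp add: power_le_one)
  have f2: "(\<lambda>x. (fd \<kappa> i x)\<^sup>2) \<in> borel_measurable lebesgue" for i by measurable
  have f2b: "\<bar>(fd \<kappa> i x)\<^sup>2\<bar> \<le> (C / (s - r))\<^sup>2" if "i \<in> Basis" for i x
    using cf(8)[OF that, of x] by (cases "x \<in> ball x0 s") (auto simp del: mem_ball)
  define N where "N = real DIM('a)"
  have N: "N \<ge> 1" unfolding N_def using DIM_positive[where 'a = 'a] by linarith
  define P where "P i = (LINT x|lebesgue. (\<kappa> x)\<^sup>2 * (cmod (Dg i x))\<^sup>2)" for i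
  define Q where "Q = (LINT x|lebesgue. (\<kappa> x)\<^sup>2 * cmod (g x) powr (1 + m))"
  define S where "S = (LINT x|lebesgue. (\<kappa> x)\<^sup>2 * (cmod (g x))\<^sup>2)"
  define V where "V = (LINT x|lebesgue. (\<kappa> x)\<^sup>2 * (cmod (G x))\<^sup>2)"
  define A where "A i = (LINT x|lebesgue. (fd \<kappa> i x)\<^sup>2 * (cmod (g x))\<^sup>2)" for i
  define B where "B i = (LINT x|lebesgue. (fd \<kappa> i x)\<^sup>2 * (cmod (Dg i x))\<^sup>2)" for i
  have nonneg: "P i \<ge> 0" "Q \<ge> 0" "S \<ge> 0" "V \<ge> 0" "A i \<ge> 0" "B i \<ge> 0" for i
    by (simp_all add: P_def Q_def S_def V_def A_def B_def)
  note iP = L2z_square_integrable[OF Dg k2] and iS = L2z_square_integrable[OF g k2] and iV = L2z_square_integrable[OF G k2]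
    and iA = L2z_square_integrable[OF g f2 f2b]
  have iB: "integrable lebesgue (\<lambda>x. (fd \<kappa> i x)\<^sup>2 * (cmod (Dg i x))\<^sup>2)" if i: "i \<in> Basis" for i
    by (rule L2z_square_integrable[OF Dg[OF i] f2 f2b[OF i]])
  have cl: "closure {x. (\<kappa> x)\<^sup>2 \<noteq> 0} \<subseteq> ball x0 s" using cf(3) by simp
  have main: "(\<Sum>i\<in>Basis. P i) + Q + S \<le> K * ((LINT x|lebesgue. (\<kappa> x)\<^sup>2 * (cmod (G x) * cmod (g x)))
      + (\<Sum>i\<in>Basis. LINT x|lebesgue. \<bar>2 * \<kappa> x * fd \<kappa> i x\<bar> * (cmod (Dg i x) * cmod (g x))))"
    unfolding P_def Q_def S_def using K0 cf(1)
    by (intro energy_identity_bound[OF U m g Dg G weak _ K] Hc fd_power2 cf(2) cl) auto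
  have ig: "integrable lebesgue (\<lambda>x. (\<kappa> x)\<^sup>2 * (cmod (G x) * cmod (g x)))"
    by (rule L2z_product_integrable[OF G g k2])
  have ix: "integrable lebesgue (\<lambda>x. \<bar>2 * \<kappa> x * fd \<kappa> i x\<bar> * (cmod (Dg i x) * cmod (g x)))" if i: "i \<in> Basis" for i
  proof (rule L2z_product_integrable[OF Dg[OF i] g])
    show "(\<lambda>x. \<bar>2 * \<kappa> x * fd \<kappa> i x\<bar>) \<in> borel_measurable lebesgue" by measurable
    fix x
    have "\<bar>fd \<kappa> i x\<bar> \<le> C / (s - r)" using \<kappa> i by (auto simp: cutoff_def)
    then have "\<kappa> x * \<bar>fd \<kappa> i x\<bar> \<le> 1 * (C / (s - r))"
      using cf(6,7)[of x] by (intro mult_mono) auto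
    then show "\<bar>\<bar>2 * \<kappa> x * fd \<kappa> i x\<bar>\<bar> \<le> 2 * (C / (s - r))"
      using cf(6)[of x] by (simp add: abs_mult)
  qed
  have gbound: "K * (LINT x|lebesgue. (\<kappa> x)\<^sup>2 * (cmod (G x) * cmod (g x))) \<le> S / 4 + K\<^sup>2 * V"
  proof -
    have "(LINT x|lebesgue. K * ((\<kappa> x)\<^sup>2 * (cmod (G x) * cmod (g x))))
        \<le> (LINT x|lebesgue. (1 / 4) * ((\<kappa> x)\<^sup>2 * (cmod (g x))\<^sup>2) + K\<^sup>2 * ((\<kappa> x)\<^sup>2 * (cmod (G x))\<^sup>2))"
    proof (rule integral_mono)
      fix x
      have "0 \<le> (\<kappa> x)\<^sup>2 * (cmod (g x) / 2 - K * cmod (G x))\<^sup>2" by simp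
      then show "K * ((\<kappa> x)\<^sup>2 * (cmod (G x) * cmod (g x)))
          \<le> (1 / 4) * ((\<kappa> x)\<^sup>2 * (cmod (g x))\<^sup>2) + K\<^sup>2 * ((\<kappa> x)\<^sup>2 * (cmod (G x))\<^sup>2)"
        by (simp add: power2_diff power_mult_distrib power_divide algebra_simps)
    qed (use ig iS iV in auto)
    then show ?thesis using iS iV by (simp add: S_def V_def)
  qed
  have xbound: "K * (LINT x|lebesgue. \<bar>2 * \<kappa> x * fd \<kappa> i x\<bar> * (cmod (Dg i x) * cmod (g x))) \<le> P i / 2 + 2 * K\<^sup>2 * A i"
    if i: "i \<in> Basis" for i
  proof -
    have "(LINT x|lebesgue. K * (\<bar>2 * \<kappa> x * fd \<kappa> i x\<bar> * (cmod (Dg i x) * cmod (g x))))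
        \<le> (LINT x|lebesgue. (1 / 2) * ((\<kappa> x)\<^sup>2 * (cmod (Dg i x))\<^sup>2) + 2 * K\<^sup>2 * ((fd \<kappa> i x)\<^sup>2 * (cmod (g x))\<^sup>2))"
    proof (rule integral_mono)
      fix x
      have "0 \<le> (\<kappa> x * cmod (Dg i x) - 2 * K * (\<bar>fd \<kappa> i x\<bar> * cmod (g x)))\<^sup>2 / 2" by simp
      also have "\<dots> = (1 / 2) * ((\<kappa> x)\<^sup>2 * (cmod (Dg i x))\<^sup>2) + 2 * K\<^sup>2 * ((fd \<kappa> i x)\<^sup>2 * (cmod (g x))\<^sup>2)
          - K * (2 * \<kappa> x * \<bar>fd \<kappa> i x\<bar> * (cmod (Dg i x) * cmod (g x)))"
        by (simp add: power2_diff power_mult_distrib field_simps)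
      finally show "K * (\<bar>2 * \<kappa> x * fd \<kappa> i x\<bar> * (cmod (Dg i x) * cmod (g x)))
          \<le> (1 / 2) * ((\<kappa> x)\<^sup>2 * (cmod (Dg i x))\<^sup>2) + 2 * K\<^sup>2 * ((fd \<kappa> i x)\<^sup>2 * (cmod (g x))\<^sup>2)"
        using cf(6)[of x] by (simp add: abs_mult)
    qed (use ix[OF i] iP[OF i] iA[OF i] in auto)
    then show ?thesis using iP[OF i] iA[OF i] by (simp add: P_def A_def)
  qed
  \<comment> \<open>With the weight 1 / (4 N), the N cross terms together consume S / 4; another S /
    4 goes to the term with G, so that half of S survives on the left.\<close>
  have xbound2: "K * (LINT x|lebesgue. \<bar>2 * \<kappa> x * fd \<kappa> i x\<bar> * (cmod (Dg i x) * cmod (g x))) \<le> S / (4 * N) + 4 * N * K\<^sup>2 * B i"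
    if i: "i \<in> Basis" for i
  proof -
    have "(LINT x|lebesgue. K * (\<bar>2 * \<kappa> x * fd \<kappa> i x\<bar> * (cmod (Dg i x) * cmod (g x))))
        \<le> (LINT x|lebesgue. (1 / (4 * N)) * ((\<kappa> x)\<^sup>2 * (cmod (g x))\<^sup>2) + 4 * N * K\<^sup>2 * ((fd \<kappa> i x)\<^sup>2 * (cmod (Dg i x))\<^sup>2))"
    proof (rule integral_mono)
      fix x
      have "0 \<le> (\<kappa> x * cmod (g x) - 4 * N * K * (\<bar>fd \<kappa> i x\<bar> * cmod (Dg i x)))\<^sup>2 / (4 * N)" using N by simp
      also have "\<dots> = (1 / (4 * N)) * ((\<kappa> x)\<^sup>2 * (cmod (g x))\<^sup>2) + 4 * N * K\<^sup>2 * ((fd \<kappa> i x)\<^sup>2 * (cmod (Dg i x))\<^sup>2)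
          - K * (2 * \<kappa> x * \<bar>fd \<kappa> i x\<bar> * (cmod (Dg i x) * cmod (g x)))"
        using N by (simp add: power2_diff power_mult_distrib field_simps) (simp add: power2_eq_square)
      finally show "K * (\<bar>2 * \<kappa> x * fd \<kappa> i x\<bar> * (cmod (Dg i x) * cmod (g x)))
          \<le> (1 / (4 * N)) * ((\<kappa> x)\<^sup>2 * (cmod (g x))\<^sup>2) + 4 * N * K\<^sup>2 * ((fd \<kappa> i x)\<^sup>2 * (cmod (Dg i x))\<^sup>2)"
        using cf(6)[of x] by (simp add: abs_mult)
    qed (use ix[OF i] iS iB[OF i] in auto)
    then show ?thesis using iS iB[OF i] by (simp add: S_def B_def)
  qed
  have low: "?L \<le> (\<Sum>i\<in>Basis. P i) + Q + S"
  proof (intro add_mono sum_mono)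
    show "bsq x0 (Dg i) r \<le> P i" if i: "i \<in> Basis" for i
      unfolding bint_def P_def
      by (intro integral_mono bint_integrable[OF Dg[OF i]] iP[OF i] mult_right_mono cf(4)) auto
    show "bsq x0 g r \<le> S"
      unfolding bint_def S_def
      by (intro integral_mono bint_integrable[OF g] iS mult_right_mono cf(4)) auto
    show "bint x0 (\<lambda>x. cmod (g x) powr (1 + m)) r \<le> Q"
      unfolding bint_def Q_def
      by (intro integral_mono L2z_powr_integrable[OF g U(1,2) m ball_indicator_measurable, of _ _ 1]
          L2z_powr_integrable[OF g U(1,2) m k2] mult_right_mono cf(4)) (auto simp: indicator_def)
  qed
  have upV: "V \<le> ?G"
    using weighted_le_bint[OF G k2(1), of 1 x0 s] cf(5) by (simp add: V_def)
  define I2 where "I2 = bsq x0 g s"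
  define ID where "ID = (\<Sum>i\<in>Basis. bsq x0 (Dg i) s)"
  have upA: "A i \<le> (C / (s - r))\<^sup>2 * I2" if i: "i \<in> Basis" for i
    unfolding A_def I2_def by (intro weighted_le_bint[OF g f2] cf(8) i) simp
  have upB: "B i \<le> (C / (s - r))\<^sup>2 * bsq x0 (Dg i) s" if i: "i \<in> Basis" for i
    unfolding B_def by (intro weighted_le_bint[OF Dg[OF i] f2] cf(8) i) simp
  have G0: "?G \<ge> 0" "I2 \<ge> 0" "ID \<ge> 0" unfolding I2_def ID_def bint_def by (auto intro!: sum_nonneg integral_nonneg_AE)
  have K2: "K\<^sup>2 \<ge> 0" by simp
  \<comment> \<open>One M serves both estimates: 8 N K^2 is what the second one needs after
    doubling, and in 1 + C^2 the 1 covers the term with G while C^2 covers the cutoff.\<close>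
  have fin: "M * (?G + y / (s - r)\<^sup>2) \<ge> 2 * K\<^sup>2 * ?G + 8 * N * K\<^sup>2 * ((C / (s - r))\<^sup>2 * y)" if y: "y \<ge> 0" for y
  proof -
    have "2 * K\<^sup>2 * ?G \<le> M * ?G"
    proof (rule mult_right_mono[OF _ G0(1)])
      have "K\<^sup>2 * 1 \<le> K\<^sup>2 * (N * (1 + C\<^sup>2))"
      proof (rule mult_left_mono)
        have "1 * 1 \<le> N * (1 + C\<^sup>2)" using N by (intro mult_mono) auto
        then show "1 \<le> N * (1 + C\<^sup>2)" by simp
      qed simp
      moreover have "M = 8 * (K\<^sup>2 * (N * (1 + C\<^sup>2)))" by (simp add: M N_def mult_ac)
      ultimately show "2 * K\<^sup>2 \<le> M" using K2 by linarith
    qed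
    moreover have "8 * N * K\<^sup>2 * ((C / (s - r))\<^sup>2 * y) \<le> M * (y / (s - r)\<^sup>2)"
    proof -
      have "8 * N * K\<^sup>2 * C\<^sup>2 * (y / (s - r)\<^sup>2) \<le> M * (y / (s - r)\<^sup>2)"
        unfolding M N_def[symmetric] using N y by (intro mult_right_mono mult_left_mono) (auto simp: algebra_simps)
      then show ?thesis by (simp add: power_divide mult.assoc)
    qed
    ultimately show ?thesis by (simp add: distrib_left)
  qed
  show "?L \<le> M * (?G + ?A)"
  proof -
    have "(\<Sum>i\<in>Basis. P i) + Q + S \<le> (S / 4 + K\<^sup>2 * V) + (\<Sum>i\<in>Basis. P i / 2 + 2 * K\<^sup>2 * A i)"
    proof -
      have "K * (\<Sum>i\<in>Basis. LINT x|lebesgue. \<bar>2 * \<kappa> x * fd \<kappa> i x\<bar> * (cmod (Dg i x) * cmod (g x))) \<le> (\<Sum>i\<in>Basis. P i / 2 + 2 * K\<^sup>2 * A i)"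
        unfolding sum_distrib_left by (rule sum_mono) (rule xbound)
      then show ?thesis using main gbound unfolding distrib_left by linarith
    qed
    also have "(\<Sum>i\<in>Basis. P i / 2 + 2 * K\<^sup>2 * A i) \<le> (\<Sum>i\<in>Basis. P i / 2 + 2 * K\<^sup>2 * ((C / (s - r))\<^sup>2 * I2))"
      by (intro sum_mono add_left_mono mult_left_mono upA) auto
    also have "\<dots> = (\<Sum>i\<in>Basis. P i) / 2 + 2 * N * K\<^sup>2 * ((C / (s - r))\<^sup>2 * I2)"
      by (simp add: sum.distrib sum_divide_distrib N_def)
    finally have "(\<Sum>i\<in>Basis. P i) + Q + S \<le> 2 * K\<^sup>2 * V + 4 * N * K\<^sup>2 * ((C / (s - r))\<^sup>2 * I2)"
      using nonneg by simp
    also have "\<dots> \<le> 2 * K\<^sup>2 * ?G + 8 * N * K\<^sup>2 * ((C / (s - r))\<^sup>2 * I2)"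
      using upV N G0 by (intro add_mono mult_left_mono mult_right_mono) auto
    also have "\<dots> \<le> M * (?G + I2 / (s - r)\<^sup>2)" by (rule fin[OF G0(2)])
    finally show ?thesis using low unfolding I2_def by linarith
  qed
  show "?L \<le> M * (?G + ?B)"
  proof -
    have "(\<Sum>i\<in>Basis. P i) + Q + S \<le> (S / 4 + K\<^sup>2 * V) + (\<Sum>i\<in>Basis. S / (4 * N) + 4 * N * K\<^sup>2 * B i)"
    proof -
      have "K * (\<Sum>i\<in>Basis. LINT x|lebesgue. \<bar>2 * \<kappa> x * fd \<kappa> i x\<bar> * (cmod (Dg i x) * cmod (g x))) \<le> (\<Sum>i\<in>Basis. S / (4 * N) + 4 * N * K\<^sup>2 * B i)"
        unfolding sum_distrib_left by (rule sum_mono) (rule xbound2)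
      then show ?thesis using main gbound unfolding distrib_left by linarith
    qed
    also have "(\<Sum>i\<in>Basis. S / (4 * N) + 4 * N * K\<^sup>2 * B i)
        \<le> (\<Sum>i\<in>Basis. S / (4 * N) + 4 * N * K\<^sup>2 * ((C / (s - r))\<^sup>2 * bsq x0 (Dg i) s))"
      using N by (intro sum_mono add_left_mono mult_left_mono upB) auto
    also have "\<dots> = S / 4 + 4 * N * K\<^sup>2 * ((C / (s - r))\<^sup>2 * ID)"
      using N by (simp add: sum.distrib N_def[symmetric] ID_def sum_distrib_left)
    finally have "(\<Sum>i\<in>Basis. P i) + Q + S \<le> 2 * K\<^sup>2 * V + 8 * N * K\<^sup>2 * ((C / (s - r))\<^sup>2 * ID)"
      using nonneg sum_nonneg[of Basis P] by simp
    also have "\<dots> \<le> 2 * K\<^sup>2 * ?G + 8 * N * K\<^sup>2 * ((C / (s - r))\<^sup>2 * ID)"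
      using upV N G0 by (intro add_mono mult_left_mono) auto
    also have "\<dots> \<le> M * (?G + ID / (s - r)\<^sup>2)" by (rule fin[OF G0(3)])
    finally show ?thesis using low unfolding ID_def by linarith
  qed
qed

section \<open>Iteration on shrinking balls\<close>

lemma sqn_le_bint:
  fixes f :: "'a::euclidean_space \<Rightarrow> complex"
  assumes f: "L2z U f" and w: "w \<in> borel_measurable lebesgue" "\<And>x. (w x)\<^sup>2 \<le> B * indicat_real (ball x0 s) x" "B \<ge> 0"
  shows "sqn (\<lambda>x. w x *\<^sub>R f x) \<le> ennreal (B * bsq x0 f s)"
proof -
  have "sqn (\<lambda>x. w x *\<^sub>R f x) \<le> (\<integral>\<^sup>+x. ennreal (B * (indicat_real (ball x0 s) x * (cmod (f x))\<^sup>2)) \<partial>lebesgue)"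
    unfolding sqn_def
  proof (rule nn_integral_mono)
    fix x
    show "ennreal ((norm (w x *\<^sub>R f x))\<^sup>2) \<le> ennreal (B * (indicat_real (ball x0 s) x * (cmod (f x))\<^sup>2))"
      using mult_right_mono[OF w(2)[of x], of "(cmod (f x))\<^sup>2"]
      by (intro ennreal_leI) (simp add: power_mult_distrib mult.assoc)
  qed
  also have "\<dots> = ennreal (LINT x|lebesgue. B * (indicat_real (ball x0 s) x * (cmod (f x))\<^sup>2))"
    using bint_integrable[OF f] w(3) by (intro nn_integral_eq_integral integrable_mult_right) auto
  finally show ?thesis by (simp add: bint_def)
qed

text \<open>\<open>H10c_interpolation\<close> for \<kappa> g with q = 1 + m. Since V is proportional
  to l^N, the term \<tau>^(1-m) Y becomes a multiple of (Y / l^N)^((1-m)/(1+m)) Y, superlinear in Y.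
  M is the sum of the two resulting constants.\<close>

lemma interpolation_local:
  fixes g :: "'a::euclidean_space \<Rightarrow> complex" and \<kappa> :: "'a \<Rightarrow> real"
  assumes U: "open U" "bounded U" and m: "0 < m" "m < 1"
    and g: "L2z U g" and Dg: "\<And>i. i \<in> Basis \<Longrightarrow> L2z U (Dg i)"
    and Hc: "H10c U (\<lambda>x. \<kappa> x *\<^sub>R g x) (\<lambda>i x. \<kappa> x *\<^sub>R Dg i x + fd \<kappa> i x *\<^sub>R g x)"
    and \<kappa>: "cutoff C x0 r s \<kappa>" and rs: "r < s" and C: "C > 0" and l: "l > 0" and Y: "Y > 0"
    and IY: "bint x0 (\<lambda>x. cmod (g x) powr (1 + m)) s \<le> Y"
    and M: "M = 64 * (real DIM('a))\<^sup>2 * (1 + C\<^sup>2) + 18 * (4 powr (1 - m) * (9 / unit_ball_vol (real DIM('a))) powr ((1 - m) / (1 + m)))"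
  shows "bsq x0 g r \<le> M * (l\<^sup>2 * ((\<Sum>i\<in>Basis. bsq x0 (Dg i) s)
      + bsq x0 g s / (s - r)\<^sup>2) + (Y / l ^ DIM('a)) powr ((1 - m) / (1 + m)) * Y)"
proof -
  note cf = cutoff_facts[OF \<kappa> rs]
  have m\<kappa>: "\<kappa> \<in> borel_measurable lebesgue" "\<And>i. fd \<kappa> i \<in> borel_measurable lebesgue"
    using kernel_lebesgue[OF cf(1)] kernel_lebesgue[OF kernel_derivative[OF cf(1)]] by auto
  define N where "N = real DIM('a)"
  have N: "N \<ge> 1" unfolding N_def using DIM_positive[where 'a = 'a] by linarith
  let ?D = "\<lambda>i. bsq x0 (Dg i) s"
  define ID where "ID = (\<Sum>i\<in>Basis. ?D i)"
  define I2 where "I2 = bsq x0 g s"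
  have nn: "?D i \<ge> 0" "I2 \<ge> 0" "ID \<ge> 0" for i
    unfolding I2_def ID_def bint_def by (auto intro!: sum_nonneg integral_nonneg_AE)
  let ?u = "\<lambda>x. \<kappa> x *\<^sub>R g x"
  define V where "V = measure lborel (ball (0::'a) l)"
  have V: "V = unit_ball_vol N * l ^ DIM('a)"
    unfolding V_def N_def using l by (simp add: content_ball)
  have v0: "unit_ball_vol N > 0" using N by simp
  define \<tau> where "\<tau> = (9 * Y / V) powr (1 / (1 + m))"
  have uq: "(\<integral>\<^sup>+x. ennreal (norm (?u x) powr (1 + m)) \<partial>lebesgue) \<le> ennreal Y"
  proof -
    have "(\<integral>\<^sup>+x. ennreal (norm (?u x) powr (1 + m)) \<partial>lebesgue)
        \<le> (\<integral>\<^sup>+x. ennreal (indicat_real (ball x0 s) x * cmod (g x) powr (1 + m)) \<partial>lebesgue)"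
    proof (intro nn_integral_mono ennreal_leI)
      fix x
      show "norm (?u x) powr (1 + m) \<le> indicat_real (ball x0 s) x * cmod (g x) powr (1 + m)"
      proof (cases "x \<in> ball x0 s")
        case True
        have "norm (?u x) \<le> cmod (g x)" using cf(6,7)[of x] by (simp add: mult_left_le_one_le)
        then show ?thesis using True m by (simp add: powr_mono2 del: norm_scaleR mem_ball)
      next
        case False
        then have "(\<kappa> x)\<^sup>2 \<le> 0" using cf(5)[of x] by (simp del: mem_ball)
        then have "\<kappa> x = 0" by simp
        then show ?thesis by simp
      qed
    qed
    also have "\<dots> = ennreal (bint x0 (\<lambda>x. cmod (g x) powr (1 + m)) s)"
      unfolding bint_def
      by (intro nn_integral_eq_integral L2z_powr_integrable[OF g U m ball_indicator_measurable, of _ _ 1])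
        (auto simp: indicator_def)
    also have "\<dots> \<le> ennreal Y" using IY by (rule ennreal_leI)
    finally show ?thesis .
  qed
  have "(\<Sum>i\<in>Basis. sqn (\<lambda>x. \<kappa> x *\<^sub>R Dg i x + fd \<kappa> i x *\<^sub>R g x)) \<le> (\<Sum>i\<in>Basis. ennreal (2 * ?D i + 2 * ((C / (s - r))\<^sup>2 * I2)))"
  proof (rule sum_mono)
    fix i :: 'a assume i: "i \<in> Basis"
    have "sqn (\<lambda>x. \<kappa> x *\<^sub>R Dg i x + fd \<kappa> i x *\<^sub>R g x) \<le> 2 * sqn (\<lambda>x. \<kappa> x *\<^sub>R Dg i x) + 2 * sqn (\<lambda>x. fd \<kappa> i x *\<^sub>R g x)"
      using g Dg[OF i] m\<kappa> by (intro sqn_add borel_measurable_scaleR) (auto simp: L2z_def)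
    also have "\<dots> \<le> 2 * ennreal (1 * ?D i) + 2 * ennreal ((C / (s - r))\<^sup>2 * I2)"
      unfolding I2_def using cf(5) cf(8)[OF i]
      by (intro add_mono mult_left_mono sqn_le_bint[OF Dg[OF i] m\<kappa>(1)] sqn_le_bint[OF g m\<kappa>(2)]) auto
    also have "\<dots> = ennreal (2 * ?D i + 2 * ((C / (s - r))\<^sup>2 * I2))"
      using nn(1)[of i] nn(2) by (simp add: ennreal_mult)
    finally show "sqn (\<lambda>x. \<kappa> x *\<^sub>R Dg i x + fd \<kappa> i x *\<^sub>R g x) \<le> ennreal (2 * ?D i + 2 * ((C / (s - r))\<^sup>2 * I2))" .
  qed
  also have "(\<Sum>i\<in>Basis. ennreal (2 * ?D i + 2 * ((C / (s - r))\<^sup>2 * I2))) = ennreal (2 * ID + 2 * N * ((C / (s - r))\<^sup>2 * I2))"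
    using nn by (subst sum_ennreal) (auto simp: sum.distrib ID_def N_def sum_distrib_left mult_ac)
  finally have s1: "(\<Sum>i\<in>Basis. sqn (\<lambda>x. \<kappa> x *\<^sub>R Dg i x + fd \<kappa> i x *\<^sub>R g x)) \<le> ennreal (2 * ID + 2 * N * ((C / (s - r))\<^sup>2 * I2))" .
  have "ennreal (bsq x0 g r) = (\<integral>\<^sup>+x. ennreal (indicat_real (ball x0 r) x * (cmod (g x))\<^sup>2) \<partial>lebesgue)"
    unfolding bint_def using bint_integrable[OF g] by (intro nn_integral_eq_integral[symmetric]) auto
  also have "\<dots> \<le> sqn ?u"
    unfolding sqn_def
  proof (intro nn_integral_mono ennreal_leI)
    fix x
    show "indicat_real (ball x0 r) x * (cmod (g x))\<^sup>2 \<le> (norm (?u x))\<^sup>2"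
      using mult_right_mono[OF cf(4)[of x], of "(cmod (g x))\<^sup>2"] by (simp add: power_mult_distrib)
  qed
  also have "sqn ?u \<le> ennreal (32 * l\<^sup>2 * N) * (\<Sum>i\<in>Basis. sqn (\<lambda>x. \<kappa> x *\<^sub>R Dg i x + fd \<kappa> i x *\<^sub>R g x))
      + ennreal (2 * ((4 * \<tau>) powr (2 - (1 + m)) * (9 * Y)))"
    unfolding N_def using m by (intro H10c_interpolation[OF Hc U _ _ l Y uq V_def]) (auto simp: \<tau>_def)
  also have "\<dots> \<le> ennreal (32 * l\<^sup>2 * N) * ennreal (2 * ID + 2 * N * ((C / (s - r))\<^sup>2 * I2)) + ennreal (2 * ((4 * \<tau>) powr (2 - (1 + m)) * (9 * Y)))"
    by (intro add_right_mono mult_left_mono s1) auto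
  also have "\<dots> = ennreal (32 * l\<^sup>2 * N * (2 * ID + 2 * N * ((C / (s - r))\<^sup>2 * I2)) + 2 * ((4 * \<tau>) powr (2 - (1 + m)) * (9 * Y)))"
    using nn N Y by (simp add: ennreal_mult ennreal_plus)
  finally have h1: "bsq x0 g r \<le> 32 * l\<^sup>2 * N * (2 * ID + 2 * N * ((C / (s - r))\<^sup>2 * I2)) + 2 * ((4 * \<tau>) powr (2 - (1 + m)) * (9 * Y))"
    using nn N Y by (subst (asm) ennreal_le_iff) auto
  have h2: "32 * l\<^sup>2 * N * (2 * ID + 2 * N * ((C / (s - r))\<^sup>2 * I2)) \<le> 64 * N\<^sup>2 * (1 + C\<^sup>2) * (l\<^sup>2 * (ID + I2 / (s - r)\<^sup>2))"
  proof -
    have "ID \<le> N * (1 + C\<^sup>2) * ID"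
    proof -
      have "1 * 1 \<le> N * (1 + C\<^sup>2)" using N by (intro mult_mono) auto
      from mult_right_mono[OF this nn(3)] show ?thesis by simp
    qed
    moreover have "N * ((C / (s - r))\<^sup>2 * I2) \<le> N * (1 + C\<^sup>2) * (I2 / (s - r)\<^sup>2)"
    proof -
      have "C\<^sup>2 * (I2 / (s - r)\<^sup>2) \<le> (1 + C\<^sup>2) * (I2 / (s - r)\<^sup>2)"
        using nn by (intro mult_right_mono) auto
      from mult_left_mono[OF this, of N] show ?thesis
        using N by (simp add: power_divide mult.assoc)
    qed
    ultimately have "ID + N * ((C / (s - r))\<^sup>2 * I2) \<le> N * (1 + C\<^sup>2) * (ID + I2 / (s - r)\<^sup>2)"
      unfolding distrib_left[of "N * (1 + C\<^sup>2)"] by linarith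
    then have "64 * l\<^sup>2 * N * (ID + N * ((C / (s - r))\<^sup>2 * I2)) \<le> 64 * l\<^sup>2 * N * (N * (1 + C\<^sup>2) * (ID + I2 / (s - r)\<^sup>2))"
      using N by (intro mult_left_mono) auto
    moreover have "32 * l\<^sup>2 * N * (2 * ID + 2 * N * z) = 64 * l\<^sup>2 * N * (ID + N * z)" for z
      by (simp add: algebra_simps)
    moreover have "64 * l\<^sup>2 * N * (N * (1 + C\<^sup>2) * z) = 64 * N\<^sup>2 * (1 + C\<^sup>2) * (l\<^sup>2 * z)" for z
      by (simp add: power2_eq_square mult_ac)
    ultimately show ?thesis by (simp only:)
  qed
  have h3: "2 * ((4 * \<tau>) powr (2 - (1 + m)) * (9 * Y))
      = 18 * (4 powr (1 - m) * (9 / unit_ball_vol N) powr ((1 - m) / (1 + m))) * ((Y / l ^ DIM('a)) powr ((1 - m) / (1 + m)) * Y)"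
  proof -
    have "\<tau> powr (1 - m) = ((9 / unit_ball_vol N) * (Y / l ^ DIM('a))) powr ((1 - m) / (1 + m))"
      by (simp add: \<tau>_def powr_powr V)
    also have "\<dots> = (9 / unit_ball_vol N) powr ((1 - m) / (1 + m)) * (Y / l ^ DIM('a)) powr ((1 - m) / (1 + m))"
      by (rule powr_mult)
    finally have "(4 * \<tau>) powr (1 - m) = 4 powr (1 - m) * ((9 / unit_ball_vol N) powr ((1 - m) / (1 + m)) * (Y / l ^ DIM('a)) powr ((1 - m) / (1 + m)))"
      by (simp add: powr_mult \<tau>_def)
    then show ?thesis by (simp add: mult_ac)
  qed
  let ?a = "64 * N\<^sup>2 * (1 + C\<^sup>2)" and ?b = "18 * (4 powr (1 - m) * (9 / unit_ball_vol N) powr ((1 - m) / (1 + m)))"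
  let ?X = "l\<^sup>2 * (ID + I2 / (s - r)\<^sup>2)" and ?Z = "(Y / l ^ DIM('a)) powr ((1 - m) / (1 + m)) * Y"
  have "bsq x0 g r \<le> ?a * ?X + ?b * ?Z"
    using h1 h2 h3 by linarith
  also have "\<dots> \<le> (?a + ?b) * (?X + ?Z)"
  proof -
    have "0 \<le> ?a * ?Z" "0 \<le> ?b * ?X" using nn Y by auto
    then show ?thesis by (simp only: distrib_left distrib_right)
  qed
  finally show ?thesis
    unfolding M N_def[symmetric] ID_def I2_def .
qed

text \<open>The iteration concerns functions of the radius only: \<open>ID\<close>,
  \<open>Iq\<close>, \<open>I2\<close> and \<open>IG\<close> stand for the integrals over a ball of
  the squared gradient, |g|^(1+m), |g|^2 and |G|^2. Quantifying E and \<epsilon> before them makes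
  the thresholds independent of the solution.\<close>

lemma energy_iteration:
  fixes m M \<rho>\<^sub>0 r1 :: real and n :: nat
  assumes m: "0 < m" "m < 1" and M: "M \<ge> 1" and \<rho>: "0 < \<rho>\<^sub>0" "\<rho>\<^sub>0 < r1" and p: "p = (2 * (1 + m) + real n * (1 - m)) / (1 - m)"
  shows "\<exists>E>0. \<exists>\<epsilon>>0. \<forall>ID Iq I2 IG :: real \<Rightarrow> real.
    (\<forall>r. 0 \<le> ID r \<and> 0 \<le> Iq r \<and> 0 \<le> I2 r \<and> 0 \<le> IG r) \<longrightarrow>
    (\<forall>r s. r \<le> s \<longrightarrow> ID r \<le> ID s \<and> I2 r \<le> I2 s) \<longrightarrow>
    (\<forall>r s. 0 < r \<and> r < s \<and> s < r1 \<longrightarrow> ID r + Iq r + I2 r \<le> M * (IG s + I2 s / (s - r)\<^sup>2)) \<longrightarrow>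
    (\<forall>r s. 0 < r \<and> r < s \<and> s < r1 \<longrightarrow> ID r + Iq r + I2 r \<le> M * (IG s + ID s / (s - r)\<^sup>2)) \<longrightarrow>
    (\<forall>r s l Y. 0 < r \<and> r < s \<and> s < r1 \<and> 0 < l \<and> 0 < Y \<and> Iq s \<le> Y \<longrightarrow>
       I2 r \<le> M * (l\<^sup>2 * (ID s + I2 s / (s - r)\<^sup>2) + (Y / l ^ n) powr ((1 - m) / (1 + m)) * Y)) \<longrightarrow>
    (\<forall>s. 0 < s \<and> s < r1 \<longrightarrow> ID s \<le> E \<and> IG s \<le> \<epsilon> * (max 0 (s - \<rho>\<^sub>0)) powr p) \<longrightarrow> I2 \<rho>\<^sub>0 \<le> 0"
proof -
  define \<theta> where "\<theta> = (1 - m) / (1 + m)"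
  have \<theta>: "\<theta> > 0" using m by (simp add: \<theta>_def)
  \<comment> \<open>The identity behind p: for Y = A h^p and l = L h, the factor (Y / l^n)^\<theta>
    is a constant times h^2.\<close>
  have pn: "(p - real n) * \<theta> = 2"
  proof -
    have "p - real n = 2 * (1 + m) / (1 - m)" using m by (simp add: p field_simps)
    then show ?thesis using m by (simp add: \<theta>_def field_simps)
  qed
  have p0: "p > 0" unfolding p using m by (intro divide_pos_pos add_pos_nonneg) auto
  \<comment> \<open>Read off from the induction step, where the interpolation terms add up to 40 c
    M^2 Y. This choice makes them half of 2^-p Y; the other half is reserved for G.\<close>
  define c where "c = 2 powr (- p) / (80 * M\<^sup>2)"
  have c: "c > 0" using M by (simp add: c_def)
  \<comment> \<open>The gradient part of the interpolation carries a factor 16 from the gap h / 4.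
    This L turns it into c h^2 Y, and A below is chosen to give the superlinear part the same
    value.\<close>
  define L where "L = sqrt (c / 16)"
  have L: "L > 0" "16 * L\<^sup>2 = c" using c by (auto simp: L_def)
  define A where "A = L ^ n * c powr (1 / \<theta>)"
  have A: "A > 0" using L c by (simp add: A_def)
  have A\<theta>: "(A / L ^ n) powr \<theta> = c"
    using L c \<theta> by (simp add: A_def powr_powr)
  \<comment> \<open>The iteration starts at radius \<open>\<rho>\<^sub>0 + d\<close>, halfway to
    \<open>r1\<close>, which leaves room for the first energy estimate.\<close>
  define d where "d = (r1 - \<rho>\<^sub>0) / 2"
  have d: "d > 0" "\<rho>\<^sub>0 + 2 * d = r1" using \<rho> by (auto simp: d_def field_simps)
  define B where "B = (1 + 1 / d\<^sup>2) * M"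
  have B: "B > 0" using M d by (simp add: B_def add_pos_nonneg)
  \<comment> \<open>The first bound is for the induction step, the second for the start. In both G
    takes half of the target, and E is set so that at the start the gradient takes the other
    half.\<close>
  define \<epsilon> where "\<epsilon> = min (A * 2 powr (- p) / (2 * M)) (A * 2 powr (- p) / (2 * B))"
  define E where "E = A * d powr p * d\<^sup>2 / (8 * B)"
  have \<epsilon>: "\<epsilon> > 0" "M * \<epsilon> \<le> A * 2 powr (- p) / 2" "B * \<epsilon> \<le> A * 2 powr (- p) / 2"
  proof -
    show "\<epsilon> > 0" using A M B by (simp add: \<epsilon>_def)
    have "M * \<epsilon> \<le> M * (A * 2 powr (- p) / (2 * M))" using M by (intro mult_left_mono) (auto simp: \<epsilon>_def)
    then show "M * \<epsilon> \<le> A * 2 powr (- p) / 2" using M by simp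
    have "B * \<epsilon> \<le> B * (A * 2 powr (- p) / (2 * B))" using B by (intro mult_left_mono) (auto simp: \<epsilon>_def)
    then show "B * \<epsilon> \<le> A * 2 powr (- p) / 2" using B by simp
  qed
  have E: "E > 0" "B * (4 * E / d\<^sup>2) = A * d powr p / 2"
    using A d B by (auto simp: E_def field_simps)
  show ?thesis
  proof (rule exI[of _ E], rule conjI[OF E(1)], rule exI[of _ \<epsilon>], rule conjI[OF \<epsilon>(1)], intro allI impI)
    fix ID Iq I2 IG :: "real \<Rightarrow> real"
    assume nn: "\<forall>r. 0 \<le> ID r \<and> 0 \<le> Iq r \<and> 0 \<le> I2 r \<and> 0 \<le> IG r"
      and mono: "\<forall>r s. r \<le> s \<longrightarrow> ID r \<le> ID s \<and> I2 r \<le> I2 s"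
      and Ea: "\<forall>r s. 0 < r \<and> r < s \<and> s < r1 \<longrightarrow> ID r + Iq r + I2 r \<le> M * (IG s + I2 s / (s - r)\<^sup>2)"
      and Eb: "\<forall>r s. 0 < r \<and> r < s \<and> s < r1 \<longrightarrow> ID r + Iq r + I2 r \<le> M * (IG s + ID s / (s - r)\<^sup>2)"
      and GN: "\<forall>r s l Y. 0 < r \<and> r < s \<and> s < r1 \<and> 0 < l \<and> 0 < Y \<and> Iq s \<le> Y \<longrightarrow>
       I2 r \<le> M * (l\<^sup>2 * (ID s + I2 s / (s - r)\<^sup>2) + (Y / l ^ n) powr ((1 - m) / (1 + m)) * Y)"
      and sm: "\<forall>s. 0 < s \<and> s < r1 \<longrightarrow> ID s \<le> E \<and> IG s \<le> \<epsilon> * (max 0 (s - \<rho>\<^sub>0)) powr p"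
    \<comment> \<open>A cutoff over a gap of order h costs h^-2, so |g|^2 enters with this weight;
      the bound by A h^p then reproduces itself with no power of h left over.\<close>
    define T where "T h = ID (\<rho>\<^sub>0 + h) + Iq (\<rho>\<^sub>0 + h) + I2 (\<rho>\<^sub>0 + h) / h\<^sup>2" for h
    \<comment> \<open>From \<open>\<rho>\<^sub>0 + 3 / 2 * d\<close> down to
      \<open>\<rho>\<^sub>0 + d\<close> by \<open>Eb\<close>, whose right side has only the gradient
      and G: no smallness of |g|^2 is assumed.\<close>
    have start: "T d \<le> A * d powr p"
    proof -
      let ?s = "\<rho>\<^sub>0 + 3 / 2 * d"
      have sr: "0 < ?s" "?s < r1" using d \<rho> by auto
      have b: "ID (\<rho>\<^sub>0 + d) + Iq (\<rho>\<^sub>0 + d) + I2 (\<rho>\<^sub>0 + d) \<le> M * (IG ?s + ID ?s / (?s - (\<rho>\<^sub>0 + d))\<^sup>2)"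
        using d \<rho> by (intro Eb[rule_format]) auto
      have IGs: "IG ?s \<le> \<epsilon> * (2 * d) powr p"
      proof -
        have "IG ?s \<le> \<epsilon> * (max 0 (?s - \<rho>\<^sub>0)) powr p" using sm sr by blast
        also have "\<dots> \<le> \<epsilon> * (2 * d) powr p"
          using \<epsilon>(1) p0 d by (intro mult_left_mono powr_mono2) auto
        finally show ?thesis .
      qed
      have IDs: "ID ?s / (?s - (\<rho>\<^sub>0 + d))\<^sup>2 \<le> 4 * E / d\<^sup>2"
      proof -
        have "?s - (\<rho>\<^sub>0 + d) = d / 2" by simp
        moreover have "ID ?s \<le> E" using sm sr by blast
        ultimately show ?thesis by (simp add: divide_right_mono power_divide mult.commute)
      qed
      have "M * (IG ?s + ID ?s / (?s - (\<rho>\<^sub>0 + d))\<^sup>2) \<le> M * (\<epsilon> * (2 * d) powr p + 4 * E / d\<^sup>2)"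
        using M by (intro mult_left_mono add_mono IGs IDs) auto
      with b have X: "ID (\<rho>\<^sub>0 + d) + Iq (\<rho>\<^sub>0 + d) + I2 (\<rho>\<^sub>0 + d) \<le> M * (\<epsilon> * (2 * d) powr p + 4 * E / d\<^sup>2)"
        by (rule order_trans)
      have "T d \<le> (1 + 1 / d\<^sup>2) * (ID (\<rho>\<^sub>0 + d) + Iq (\<rho>\<^sub>0 + d) + I2 (\<rho>\<^sub>0 + d))"
        using nn by (simp add: T_def distrib_right distrib_left add_divide_distrib)
      also have "\<dots> \<le> (1 + 1 / d\<^sup>2) * (M * (\<epsilon> * (2 * d) powr p + 4 * E / d\<^sup>2))"
        using X by (intro mult_left_mono) auto
      also have "\<dots> = B * \<epsilon> * (2 * d) powr p + B * (4 * E / d\<^sup>2)"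
        unfolding B_def by (simp add: algebra_simps)
      also have "\<dots> \<le> A * 2 powr (- p) / 2 * (2 * d) powr p + A * d powr p / 2"
        unfolding E(2) using \<epsilon>(3) by (intro add_mono mult_right_mono) auto
      also have "A * 2 powr (- p) / 2 * (2 * d) powr p = A * d powr p / 2"
        using d by (simp add: powr_mult powr_minus)
      finally show ?thesis by simp
    qed
    have step: "T (h / 2) \<le> A * (h / 2) powr p" if h: "0 < h" "h \<le> d" and Th: "T h \<le> A * h powr p" for h
    proof -
      \<comment> \<open>Two moves of length h / 4: interpolation from
        \<open>\<rho>\<^sub>0 + h\<close> down to \<sigma>, where it bounds |g|^2, then the energy
        estimate from \<sigma> down to \<open>\<rho>\<^sub>0 + h / 2\<close>.\<close>
      define \<sigma> where "\<sigma> = \<rho>\<^sub>0 + 3 / 4 * h"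
      define Y where "Y = A * h powr p"
      have Y: "Y > 0" using A h by (simp add: Y_def)
      have hr: "\<rho>\<^sub>0 + h < r1" using h d by linarith
      have \<sigma>r: "0 < \<sigma>" "\<sigma> < r1" using h \<rho> hr by (auto simp: \<sigma>_def)
      have q1: "Iq (\<rho>\<^sub>0 + h) \<le> Y" "ID (\<rho>\<^sub>0 + h) + I2 (\<rho>\<^sub>0 + h) / h\<^sup>2 \<le> Y"
        using Th nn zero_le_divide_iff[of "I2 (\<rho>\<^sub>0 + h)" "h\<^sup>2"] unfolding T_def Y_def
        by (smt (verit) zero_le_power2)+
      have "I2 \<sigma> \<le> M * ((L * h)\<^sup>2 * (ID (\<rho>\<^sub>0 + h) + I2 (\<rho>\<^sub>0 + h) / (\<rho>\<^sub>0 + h - \<sigma>)\<^sup>2) + (Y / (L * h) ^ n) powr \<theta> * Y)"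
        unfolding \<theta>_def using h \<rho> hr L Y q1 by (intro GN[rule_format]) (auto simp: \<sigma>_def)
      also have "\<dots> \<le> M * (16 * (L * h)\<^sup>2 * Y + c * h\<^sup>2 * Y)"
      proof (intro mult_left_mono add_mono)
        have hs: "\<rho>\<^sub>0 + h - \<sigma> = h / 4" by (simp add: \<sigma>_def)
        have "ID (\<rho>\<^sub>0 + h) + I2 (\<rho>\<^sub>0 + h) / (\<rho>\<^sub>0 + h - \<sigma>)\<^sup>2 = ID (\<rho>\<^sub>0 + h) + 16 * (I2 (\<rho>\<^sub>0 + h) / h\<^sup>2)"
          unfolding hs by (simp add: power_divide)
        also have "\<dots> \<le> 16 * (ID (\<rho>\<^sub>0 + h) + I2 (\<rho>\<^sub>0 + h) / h\<^sup>2)" using nn by simp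
        also have "\<dots> \<le> 16 * Y" using q1 by simp
        finally have "ID (\<rho>\<^sub>0 + h) + I2 (\<rho>\<^sub>0 + h) / (\<rho>\<^sub>0 + h - \<sigma>)\<^sup>2 \<le> 16 * Y" .
        from mult_left_mono[OF this, of "(L * h)\<^sup>2"]
        show "(L * h)\<^sup>2 * (ID (\<rho>\<^sub>0 + h) + I2 (\<rho>\<^sub>0 + h) / (\<rho>\<^sub>0 + h - \<sigma>)\<^sup>2) \<le> 16 * (L * h)\<^sup>2 * Y"
          by (simp add: mult_ac)
        have Yl: "Y / (L * h) ^ n = (A / L ^ n) * h powr (p - real n)"
          using h L by (simp add: Y_def power_mult_distrib powr_diff powr_realpow)
        have "(Y / (L * h) ^ n) powr \<theta> = (A / L ^ n) powr \<theta> * (h powr (p - real n)) powr \<theta>"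
          unfolding Yl by (rule powr_mult)
        also have "(h powr (p - real n)) powr \<theta> = h\<^sup>2"
          using h by (simp add: powr_powr pn powr_numeral)
        finally show "(Y / (L * h) ^ n) powr \<theta> * Y \<le> c * h\<^sup>2 * Y" by (simp add: A\<theta>)
      qed (use M in auto)
      also have "\<dots> = M * ((16 * L\<^sup>2 + c) * h\<^sup>2 * Y)" by (simp add: power_mult_distrib algebra_simps)
      finally have I\<sigma>: "I2 \<sigma> \<le> 2 * c * M * Y * h\<^sup>2" unfolding L(2) by (simp add: algebra_simps)
      then have I\<sigma>': "I2 \<sigma> / h\<^sup>2 \<le> 2 * c * M * Y" using h by (simp add: divide_le_eq)
      have e1: "ID (\<rho>\<^sub>0 + h / 2) + Iq (\<rho>\<^sub>0 + h / 2) + I2 (\<rho>\<^sub>0 + h / 2) \<le> M * (\<epsilon> * h powr p + 16 * (2 * c * M * Y))"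
      proof -
        have "ID (\<rho>\<^sub>0 + h / 2) + Iq (\<rho>\<^sub>0 + h / 2) + I2 (\<rho>\<^sub>0 + h / 2)
          \<le> M * (IG \<sigma> + I2 \<sigma> / (\<sigma> - (\<rho>\<^sub>0 + h / 2))\<^sup>2)"
          using h \<rho> hr by (intro Ea[rule_format]) (auto simp: \<sigma>_def)
        also have "\<sigma> - (\<rho>\<^sub>0 + h / 2) = h / 4" by (simp add: \<sigma>_def)
        also have "I2 \<sigma> / (h / 4)\<^sup>2 = 16 * (I2 \<sigma> / h\<^sup>2)" by (simp add: power_divide)
        also have "M * (IG \<sigma> + 16 * (I2 \<sigma> / h\<^sup>2)) \<le> M * (\<epsilon> * h powr p + 16 * (2 * c * M * Y))"
        proof (intro mult_left_mono add_mono I\<sigma>')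
          have "IG \<sigma> \<le> \<epsilon> * (max 0 (\<sigma> - \<rho>\<^sub>0)) powr p" using sm \<sigma>r by blast
          also have "\<dots> \<le> \<epsilon> * h powr p"
            using \<epsilon>(1) p0 h by (intro mult_left_mono powr_mono2) (auto simp: \<sigma>_def)
          finally show "IG \<sigma> \<le> \<epsilon> * h powr p" .
        qed (use M in auto)
        finally show ?thesis .
      qed
      have e2: "I2 (\<rho>\<^sub>0 + h / 2) / (h / 2)\<^sup>2 \<le> 4 * (2 * c * M * Y)"
      proof -
        have "I2 (\<rho>\<^sub>0 + h / 2) \<le> I2 \<sigma>" using mono h by (auto simp: \<sigma>_def)
        then have "I2 (\<rho>\<^sub>0 + h / 2) / h\<^sup>2 \<le> I2 \<sigma> / h\<^sup>2" by (intro divide_right_mono) auto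
        moreover have "I2 (\<rho>\<^sub>0 + h / 2) / (h / 2)\<^sup>2 = 4 * (I2 (\<rho>\<^sub>0 + h / 2) / h\<^sup>2)"
          by (simp add: power_divide)
        ultimately show ?thesis using I\<sigma>' by linarith
      qed
      have "T (h / 2) \<le> M * (\<epsilon> * h powr p + 16 * (2 * c * M * Y)) + 4 * (2 * c * M * Y)"
        using e1 e2 nn unfolding T_def by (smt (verit))
      also have "\<dots> \<le> M * \<epsilon> * h powr p + 40 * c * M\<^sup>2 * Y"
      proof -
        have "M \<le> M\<^sup>2" using M by (simp add: power2_eq_square)
        then have "8 * c * Y * M \<le> 8 * c * Y * M\<^sup>2" using c Y by (intro mult_left_mono) auto
        then show ?thesis by (simp add: algebra_simps power2_eq_square)
      qed
      also have "\<dots> \<le> A * 2 powr (- p) / 2 * h powr p + 40 * c * M\<^sup>2 * Y"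
        using \<epsilon>(2) by (intro add_right_mono mult_right_mono) auto
      also have "40 * c * M\<^sup>2 = 2 powr (- p) / 2" using M by (simp add: c_def)
      also have "A * 2 powr (- p) / 2 * h powr p + 2 powr (- p) / 2 * Y = A * (h / 2) powr p"
        using h by (simp add: Y_def powr_divide powr_minus_divide field_simps)
      finally show ?thesis .
    qed
    have Tk: "T (d / 2 ^ k) \<le> A * (d / 2 ^ k) powr p" for k
    proof (induction k)
      case 0
      then show ?case using start by simp
    next
      case (Suc k)
      have "d / 2 ^ k \<le> d" using d by (simp add: divide_le_eq)
      then show ?case using step[of "d / 2 ^ k"] d Suc by (simp add: mult.commute)
    qed
    \<comment> \<open>Along h = d / 2^k the energy bound gives at most A h^(p+2) for |g|^2; keeping
      a single factor h of this is enough for a geometric decay, and monotonicity carries the bound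
      to the radius \<open>\<rho>\<^sub>0\<close>.\<close>
    have bound: "I2 \<rho>\<^sub>0 \<le> A * d powr p * d\<^sup>2 * (1 / 2) ^ k" for k
    proof -
      define h where "h = d / 2 ^ k"
      have h: "h > 0" "h \<le> d" using d by (auto simp: h_def divide_le_eq)
      have "I2 (\<rho>\<^sub>0 + h) / h\<^sup>2 \<le> T h" using nn unfolding T_def by simp
      also have "\<dots> \<le> A * h powr p" using Tk h_def by simp
      finally have "I2 (\<rho>\<^sub>0 + h) \<le> A * h powr p * h\<^sup>2" using h by (simp add: divide_le_eq)
      also have "\<dots> \<le> A * d powr p * (d * h)"
        unfolding power2_eq_square using A h p0 by (intro mult_mono powr_mono2) auto
      finally have "I2 (\<rho>\<^sub>0 + h) \<le> A * d powr p * (d * h)" .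
      moreover have "I2 \<rho>\<^sub>0 \<le> I2 (\<rho>\<^sub>0 + h)" using mono h by auto
      ultimately show ?thesis by (simp add: h_def power2_eq_square power_divide)
    qed
    have "(\<lambda>k. A * d powr p * d\<^sup>2 * (1 / 2) ^ k) \<longlonglongrightarrow> A * d powr p * d\<^sup>2 * 0"
      by (intro tendsto_intros LIMSEQ_power_zero) simp
    then show "I2 \<rho>\<^sub>0 \<le> 0"
      using bound by (intro LIMSEQ_le_const) auto
  qed
qed

section \<open>From the local weak solution to the iteration\<close>

text \<open>Test functions supported in U see only the restrictions to U. Testing with
  \<open>cnj z * \<psi> x\<close> gives the real part of z times the equation; z = 1 and z = \<i>
  together recover the complex identity.\<close>

lemma weak_sol_weak_eq:
  fixes g G :: "'a::euclidean_space \<Rightarrow> complex"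
  assumes w: "weak_sol \<Omega> m a b c G g Dg" and U: "U \<subseteq> \<Omega>"
    and Dg: "\<And>i. i \<in> Basis \<Longrightarrow> L2z U (restr U (Dg i))"
  shows "weak_eq U (\<lambda>i. restr U (Dg i)) (reaction m a b c (restr U g)) (restr U G)"
  unfolding weak_eq_def
proof (intro allI impI)
  fix \<psi> :: "'a \<Rightarrow> complex" assume tf: "test_fun U \<psi>"
  define X where "X = (LINT x|lebesgue. (\<Sum>i\<in>Basis. restr U (Dg i) x * cnj (pd \<psi> i x)))"
  define F where "F = (LINT x|lebesgue. reaction m a b c (restr U g) x * cnj (\<psi> x))"
  define H where "H = (LINT x|lebesgue. restr U G x * cnj (\<psi> x))"
  have re: "Re (z * X) + Re (z * F) = Re (z * H)" for z
  proof -
    let ?\<phi> = "\<lambda>x. cnj z * \<psi> x"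
    have k: "C_inf \<psi>" using tf by (simp add: test_fun_def)
    have pd: "pd ?\<phi> i x = cnj z * pd \<psi> i x" for i x
      using frechet_derivative_at[OF bounded_linear.has_derivative[OF bounded_linear_mult_right C_inf_has_derivative[OF k], of "cnj z" x], symmetric]
      by (simp add: pd_def)
    have cl: "closure {x. ?\<phi> x \<noteq> 0} \<subseteq> closure {x. \<psi> x \<noteq> 0}" by (intro closure_mono) auto
    then have "compact (closure {x. ?\<phi> x \<noteq> 0})"
      using tf bounded_subset[OF compact_imp_bounded cl] by (simp add: test_fun_def compact_eq_bounded_closed)
    then have "test_fun \<Omega> ?\<phi>"
      using cl tf U C_inf_bounded_linear[OF bounded_linear_mult_right k, of "cnj z"]
      unfolding test_fun_def by blast
    then have eq: "Re (LINT x:\<Omega>|lebesgue. (\<Sum>i\<in>Basis. Dg i x * cnj (pd ?\<phi> i x)))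
      + Re (LINT x:\<Omega>|lebesgue. (a * nl m (g x) + b * g x
              + c * complex_of_real ((norm x)\<^sup>2) * g x) * cnj (?\<phi> x))
      = Re (LINT x:\<Omega>|lebesgue. G x * cnj (?\<phi> x))"
      using w unfolding weak_sol_def by blast
    have off: "\<psi> x = 0" "pd \<psi> i x = 0" if "x \<notin> U" for x i
      using test_fun_support[OF tf that] by auto
    have 1: "(LINT x:\<Omega>|lebesgue. (\<Sum>i\<in>Basis. Dg i x * cnj (pd ?\<phi> i x))) = z * X"
      unfolding set_lebesgue_integral_def X_def integral_mult_right_zero[symmetric]
    proof (rule Bochner_Integration.integral_cong[OF refl])
      fix x
      show "indicat_real \<Omega> x *\<^sub>R (\<Sum>i\<in>Basis. Dg i x * cnj (pd ?\<phi> i x)) = z * (\<Sum>i\<in>Basis. restr U (Dg i) x * cnj (pd \<psi> i x))"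
        using U off[of x] by (cases "x \<in> U") (auto simp: pd restr_def sum_distrib_left mult_ac indicator_def)
    qed
    have 2: "(LINT x:\<Omega>|lebesgue. (a * nl m (g x) + b * g x
              + c * complex_of_real ((norm x)\<^sup>2) * g x) * cnj (?\<phi> x)) = z * F"
      unfolding set_lebesgue_integral_def F_def integral_mult_right_zero[symmetric]
    proof (rule Bochner_Integration.integral_cong[OF refl])
      fix x
      show "indicat_real \<Omega> x *\<^sub>R ((a * nl m (g x) + b * g x + c * complex_of_real ((norm x)\<^sup>2) * g x) * cnj (?\<phi> x))
          = z * (reaction m a b c (restr U g) x * cnj (\<psi> x))"
        using U off(1)[of x] by (cases "x \<in> U") (auto simp: reaction_def restr_def mult_ac indicator_def)
    qed
    have 3: "(LINT x:\<Omega>|lebesgue. G x * cnj (?\<phi> x)) = z * H"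
      unfolding set_lebesgue_integral_def H_def integral_mult_right_zero[symmetric]
    proof (rule Bochner_Integration.integral_cong[OF refl])
      fix x
      show "indicat_real \<Omega> x *\<^sub>R (G x * cnj (?\<phi> x)) = z * (restr U G x * cnj (\<psi> x))"
        using U off(1)[of x] by (cases "x \<in> U") (auto simp: restr_def mult_ac indicator_def)
    qed
    show ?thesis using eq unfolding 1 2 3 .
  qed
  have "X + F = H"
    using re[of 1] re[of \<i>] by (auto simp: complex_eq_iff)
  moreover have "X = (\<Sum>i\<in>Basis. LINT x|lebesgue. restr U (Dg i) x * cnj (pd \<psi> i x))"
    unfolding X_def
  proof (rule Bochner_Integration.integral_sum)
    fix i :: 'a assume "i \<in> Basis"
    note k = kernel_pd[OF test_fun_kernel[OF tf], of i]
    show "integrable lebesgue (\<lambda>x. restr U (Dg i) x * cnj (pd \<psi> i x))"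
      using Dg[OF \<open>i \<in> Basis\<close>]
      by (intro L2_times_integrable[OF _ kernel_lebesgue[OF k] _ kernel_sqn_finite[OF k]]) (auto simp: L2z_def)
  qed
  ultimately show "(\<Sum>i\<in>Basis. LINT x|lebesgue. restr U (Dg i) x * cnj (pd \<psi> i x))
      + (LINT x|lebesgue. reaction m a b c (restr U g) x * cnj (\<psi> x)) = (LINT x|lebesgue. restr U G x * cnj (\<psi> x))"
    unfolding F_def H_def by simp
qed

text \<open>A connected set that meets \<Omega> but not its frontier stays in \<Omega>, and a closed
  ball of radius below the distance to the frontier misses the frontier.\<close>

lemma cball_subset_of_infdist:
  fixes x :: "'a::euclidean_space"
  assumes "open \<Omega>" "bounded \<Omega>" "x \<in> \<Omega>" "r < R" "R \<le> infdist x (frontier \<Omega>)"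
  shows "cball x r \<subseteq> \<Omega>"
proof (cases "r < 0")
  case False
  have "y \<notin> frontier \<Omega>" if "y \<in> cball x r" for y
    using that assms(4,5) infdist_le[of y "frontier \<Omega>" x] by auto
  then have "cball x r \<inter> frontier \<Omega> = {}" by blast
  moreover have "x \<in> cball x r \<inter> \<Omega>" using False assms(3) by simp
  ultimately show ?thesis
    using connected_Int_frontier[OF connected_cball, of x r \<Omega>] by blast
qed simp

lemma bint_mono_radius:
  assumes "integrable lebesgue (\<lambda>x. indicat_real (ball x0 r) x * f x)" "integrable lebesgue (\<lambda>x. indicat_real (ball x0 s) x * f x)"
    and "r \<le> s" "\<And>x. f x \<ge> 0"
  shows "bint x0 f r \<le> bint x0 f s"
  unfolding bint_def using assms(3,4) by (intro integral_mono assms(1,2)) (auto simp: indicator_def)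

lemma bint_restr:
  assumes "L2z U (restr U f)"
  shows "ennreal (bsq x0 (restr U f) s) = set_nn_integral lebesgue (U \<inter> ball x0 s) (\<lambda>x. ennreal ((cmod (f x))\<^sup>2))"
proof -
  have "ennreal (bsq x0 (restr U f) s) = (\<integral>\<^sup>+x. ennreal (indicat_real (ball x0 s) x * (cmod (restr U f x))\<^sup>2) \<partial>lebesgue)"
    unfolding bint_def using bint_integrable[OF assms] by (intro nn_integral_eq_integral[symmetric]) auto
  also have "\<dots> = set_nn_integral lebesgue (U \<inter> ball x0 s) (\<lambda>x. ennreal ((cmod (f x))\<^sup>2))"
    by (intro nn_integral_cong) (auto simp: indicator_def restr_def)
  finally show ?thesis .
qed

theorem theorem2p5:
  fixes \<Omega> :: "'n::euclidean_space set" and R m \<rho>\<^sub>0 \<rho>\<^sub>1 :: real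
    and a b c :: complex and x\<^sub>0 :: 'n
  assumes "\<Omega> \<noteq> {}" and "open \<Omega>" and "bounded \<Omega>" and "\<Omega> \<subseteq> ball 0 R"
    and "0 < m" and "m < 1"
    and "Im a \<le> 0" and "Im b < 0" and "Im c \<le> 0" and "Re a \<le> 0 \<longrightarrow> Im a < 0"
    and "x\<^sub>0 \<in> \<Omega>" and "0 < \<rho>\<^sub>1" and "0 < \<rho>\<^sub>0" and "\<rho>\<^sub>0 < \<rho>\<^sub>1"
  shows "\<exists>E>0. \<exists>\<epsilon>>0. \<forall>(G::'n \<Rightarrow> complex) (g::'n \<Rightarrow> complex) (Dg::'n \<Rightarrow> 'n \<Rightarrow> complex).
      L1_loc \<Omega> G \<longrightarrow> H1_loc \<Omega> g Dg \<longrightarrow> weak_sol \<Omega> m a b c G g Dg \<longrightarrow>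
      (\<rho>\<^sub>1 > infdist x\<^sub>0 (frontier \<Omega>) \<longrightarrow> H1_0 \<Omega> g Dg) \<longrightarrow>
      set_nn_integral lebesgue (\<Omega> \<inter> ball x\<^sub>0 \<rho>\<^sub>1)
         (\<lambda>x. ennreal (\<Sum>i\<in>Basis. (cmod (Dg i x))\<^sup>2)) < ennreal E \<longrightarrow>
      (\<forall>\<rho>. 0 < \<rho> \<and> \<rho> < \<rho>\<^sub>1 \<longrightarrow>
         set_nn_integral lebesgue (\<Omega> \<inter> ball x\<^sub>0 \<rho>) (\<lambda>x. ennreal ((cmod (G x))\<^sup>2))
           \<le> ennreal (\<epsilon> * (max 0 (\<rho> - \<rho>\<^sub>0)) powr
                ((2 * (1 + m) + real DIM('n) * (1 - m)) / (1 - m)))) \<longrightarrow>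
      (AE x in lebesgue. x \<in> \<Omega> \<inter> ball x\<^sub>0 \<rho>\<^sub>0 \<longrightarrow> g x = 0)"
proof -
  \<comment> \<open>Staying strictly below \<open>\<rho>\<^sub>1\<close> gives a compact ball inside
    \<Omega> in the interior case, where local square integrability becomes square integrability,
    and makes the bound on G applicable at the radius \<open>r1\<close> itself.\<close>
  define r1 where "r1 = (\<rho>\<^sub>0 + \<rho>\<^sub>1) / 2"
  have r1: "\<rho>\<^sub>0 < r1" "r1 < \<rho>\<^sub>1" "0 < r1" using assms(13,14) by (auto simp: r1_def)
  define U where "U = \<Omega> \<inter> ball x\<^sub>0 r1"
  have U: "open U" "bounded U" "U \<subseteq> ball 0 R" "U \<subseteq> \<Omega>" "U \<subseteq> ball x\<^sub>0 r1" "U \<in> sets lebesgue"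
    using assms(2-4) by (auto simp: U_def)
  obtain K where K: "K \<ge> 1" "coercive R a b c K"
    using coercivity[OF assms(7-10)] by blast
  obtain C where C: "C > 0" "\<And>(x0::'n) r s. 0 < r \<Longrightarrow> r < s \<Longrightarrow> \<exists>\<kappa>. cutoff C x0 r s \<kappa>"
    using cutoff_exists by blast
  define M1 where "M1 = 8 * real DIM('n) * K\<^sup>2 * (1 + C\<^sup>2)"
  define M2 where "M2 = 64 * (real DIM('n))\<^sup>2 * (1 + C\<^sup>2) + 18 * (4 powr (1 - m) * (9 / unit_ball_vol (real DIM('n))) powr ((1 - m) / (1 + m)))"
  define M where "M = max 1 (max M1 M2)"
  have M: "M \<ge> 1" "M1 \<le> M" "M2 \<le> M" by (auto simp: M_def)
  define p where "p = (2 * (1 + m) + real DIM('n) * (1 - m)) / (1 - m)"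
  obtain E \<epsilon> where E: "E > 0" and \<epsilon>: "\<epsilon> > 0" and iter: "\<And>ID Iq I2 IG :: real \<Rightarrow> real.
    (\<forall>r. 0 \<le> ID r \<and> 0 \<le> Iq r \<and> 0 \<le> I2 r \<and> 0 \<le> IG r) \<Longrightarrow>
    (\<forall>r s. r \<le> s \<longrightarrow> ID r \<le> ID s \<and> I2 r \<le> I2 s) \<Longrightarrow>
    (\<forall>r s. 0 < r \<and> r < s \<and> s < r1 \<longrightarrow> ID r + Iq r + I2 r \<le> M * (IG s + I2 s / (s - r)\<^sup>2)) \<Longrightarrow>
    (\<forall>r s. 0 < r \<and> r < s \<and> s < r1 \<longrightarrow> ID r + Iq r + I2 r \<le> M * (IG s + ID s / (s - r)\<^sup>2)) \<Longrightarrow>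
    (\<forall>r s l Y :: real. 0 < r \<and> r < s \<and> s < r1 \<and> 0 < l \<and> 0 < Y \<and> Iq s \<le> Y \<longrightarrow>
       I2 r \<le> M * (l\<^sup>2 * (ID s + I2 s / (s - r)\<^sup>2) + (Y / l ^ DIM('n)) powr ((1 - m) / (1 + m)) * Y)) \<Longrightarrow>
    (\<forall>s. 0 < s \<and> s < r1 \<longrightarrow> ID s \<le> E \<and> IG s \<le> \<epsilon> * (max 0 (s - \<rho>\<^sub>0)) powr p) \<Longrightarrow> I2 \<rho>\<^sub>0 \<le> 0"
    using energy_iteration[OF assms(5,6) M(1) assms(13) r1(1) p_def] by blast
  show ?thesis
    unfolding p_def[symmetric]
  proof (rule exI[of _ E], rule conjI[OF E], rule exI[of _ \<epsilon>], rule conjI[OF \<epsilon>], intro allI impI)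
    fix G g :: "'n \<Rightarrow> complex" and Dg :: "'n \<Rightarrow> 'n \<Rightarrow> complex"
    assume LG: "L1_loc \<Omega> G" and Hl: "H1_loc \<Omega> g Dg" and ws: "weak_sol \<Omega> m a b c G g Dg"
      and H0: "\<rho>\<^sub>1 > infdist x\<^sub>0 (frontier \<Omega>) \<longrightarrow> H1_0 \<Omega> g Dg"
      and DE: "set_nn_integral lebesgue (\<Omega> \<inter> ball x\<^sub>0 \<rho>\<^sub>1) (\<lambda>x. ennreal (\<Sum>i\<in>Basis. (cmod (Dg i x))\<^sup>2)) < ennreal E"
      and G\<epsilon>: "\<forall>\<rho>. 0 < \<rho> \<and> \<rho> < \<rho>\<^sub>1 \<longrightarrow>
         set_nn_integral lebesgue (\<Omega> \<inter> ball x\<^sub>0 \<rho>) (\<lambda>x. ennreal ((cmod (G x))\<^sup>2)) \<le> ennreal (\<epsilon> * (max 0 (\<rho> - \<rho>\<^sub>0)) powr p)"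
    define g' where "g' = restr U g"
    define D' where "D' i = restr U (Dg i)" for i
    define G' where "G' = restr U G"
    \<comment> \<open>The two alternatives on \<open>\<rho>\<^sub>1\<close> are treated here and
      only here: both lead to the same integrability and to the admissibility of cutoffs of
      g.\<close>
    have loc: "L2z U g' \<and> (\<forall>i\<in>Basis. L2z U (D' i)) \<and> (\<forall>\<eta> s. C_inf \<eta> \<longrightarrow> closure {x. \<eta> x \<noteq> 0} \<subseteq> ball x\<^sub>0 s \<longrightarrow> s < r1 \<longrightarrow>
        H10c U (\<lambda>x. \<eta> x *\<^sub>R g' x) (\<lambda>i x. \<eta> x *\<^sub>R D' i x + fd \<eta> i x *\<^sub>R g' x))"
    proof (cases "\<rho>\<^sub>1 > infdist x\<^sub>0 (frontier \<Omega>)")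
      case True
      then have H: "H1_0 \<Omega> g Dg" using H0 by blast
      have z: "L2z U (restr U f)" if "L2 \<Omega> f" for f
        using that restr_L2[of \<Omega> f \<Omega> U] U by (auto simp: L2z_def L2_def restr_def)
      show ?thesis
        unfolding g'_def D'_def
      proof (intro conjI ballI allI impI z)
        fix \<eta> :: "'n \<Rightarrow> real" and s :: real
        assume \<eta>: "C_inf \<eta>" "closure {x. \<eta> x \<noteq> 0} \<subseteq> ball x\<^sub>0 s" "s < r1"
        then have "closure {x. \<eta> x \<noteq> 0} \<subseteq> ball x\<^sub>0 r1" by (meson less_imp_le order_trans subset_ball)
        then show "H10c U (\<lambda>x. \<eta> x *\<^sub>R restr U g x) (\<lambda>i x. \<eta> x *\<^sub>R restr U (Dg i) x + fd \<eta> i x *\<^sub>R restr U g x)"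
          by (rule H10c_cutoff_global[OF H assms(2) U_def \<eta>(1)])
      qed (use H in \<open>auto simp: H1_0_def\<close>)
    next
      case False
      then have cb: "cball x\<^sub>0 r1 \<subseteq> \<Omega>"
        using cball_subset_of_infdist[OF assms(2,3,11) r1(2)] by simp
      then have Ub: "U = ball x\<^sub>0 r1" "ball x\<^sub>0 r1 \<subseteq> \<Omega>" using ball_subset_cball by (auto simp: U_def)
      have z: "L2z U (restr U f)" if f: "L2_loc \<Omega> f" for f
      proof -
        have "set_borel_measurable lebesgue \<Omega> f" "set_integrable lebesgue (cball x\<^sub>0 r1) (\<lambda>x. (cmod (f x))\<^sup>2)"
          using f cb by (auto simp: L2_loc_def)
        from restr_L2[OF this U(6,4)] show ?thesis
          using Ub(1) by (auto simp: L2z_def restr_def)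
      qed
      have zg: "L2z U (restr U g)" and zD: "\<And>i. i \<in> Basis \<Longrightarrow> L2z U (restr U (Dg i))"
        using Hl z by (auto simp: H1_loc_def)
      show ?thesis
        unfolding g'_def D'_def
      proof (intro conjI ballI allI impI zg zD)
        fix \<eta> :: "'n \<Rightarrow> real" and s :: real
        assume \<eta>: "C_inf \<eta>" "closure {x. \<eta> x \<noteq> 0} \<subseteq> ball x\<^sub>0 s" "s < r1"
        have "weak_grad \<Omega> g Dg" using Hl by (simp add: H1_loc_def)
        then show "H10c U (\<lambda>x. \<eta> x *\<^sub>R restr U g x) (\<lambda>i x. \<eta> x *\<^sub>R restr U (Dg i) x + fd \<eta> i x *\<^sub>R restr U g x)"
          using zg zD unfolding Ub(1) L2z_def by (intro H10c_cutoff_interior[OF _ Ub(2) _ _ _ _ \<eta>]) auto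
      qed
    qed
    then have g': "L2z U g'" and D': "\<And>i. i \<in> Basis \<Longrightarrow> L2z U (D' i)"
      and Hc: "\<And>\<eta> s. C_inf \<eta> \<Longrightarrow> closure {x. \<eta> x \<noteq> 0} \<subseteq> ball x\<^sub>0 s \<Longrightarrow> s < r1 \<Longrightarrow>
        H10c U (\<lambda>x. \<eta> x *\<^sub>R g' x) (\<lambda>i x. \<eta> x *\<^sub>R D' i x + fd \<eta> i x *\<^sub>R g' x)" by blast+
    \<comment> \<open>Square integrability of G on U comes from the growth hypothesis at radius
      \<open>r1\<close>, and measurability from \<open>L1_loc\<close>.\<close>
    have G': "L2z U G'"
    proof -
      have "sqn (restr U G) = set_nn_integral lebesgue (\<Omega> \<inter> ball x\<^sub>0 r1) (\<lambda>x. ennreal ((cmod (G x))\<^sup>2))"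
        unfolding sqn_def U_def by (intro nn_integral_cong) (auto simp: indicator_def restr_def)
      also have "\<dots> < \<infinity>" using G\<epsilon> r1 by (auto intro: le_less_trans)
      finally have "sqn (restr U G) < \<infinity>" .
      moreover have "restr U G \<in> borel_measurable lebesgue"
      proof -
        have "restr U G = (\<lambda>x. indicat_real U x *\<^sub>R (indicat_real \<Omega> x *\<^sub>R G x))"
          using U(4) by (intro ext) (auto simp: restr_def indicator_def)
        then show ?thesis
          using LG U(6) unfolding L1_loc_def set_borel_measurable_def
          by (metis borel_measurable_scaleR borel_measurable_indicator)
      qed
      ultimately show ?thesis by (simp add: G'_def L2z_def restr_def)
    qed
    have we: "weak_eq U D' (reaction m a b c g') G'"
      using weak_sol_weak_eq[OF ws U(4)] D' unfolding D'_def[abs_def] g'_def G'_def by blast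
    define ID where "ID s = (\<Sum>i\<in>Basis. bsq x\<^sub>0 (D' i) s)" for s
    define Iq where "Iq = bint x\<^sub>0 (\<lambda>x. cmod (g' x) powr (1 + m))"
    define I2 where "I2 = bsq x\<^sub>0 g'"
    define IG where "IG = bsq x\<^sub>0 G'"
    have "I2 \<rho>\<^sub>0 \<le> 0"
    proof (rule iter)
      show nn: "\<forall>r. 0 \<le> ID r \<and> 0 \<le> Iq r \<and> 0 \<le> I2 r \<and> 0 \<le> IG r"
        unfolding ID_def Iq_def I2_def IG_def bint_def by (auto intro!: sum_nonneg integral_nonneg_AE)
      show "\<forall>r s. r \<le> s \<longrightarrow> ID r \<le> ID s \<and> I2 r \<le> I2 s"
        unfolding ID_def I2_def using g' D' by (auto intro!: sum_mono bint_mono_radius bint_integrable)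
      show "\<forall>r s. 0 < r \<and> r < s \<and> s < r1 \<longrightarrow> ID r + Iq r + I2 r \<le> M * (IG s + I2 s / (s - r)\<^sup>2)"
      proof (intro allI impI)
        fix r s :: real assume rs: "0 < r \<and> r < s \<and> s < r1"
        then obtain \<kappa> where \<kappa>: "cutoff C x\<^sub>0 r s \<kappa>" using C(2) by blast
        have "ID r + Iq r + I2 r \<le> M1 * (IG s + I2 s / (s - r)\<^sup>2)"
          unfolding ID_def Iq_def I2_def IG_def using rs
          by (intro energy_local(1)[OF U(1-3) assms(5,6) g' D' G' we K Hc \<kappa> _ C(1) M1_def]) auto
        also have "\<dots> \<le> M * (IG s + I2 s / (s - r)\<^sup>2)" using nn M by (intro mult_right_mono) auto
        finally show "ID r + Iq r + I2 r \<le> M * (IG s + I2 s / (s - r)\<^sup>2)" .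
      qed
      show "\<forall>r s. 0 < r \<and> r < s \<and> s < r1 \<longrightarrow> ID r + Iq r + I2 r \<le> M * (IG s + ID s / (s - r)\<^sup>2)"
      proof (intro allI impI)
        fix r s :: real assume rs: "0 < r \<and> r < s \<and> s < r1"
        then obtain \<kappa> where \<kappa>: "cutoff C x\<^sub>0 r s \<kappa>" using C(2) by blast
        have "ID r + Iq r + I2 r \<le> M1 * (IG s + ID s / (s - r)\<^sup>2)"
          unfolding ID_def Iq_def I2_def IG_def using rs
          by (intro energy_local(2)[OF U(1-3) assms(5,6) g' D' G' we K Hc \<kappa> _ C(1) M1_def]) auto
        also have "\<dots> \<le> M * (IG s + ID s / (s - r)\<^sup>2)" using nn M by (intro mult_right_mono) auto
        finally show "ID r + Iq r + I2 r \<le> M * (IG s + ID s / (s - r)\<^sup>2)" .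
      qed
      show "\<forall>r s l Y :: real. 0 < r \<and> r < s \<and> s < r1 \<and> 0 < l \<and> 0 < Y \<and> Iq s \<le> Y \<longrightarrow>
       I2 r \<le> M * (l\<^sup>2 * (ID s + I2 s / (s - r)\<^sup>2) + (Y / l ^ DIM('n)) powr ((1 - m) / (1 + m)) * Y)"
      proof (intro allI impI)
        fix r s l Y :: real assume rs: "0 < r \<and> r < s \<and> s < r1 \<and> 0 < l \<and> 0 < Y \<and> Iq s \<le> Y"
        then obtain \<kappa> where \<kappa>: "cutoff C x\<^sub>0 r s \<kappa>" using C(2) by blast
        let ?X = "l\<^sup>2 * (ID s + I2 s / (s - r)\<^sup>2) + (Y / l ^ DIM('n)) powr ((1 - m) / (1 + m)) * Y"
        have r: "r < s" "l > 0" "Y > 0" "s < r1" using rs by auto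
        have IY: "bint x\<^sub>0 (\<lambda>x. cmod (g' x) powr (1 + m)) s \<le> Y" using rs by (simp add: Iq_def)
        have "I2 r \<le> M2 * ?X"
          unfolding ID_def I2_def
          by (rule interpolation_local[OF U(1,2) assms(5,6) g' D' Hc \<kappa> r(1) C(1) r(2,3) IY M2_def])
            (use cutoff_facts(2,3)[OF \<kappa> r(1)] r(4) in auto)
        also have "\<dots> \<le> M * ?X" using nn M r by (intro mult_right_mono) auto
        finally show "I2 r \<le> M * ?X" .
      qed
      show "\<forall>s. 0 < s \<and> s < r1 \<longrightarrow> ID s \<le> E \<and> IG s \<le> \<epsilon> * (max 0 (s - \<rho>\<^sub>0)) powr p"
      proof (intro allI impI conjI)
        fix s :: real assume s: "0 < s \<and> s < r1"
        have "ennreal (ID s) = (\<Sum>i\<in>Basis. ennreal (bsq x\<^sub>0 (D' i) s))"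
          unfolding ID_def by (rule sum_ennreal[symmetric]) (auto simp: bint_def)
        also have "\<dots> = (\<Sum>i\<in>Basis. \<integral>\<^sup>+x. ennreal (indicat_real (ball x\<^sub>0 s) x * (cmod (D' i x))\<^sup>2) \<partial>lebesgue)"
          unfolding bint_def
        proof (rule sum.cong[OF refl])
          fix i :: 'n assume "i \<in> Basis"
          from bint_integrable[OF D'[OF this], of x\<^sub>0 s]
          show "ennreal (LINT x|lebesgue. indicat_real (ball x\<^sub>0 s) x * (cmod (D' i x))\<^sup>2)
              = (\<integral>\<^sup>+x. ennreal (indicat_real (ball x\<^sub>0 s) x * (cmod (D' i x))\<^sup>2) \<partial>lebesgue)"
            by (intro nn_integral_eq_integral[symmetric]) auto
        qed
        also have "\<dots> = (\<integral>\<^sup>+x. (\<Sum>i\<in>Basis. ennreal (indicat_real (ball x\<^sub>0 s) x * (cmod (D' i x))\<^sup>2)) \<partial>lebesgue)"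
        proof (rule nn_integral_sum[symmetric])
          fix i :: 'n assume "i \<in> Basis"
          from bint_integrable[OF D'[OF this], of x\<^sub>0 s]
          show "(\<lambda>x. ennreal (indicat_real (ball x\<^sub>0 s) x * (cmod (D' i x))\<^sup>2)) \<in> borel_measurable lebesgue"
            by (intro measurable_compose[OF _ measurable_ennreal]) auto
        qed
        also have "\<dots> \<le> set_nn_integral lebesgue (\<Omega> \<inter> ball x\<^sub>0 \<rho>\<^sub>1) (\<lambda>x. ennreal (\<Sum>i\<in>Basis. (cmod (Dg i x))\<^sup>2))"
        proof (rule nn_integral_mono)
          fix x
          show "(\<Sum>i\<in>Basis. ennreal (indicat_real (ball x\<^sub>0 s) x * (cmod (D' i x))\<^sup>2))
            \<le> ennreal (\<Sum>i\<in>Basis. (cmod (Dg i x))\<^sup>2) * indicator (\<Omega> \<inter> ball x\<^sub>0 \<rho>\<^sub>1) x"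
          proof (cases "x \<in> U \<inter> ball x\<^sub>0 s")
            case True
            then have "x \<in> \<Omega> \<inter> ball x\<^sub>0 \<rho>\<^sub>1" using U(4) s r1 by auto
            then show ?thesis using True by (simp add: D'_def restr_def sum_ennreal)
          next
            case False
            then show ?thesis by (auto simp: D'_def restr_def indicator_def)
          qed
        qed
        also have "\<dots> < ennreal E" by (rule DE)
        finally show "ID s \<le> E" using E nn by (subst (asm) ennreal_less_iff) auto
        have "ennreal (IG s) = set_nn_integral lebesgue (U \<inter> ball x\<^sub>0 s) (\<lambda>x. ennreal ((cmod (G x))\<^sup>2))"
          unfolding IG_def G'_def by (rule bint_restr) (use G' in \<open>simp add: G'_def\<close>)
        also have "U \<inter> ball x\<^sub>0 s = \<Omega> \<inter> ball x\<^sub>0 s" using s by (auto simp: U_def)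
        also have "set_nn_integral lebesgue (\<Omega> \<inter> ball x\<^sub>0 s) (\<lambda>x. ennreal ((cmod (G x))\<^sup>2)) \<le> ennreal (\<epsilon> * (max 0 (s - \<rho>\<^sub>0)) powr p)"
          using G\<epsilon> s r1 by auto
        finally show "IG s \<le> \<epsilon> * (max 0 (s - \<rho>\<^sub>0)) powr p" using \<epsilon> by (subst (asm) ennreal_le_iff) auto
      qed
    qed
    moreover have "I2 \<rho>\<^sub>0 \<ge> 0" unfolding I2_def bint_def by (intro integral_nonneg_AE) auto
    ultimately have "(LINT x|lebesgue. indicat_real (ball x\<^sub>0 \<rho>\<^sub>0) x * (cmod (g' x))\<^sup>2) = 0"
      unfolding I2_def bint_def by simp
    then have "AE x in lebesgue. indicat_real (ball x\<^sub>0 \<rho>\<^sub>0) x * (cmod (g' x))\<^sup>2 = 0"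
      by (subst (asm) integral_nonneg_eq_0_iff_AE[OF bint_integrable[OF g']]) auto
    then show "AE x in lebesgue. x \<in> \<Omega> \<inter> ball x\<^sub>0 \<rho>\<^sub>0 \<longrightarrow> g x = 0"
      by (rule eventually_mono) (use r1 in \<open>auto simp: g'_def restr_def U_def\<close>)
  qed
qed

end
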